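(* Let $\mathbb K$ be a commutative unital ring, $N=\{a_1<\dots<a_n\}\subset\mathbb N$ a finite set and $\alpha\subset N$. For $j\in N$ put $\langle\alpha,j\rangle=\{j\}$ if $j\in\alpha$ and $\langle\alpha,j\rangle=\emptyset$ if $j\notin\alpha$. Then $$\mathsf G^{\alpha;N}=\mathsf G^{\langle\alpha,a_n\rangle;\{a_n\}}\circ\mathsf G^{\langle\alpha,a_{n-1}\rangle;\{a_{n-1}\}}\circ\dots\circ\mathsf G^{\langle\alpha,a_1\rangle;\{a_1\}} .$$ This holds both for the vertex sets $\mathsf G^{\alpha;N}U$ of linear sets $U$ and for the vertex maps $\mathsf G^{\alpha;N}f$, where $f$ is either a $C^n$-map $f:U\to U'$ between open sets in the setting of topological differential calculus, or a polynomial law. In particular, the top and bottom vertex maps are $$\mathsf G^{N;N}f=(\dots(f^{\{a_1\}})^{\{a_2\}}\dots)^{\{a_n\}},\qquad \mathsf G^{\emptyset;N}f=f\times\mathrm{id}_{\mathbb K}^n .$$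
   Context: A linear set is a pair $(U,V)$, $V$ a $\mathbb K$-module, $U\subset V$. For $X$ a subset of a module $E$ and a label $k$: $\mathsf G^{\{k\};\{k\}}X=X^{\{k\}}=\{(x,v,t)\in E^2\times\mathbb K:x\in X,\ x+tv\in X\}$ and $\mathsf G^{\emptyset;\{k\}}X=X\times\mathbb K$; these are morphism and object sets of the groupoid $\mathsf G^{\{k\}}X$ with source $(x,t)$, target $(x+tv,t)$, units $(x,0,t)$, product $(x',v',t)*(x,v,t)=(x,v+v',t)$. For maps: $\mathsf G^{\{k\};\{k\}}f=f^{\{k\}}:(x,v,t)\mapsto(f(x),f^{[1]}(x,v,t),t)$ and $\mathsf G^{\emptyset;\{k\}}f=f\times\mathrm{id}_{\mathbb K}$. Here, for a polynomial law $f$ (family $f_A:V\otimes A\to W\otimes A$ natural in commutative $\mathbb K$-algebras $A$), $f^{[1]}$ is the polynomial law with $f_{A[T]}(x+Tv)=f_A(x)+TF$, $F\in W\otimes A[T]$, $f^{[1]}_A(x,v,t)=F|_{T=t}$. Topological differential calculus: $\mathbb K$ is a Hausdorff topological ring with dense unit group, $V,V'$ Hausdorff topological $\mathbb K$-modules, $U\subset V$, $U'\subset V'$ non-empty and open. $f:U\to U'$ is $C^1$ if it is continuous and there is a (unique) continuous $f^{[1]}:U^{\{1\}}\to V'$ with $f^{[1]}(x,v,t)=\frac{f(x+tv)-f(x)}t$ for invertible $t$; $f$ is $C^n$ if it is $C^{n-1}$ and $f^{[n-1]}$ is $C^1$, $f^{[n]}=(f^{[n-1]})^{[1]}$. The $n$-fold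 groupoid $\mathsf G^NU$ (vertex sets $\mathsf G^{\alpha;N}U$, $\alpha\subset N$) is $(\mathsf G^{\{a_n\}}\circ\dots\circ\mathsf G^{\{a_1\}})U$: it arises from the $(n-1)$-fold groupoid $\mathsf G^{N'}U$, $N'=N\setminus\{a_n\}$, by applying $\mathsf G^{\{a_n\}}$ to all its vertex sets and structure maps; a vertex set $X$ of $\mathsf G^{N'}U$ at $\alpha$ gives rise to the object set of $\mathsf G^{\{a_n\}}X$ at vertex $\alpha$ and to its morphism set at vertex $\alpha\cup\{a_n\}$. In the polynomial case, $\mathsf G^Nf$ (with vertex maps $\mathsf G^{\alpha;N}f$) arises from $\mathsf G^{N'}f$ by applying $\mathsf G^{\{a_n\}}$ in the same way. In the topological case, $\mathsf G^Nf$ is the unique family of continuous vertex maps $\mathsf G^{\alpha;N}U\to\mathsf G^{\alpha;N}U'$ that is a morphism of $n$-fold groupoids (a groupoid morphism for every edge $(\beta,\beta\cup\{i\})$) and whose vertex map at each $\alpha\subset N'$ is the vertex map $\mathsf G^{\alpha;N'}f$ times $\mathrm{id}_{\mathbb K}$, starting with $\mathsf G^\emptyset f=f$. *)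

theory Defs
  imports "HOL-Analysis.T1_Spaces" "HOL-Algebra.UnivPoly" "HOL-Algebra.Free_Abelian_Groups"
begin

section \<open>Points, modules and topologies\<close>

text \<open>Iterating \<open>E \<mapsto> E \<times> K\<close> and \<open>E \<mapsto> E \<times> E \<times> K\<close> leads through modules of ever larger type.
  Starting from a module with elements of type \<open>'v\<close>, all of them are placed in one type, in which
  \<open>Obj\<close> tags the pairs \<open>(x, t)\<close> and \<open>Mor\<close> the triples \<open>(x, v, t)\<close>.\<close>

datatype ('v, 'k) pt =
    Base 'v
  | Obj "('v, 'k) pt \<times> 'k"
  | Mor "('v, 'k) pt \<times> ('v, 'k) pt \<times> 'k"

primrec unBase :: "('v, 'k) pt \<Rightarrow> 'v" where
  "unBase (Base v) = v"

fun bpt :: "('v, 'k) pt \<Rightarrow> ('v, 'k) pt" where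
  "bpt (Obj (x, t)) = x"
| "bpt (Mor (x, v, t)) = x"

fun vpt :: "('v, 'k) pt \<Rightarrow> ('v, 'k) pt" where
  "vpt (Mor (x, v, t)) = v"

fun tpt :: "('v, 'k) pt \<Rightarrow> 'k" where
  "tpt (Obj (x, t)) = t"
| "tpt (Mor (x, v, t)) = t"

text \<open>Transport of structure along an injective \<open>\<phi>\<close>, which will always be a constructor.\<close>

definition wrap_mod :: "('a \<Rightarrow> 'b) \<Rightarrow> ('k, 'a) module \<Rightarrow> ('k, 'b) module" where
  "wrap_mod \<phi> M =
    \<lparr>carrier = \<phi> ` carrier M,
     monoid.mult = (\<lambda>x y. \<phi> (the_inv \<phi> x \<otimes>\<^bsub>M\<^esub> the_inv \<phi> y)),
     monoid.one = \<phi> \<one>\<^bsub>M\<^esub>,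
     ring.zero = \<phi> \<zero>\<^bsub>M\<^esub>,
     ring.add = (\<lambda>x y. \<phi> (the_inv \<phi> x \<oplus>\<^bsub>M\<^esub> the_inv \<phi> y)),
     smult = (\<lambda>k x. \<phi> (k \<odot>\<^bsub>M\<^esub> the_inv \<phi> x))\<rparr>"

definition wrap_top :: "('a \<Rightarrow> 'b) \<Rightarrow> 'a topology \<Rightarrow> 'b topology" where
  "wrap_top \<phi> T = pullback_topology (\<phi> ` topspace T) (the_inv \<phi>) T"

text \<open>A module record has a multiplication and a unit, which play no role for a module.\<close>

definition prod_mod :: "('k, 'a) module \<Rightarrow> ('k, 'b) module \<Rightarrow> ('k, 'a \<times> 'b) module" where
  "prod_mod E F =
    \<lparr>carrier = carrier E \<times> carrier F,
     monoid.mult = undefined,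
     monoid.one = undefined,
     ring.zero = (\<zero>\<^bsub>E\<^esub>, \<zero>\<^bsub>F\<^esub>),
     ring.add = (\<lambda>(x, y) (x', y'). (x \<oplus>\<^bsub>E\<^esub> x', y \<oplus>\<^bsub>F\<^esub> y')),
     smult = (\<lambda>k (x, y). (k \<odot>\<^bsub>E\<^esub> x, k \<odot>\<^bsub>F\<^esub> y))\<rparr>"

definition reg_mod :: "'k ring \<Rightarrow> ('k, 'k) module" where
  "reg_mod R =
    \<lparr>carrier = carrier R, monoid.mult = mult R, monoid.one = \<one>\<^bsub>R\<^esub>, ring.zero = \<zero>\<^bsub>R\<^esub>, ring.add = add R, smult = mult R\<rparr>"

definition obj_mod :: "'k ring \<Rightarrow> ('k, ('v, 'k) pt) module \<Rightarrow> ('k, ('v, 'k) pt) module" where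
  "obj_mod R E = wrap_mod Obj (prod_mod E (reg_mod R))"

definition mor_mod :: "'k ring \<Rightarrow> ('k, ('v, 'k) pt) module \<Rightarrow> ('k, ('v, 'k) pt) module" where
  "mor_mod R E = wrap_mod Mor (prod_mod E (prod_mod E (reg_mod R)))"


section \<open>Iteration over a finite set of labels\<close>

definition angle :: "nat set \<Rightarrow> nat \<Rightarrow> nat set" where
  "angle \<alpha> j = (if j \<in> \<alpha> then {j} else {})"

text \<open>In what follows \<open>G \<beta> k\<close>, with \<open>\<beta> = {}\<close> or \<open>\<beta> = {k}\<close>, is \<open>G\<^bsup>\<beta>;{k}\<^esup>\<close>, acting on linear sets or
  on maps given with their domain and codomain.  The right-hand side of the theorem is
  \<open>composite\<close>, where \<open>fold\<close> applies the functor of the smallest label first.\<close>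

definition composite :: "(nat set \<Rightarrow> nat \<Rightarrow> 's \<Rightarrow> 's) \<Rightarrow> nat set \<Rightarrow> nat set \<Rightarrow> 's \<Rightarrow> 's" where
  "composite G \<alpha> N = fold (\<lambda>j. G (angle \<alpha> j) j) (sorted_list_of_set N)"

text \<open>The vertices of an n-fold structure are built by recursion on the list \<open>[a\<^sub>n, \<dots>, a\<^sub>1]\<close>:
  each vertex of the structure for \<open>[a\<^sub>n\<^sub>-\<^sub>1, \<dots>, a\<^sub>1]\<close> yields the objects and the morphisms of its
  \<open>G\<^bsup>{a\<^sub>n}\<^esup>\<close>.\<close>

definition labels :: "nat set \<Rightarrow> nat list" where
  "labels N = rev (sorted_list_of_set N)"

primrec vertex :: "(nat set \<Rightarrow> nat \<Rightarrow> 's \<Rightarrow> 's) \<Rightarrow> nat list \<Rightarrow> 's \<Rightarrow> nat set \<Rightarrow> 's" where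
  "vertex G [] s \<alpha> = s"
| "vertex G (a # L) s \<alpha> =
    (if a \<in> \<alpha> then G {a} a (vertex G L s (\<alpha> - {a})) else G {} a (vertex G L s \<alpha>))"


section \<open>Linear sets\<close>

record ('k, 'a) linset =
  pts :: "'a set"
  amb :: "('k, 'a) module"

definition linear_set :: "'k ring \<Rightarrow> ('k, 'a, 'z) linset_scheme \<Rightarrow> bool" where
  "linear_set R S \<longleftrightarrow> module R (amb S) \<and> pts S \<subseteq> carrier (amb S)"

definition base_lin :: "('k, 'v) linset \<Rightarrow> ('k, ('v, 'k) pt) linset" where
  "base_lin S = \<lparr>pts = Base ` pts S, amb = wrap_mod Base (amb S)\<rparr>"

definition dom1 :: "'k ring \<Rightarrow> ('k, 'a, 'z) linset_scheme \<Rightarrow> ('a \<times> 'a \<times> 'k) set" where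
  "dom1 R S = {(x, v, t). x \<in> pts S \<and> v \<in> carrier (amb S) \<and> t \<in> carrier R
                          \<and> x \<oplus>\<^bsub>amb S\<^esub> (t \<odot>\<^bsub>amb S\<^esub> v) \<in> pts S}"

definition lin_G :: "'k ring \<Rightarrow> nat set \<Rightarrow> nat \<Rightarrow> ('k, ('v, 'k) pt) linset \<Rightarrow> ('k, ('v, 'k) pt) linset" where
  "lin_G R \<beta> k S =
    (if \<beta> = {k} then \<lparr>pts = Mor ` dom1 R S, amb = mor_mod R (amb S)\<rparr>
     else \<lparr>pts = Obj ` (pts S \<times> carrier R), amb = obj_mod R (amb S)\<rparr>)"


section \<open>Topological differential calculus\<close>

definition top_ring :: "'k ring \<Rightarrow> 'k topology \<Rightarrow> bool" where
  "top_ring R TK \<longleftrightarrow>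
    cring R \<and> topspace TK = carrier R
    \<and> continuous_map (prod_topology TK TK) TK (\<lambda>(a, b). a \<oplus>\<^bsub>R\<^esub> b)
    \<and> continuous_map TK TK (\<lambda>a. \<ominus>\<^bsub>R\<^esub> a)
    \<and> continuous_map (prod_topology TK TK) TK (\<lambda>(a, b). a \<otimes>\<^bsub>R\<^esub> b)"

definition top_module :: "'k ring \<Rightarrow> 'k topology \<Rightarrow> ('k, 'a) module \<Rightarrow> 'a topology \<Rightarrow> bool" where
  "top_module R TK E T \<longleftrightarrow>
    module R E \<and> topspace T = carrier E
    \<and> continuous_map (prod_topology T T) T (\<lambda>(x, y). x \<oplus>\<^bsub>E\<^esub> y)
    \<and> continuous_map T T (\<lambda>x. \<ominus>\<^bsub>E\<^esub> x)
    \<and> continuous_map (prod_topology TK T) T (\<lambda>(k, x). k \<odot>\<^bsub>E\<^esub> x)"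

record ('k, 'a) tlinset = "('k, 'a) linset" +
  tau :: "'a topology"  \<comment> \<open>the topology of the ambient module\<close>

definition open_set :: "'k ring \<Rightarrow> 'k topology \<Rightarrow> ('k, 'a) tlinset \<Rightarrow> bool" where
  "open_set R TK S \<longleftrightarrow>
    top_module R TK (amb S) (tau S) \<and> Hausdorff_space (tau S) \<and> openin (tau S) (pts S) \<and> pts S \<noteq> {}"

abbreviation subspace :: "('k, 'a) tlinset \<Rightarrow> 'a topology" where
  "subspace S \<equiv> subtopology (tau S) (pts S)"

definition whole :: "('k, 'a) tlinset \<Rightarrow> ('k, 'a) tlinset" where
  "whole S = S\<lparr>pts := carrier (amb S)\<rparr>"

definition base_top :: "('k, 'v) tlinset \<Rightarrow> ('k, ('v, 'k) pt) tlinset" where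
  "base_top S = \<lparr>pts = Base ` pts S, amb = wrap_mod Base (amb S), tau = wrap_top Base (tau S)\<rparr>"

definition base_map :: "('v \<Rightarrow> 'w) \<Rightarrow> ('v, 'k) pt \<Rightarrow> ('w, 'k) pt" where
  "base_map f = Base \<circ> f \<circ> unBase"

definition obj_top :: "'k ring \<Rightarrow> 'k topology \<Rightarrow> ('k, ('v, 'k) pt) tlinset \<Rightarrow> ('k, ('v, 'k) pt) tlinset" where
  "obj_top R TK S = \<lparr>pts = Obj ` (pts S \<times> carrier R), amb = obj_mod R (amb S),
                     tau = wrap_top Obj (prod_topology (tau S) TK)\<rparr>"

definition mor_top :: "'k ring \<Rightarrow> 'k topology \<Rightarrow> ('k, ('v, 'k) pt) tlinset \<Rightarrow> ('k, ('v, 'k) pt) tlinset" where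
  "mor_top R TK S = \<lparr>pts = Mor ` dom1 R S, amb = mor_mod R (amb S),
                     tau = wrap_top Mor (prod_topology (tau S) (prod_topology (tau S) TK))\<rparr>"

definition top_G ::
    "'k ring \<Rightarrow> 'k topology \<Rightarrow> nat set \<Rightarrow> nat \<Rightarrow> ('k, ('v, 'k) pt) tlinset \<Rightarrow> ('k, ('v, 'k) pt) tlinset" where
  "top_G R TK \<beta> k S = (if \<beta> = {k} then mor_top R TK S else obj_top R TK S)"

text \<open>The continuous extension of the difference quotient of \<open>f\<close> to a set \<open>Z\<close> of triples in
  \<open>E \<times> E \<times> K\<close>.  For maps on a linear set, \<open>Z\<close> is \<open>dom1\<close>.\<close>

definition is_slope ::
    "'k ring \<Rightarrow> 'k topology \<Rightarrow> ('k, 'a) module \<Rightarrow> 'a topology \<Rightarrow> ('k, 'b) module \<Rightarrow> 'b topology \<Rightarrow>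
     ('a \<times> 'a \<times> 'k) set \<Rightarrow> ('a \<Rightarrow> 'b) \<Rightarrow> ('a \<times> 'a \<times> 'k \<Rightarrow> 'b) \<Rightarrow> bool" where
  "is_slope R TK E T E' T' Z f g \<longleftrightarrow>
    continuous_map (subtopology (prod_topology T (prod_topology T TK)) Z) T' g
    \<and> (\<forall>(x, v, t) \<in> Z. t \<in> Units R \<longrightarrow>
         g (x, v, t) = inv\<^bsub>R\<^esub> t \<odot>\<^bsub>E'\<^esub> (f (x \<oplus>\<^bsub>E\<^esub> (t \<odot>\<^bsub>E\<^esub> v)) \<ominus>\<^bsub>E'\<^esub> f x))"

definition slope ::
    "'k ring \<Rightarrow> 'k topology \<Rightarrow> ('k, 'a) module \<Rightarrow> 'a topology \<Rightarrow> ('k, 'b) module \<Rightarrow> 'b topology \<Rightarrow>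
     ('a \<times> 'a \<times> 'k) set \<Rightarrow> ('a \<Rightarrow> 'b) \<Rightarrow> 'a \<times> 'a \<times> 'k \<Rightarrow> 'b" where
  "slope R TK E T E' T' Z f = (THE g. g \<in> extensional Z \<and> is_slope R TK E T E' T' Z f g)"

definition C1 :: "'k ring \<Rightarrow> 'k topology \<Rightarrow> ('k, 'a) tlinset \<Rightarrow> ('k, 'b) tlinset \<Rightarrow> ('a \<Rightarrow> 'b) \<Rightarrow> bool" where
  "C1 R TK S S' f \<longleftrightarrow>
    continuous_map (subspace S) (subspace S') f
    \<and> (\<exists>g. is_slope R TK (amb S) (tau S) (amb S') (tau S') (dom1 R S) f g)"

text \<open>\<open>f\<^sup>[\<^sup>1\<^sup>]\<close> on the points \<open>Mor (x, v, t)\<close> of \<open>mor_top R TK S\<close>.\<close>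

definition slope_map ::
    "'k ring \<Rightarrow> 'k topology \<Rightarrow> ('k, ('v, 'k) pt) tlinset \<Rightarrow> ('k, 'b) tlinset \<Rightarrow>
     (('v, 'k) pt \<Rightarrow> 'b) \<Rightarrow> ('v, 'k) pt \<Rightarrow> 'b" where
  "slope_map R TK S S' f p =
    slope R TK (amb S) (tau S) (amb S') (tau S') (dom1 R S) f (bpt p, vpt p, tpt p)"

primrec slope_iter ::
    "'k ring \<Rightarrow> 'k topology \<Rightarrow> nat \<Rightarrow> ('k, ('v, 'k) pt) tlinset \<Rightarrow> ('k, 'b) tlinset \<Rightarrow>
     (('v, 'k) pt \<Rightarrow> 'b) \<Rightarrow> ('v, 'k) pt \<Rightarrow> 'b" where
  "slope_iter R TK 0 S S' f = f"
| "slope_iter R TK (Suc n) S S' f =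
    slope_map R TK ((mor_top R TK ^^ n) S) S' (slope_iter R TK n S S' f)"

primrec Cn ::
    "'k ring \<Rightarrow> 'k topology \<Rightarrow> nat \<Rightarrow> ('k, ('v, 'k) pt) tlinset \<Rightarrow> ('k, 'b) tlinset \<Rightarrow>
     (('v, 'k) pt \<Rightarrow> 'b) \<Rightarrow> bool" where
  "Cn R TK 0 S S' f \<longleftrightarrow> continuous_map (subspace S) (subspace S') f"
| "Cn R TK (Suc n) S S' f \<longleftrightarrow>
    Cn R TK n S S' f
    \<and> C1 R TK ((mor_top R TK ^^ n) S) (whole S') (slope_iter R TK n S S' f)"

text \<open>\<open>f\<^bsup>{k}\<^esup>\<close> and \<open>f \<times> id\<^sub>K\<close>.\<close>

definition mor_map ::
    "'k ring \<Rightarrow> 'k topology \<Rightarrow> ('k, ('v, 'k) pt) tlinset \<Rightarrow> ('k, ('w, 'k) pt) tlinset \<Rightarrow>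
     (('v, 'k) pt \<Rightarrow> ('w, 'k) pt) \<Rightarrow> ('v, 'k) pt \<Rightarrow> ('w, 'k) pt" where
  "mor_map R TK S S' f p = Mor (f (bpt p), slope_map R TK S S' f p, tpt p)"

definition obj_map :: "(('v, 'k) pt \<Rightarrow> ('w, 'k) pt) \<Rightarrow> ('v, 'k) pt \<Rightarrow> ('w, 'k) pt" where
  "obj_map f p = Obj (f (bpt p), tpt p)"

type_synonym ('v, 'w, 'k) tmap =
  "('k, ('v, 'k) pt) tlinset \<times> ('k, ('w, 'k) pt) tlinset \<times> (('v, 'k) pt \<Rightarrow> ('w, 'k) pt)"

fun mor_tmap :: "'k ring \<Rightarrow> 'k topology \<Rightarrow> ('v, 'w, 'k) tmap \<Rightarrow> ('v, 'w, 'k) tmap" where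
  "mor_tmap R TK (S, S', f) = (mor_top R TK S, mor_top R TK S', mor_map R TK S S' f)"

fun obj_tmap :: "'k ring \<Rightarrow> 'k topology \<Rightarrow> ('v, 'w, 'k) tmap \<Rightarrow> ('v, 'w, 'k) tmap" where
  "obj_tmap R TK (S, S', f) = (obj_top R TK S, obj_top R TK S', obj_map f)"

definition top_map_G ::
    "'k ring \<Rightarrow> 'k topology \<Rightarrow> nat set \<Rightarrow> nat \<Rightarrow> ('v, 'w, 'k) tmap \<Rightarrow> ('v, 'w, 'k) tmap" where
  "top_map_G R TK \<beta> k F = (if \<beta> = {k} then mor_tmap R TK F else obj_tmap R TK F)"

abbreviation the_map :: "'s \<times> 's' \<times> 'f \<Rightarrow> 'f" where
  "the_map F \<equiv> snd (snd F)"

text \<open>The point \<open>(x, t\<^sub>1, \<dots>, t\<^sub>n)\<close> of \<open>G\<^bsup>{};N\<^esup>U = U \<times> K\<^sup>n\<close>.\<close>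

definition bottom_pt :: "'v \<Rightarrow> 'k list \<Rightarrow> ('v, 'k) pt" where
  "bottom_pt x ts = fold (\<lambda>t p. Obj (p, t)) ts (Base x)"


section \<open>The n-fold groupoid of an open set\<close>

text \<open>At the edge \<open>(\<beta>, \<beta> \<union> {i})\<close> the objects are the points of the vertex \<open>\<beta>\<close> and the morphisms
  are those of the vertex \<open>\<beta> \<union> {i}\<close>.  In the direction of the last label \<open>a\<close> the structure is that
  of \<open>G\<^bsup>{a}\<^esup>\<close>; in the other directions \<open>G\<^bsup>{a}\<^esup>\<close> is applied to the structure maps already
  present.\<close>

abbreviation tvertex where
  "tvertex R TK \<equiv> vertex (top_G R TK)"

abbreviation apply_G ::
    "'k ring \<Rightarrow> 'k topology \<Rightarrow> nat set \<Rightarrow> nat \<Rightarrow> ('k, ('v, 'k) pt) tlinset \<Rightarrow> ('k, ('w, 'k) pt) tlinset \<Rightarrow>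
     (('v, 'k) pt \<Rightarrow> ('w, 'k) pt) \<Rightarrow> ('v, 'k) pt \<Rightarrow> ('w, 'k) pt" where
  "apply_G R TK \<beta> k S S' f \<equiv> the_map (top_map_G R TK \<beta> k (S, S', f))"

primrec nsrc ::
    "'k ring \<Rightarrow> 'k topology \<Rightarrow> ('k, ('v, 'k) pt) tlinset \<Rightarrow> nat list \<Rightarrow> nat set \<Rightarrow> nat \<Rightarrow>
     ('v, 'k) pt \<Rightarrow> ('v, 'k) pt" where
  "nsrc R TK S [] \<beta> i = undefined"
| "nsrc R TK S (a # L) \<beta> i =
    (if i = a then (\<lambda>m. Obj (bpt m, tpt m))
     else let \<gamma> = \<beta> - {a} in
       apply_G R TK (angle \<beta> a) a (tvertex R TK L S (insert i \<gamma>)) (tvertex R TK L S \<gamma>)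
         (nsrc R TK S L \<gamma> i))"

primrec ntgt ::
    "'k ring \<Rightarrow> 'k topology \<Rightarrow> ('k, ('v, 'k) pt) tlinset \<Rightarrow> nat list \<Rightarrow> nat set \<Rightarrow> nat \<Rightarrow>
     ('v, 'k) pt \<Rightarrow> ('v, 'k) pt" where
  "ntgt R TK S [] \<beta> i = undefined"
| "ntgt R TK S (a # L) \<beta> i =
    (if i = a then let E = amb (tvertex R TK L S \<beta>) in
       (\<lambda>m. Obj (bpt m \<oplus>\<^bsub>E\<^esub> (tpt m \<odot>\<^bsub>E\<^esub> vpt m), tpt m))
     else let \<gamma> = \<beta> - {a} in
       apply_G R TK (angle \<beta> a) a (tvertex R TK L S (insert i \<gamma>)) (tvertex R TK L S \<gamma>)
         (ntgt R TK S L \<gamma> i))"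

primrec nunit ::
    "'k ring \<Rightarrow> 'k topology \<Rightarrow> ('k, ('v, 'k) pt) tlinset \<Rightarrow> nat list \<Rightarrow> nat set \<Rightarrow> nat \<Rightarrow>
     ('v, 'k) pt \<Rightarrow> ('v, 'k) pt" where
  "nunit R TK S [] \<beta> i = undefined"
| "nunit R TK S (a # L) \<beta> i =
    (if i = a then (\<lambda>p. Mor (bpt p, \<zero>\<^bsub>amb (tvertex R TK L S \<beta>)\<^esub>, tpt p))
     else let \<gamma> = \<beta> - {a} in
       apply_G R TK (angle \<beta> a) a (tvertex R TK L S \<gamma>) (tvertex R TK L S (insert i \<gamma>))
         (nunit R TK S L \<gamma> i))"

definition ncomp ::
    "'k ring \<Rightarrow> 'k topology \<Rightarrow> ('k, ('v, 'k) pt) tlinset \<Rightarrow> nat list \<Rightarrow> nat set \<Rightarrow> nat \<Rightarrow>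
     (('v, 'k) pt \<times> ('v, 'k) pt) set" where
  "ncomp R TK S L \<beta> i =
    {(m', m). m' \<in> pts (tvertex R TK L S (insert i \<beta>)) \<and> m \<in> pts (tvertex R TK L S (insert i \<beta>))
              \<and> nsrc R TK S L \<beta> i m' = ntgt R TK S L \<beta> i m}"

text \<open>The product of the new structure lives on the fibre product of the new source and target maps,
  so the slope of the old product is taken over the set \<open>Z\<close> of triples \<open>((p', p), (w', w), t)\<close>
  for which \<open>((p', w', t), (p, w, t))\<close> is composable.  The set \<open>dom1\<close> of the old composable
  pairs would be too large: at \<open>t = 0\<close> it does not restrict the direction \<open>(w', w)\<close>.\<close>

primrec nmul ::
    "'k ring \<Rightarrow> 'k topology \<Rightarrow> ('k, ('v, 'k) pt) tlinset \<Rightarrow> nat list \<Rightarrow> nat set \<Rightarrow> nat \<Rightarrow>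
     ('v, 'k) pt \<times> ('v, 'k) pt \<Rightarrow> ('v, 'k) pt" where
  "nmul R TK S [] \<beta> i = undefined"
| "nmul R TK S (a # L) \<beta> i =
    (if i = a then
       (\<lambda>(m', m). Mor (bpt m, vpt m \<oplus>\<^bsub>amb (tvertex R TK L S \<beta>)\<^esub> vpt m', tpt m))
     else if a \<in> \<beta> then
       let M = tvertex R TK L S (insert i (\<beta> - {a}));
           mul = nmul R TK S L (\<beta> - {a}) i;
           Z = {((p', p), (w', w), t). (Mor (p', w', t), Mor (p, w, t)) \<in> ncomp R TK S (a # L) \<beta> i}
       in (\<lambda>(m', m). Mor (mul (bpt m', bpt m),
              slope R TK (prod_mod (amb M) (amb M)) (prod_topology (tau M) (tau M)) (amb M) (tau M) Z mul
                ((bpt m', bpt m), (vpt m', vpt m), tpt m),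
              tpt m))
     else (\<lambda>(m', m). Obj (nmul R TK S L \<beta> i (bpt m', bpt m), tpt m)))"

definition nfold_morphism ::
    "'k ring \<Rightarrow> 'k topology \<Rightarrow> nat list \<Rightarrow> ('k, ('v, 'k) pt) tlinset \<Rightarrow> ('k, ('w, 'k) pt) tlinset \<Rightarrow>
     (nat set \<Rightarrow> ('v, 'k) pt \<Rightarrow> ('w, 'k) pt) \<Rightarrow> bool" where
  "nfold_morphism R TK L S S' \<Phi> \<longleftrightarrow>
    (\<forall>\<beta> i. \<beta> \<subseteq> set L \<and> i \<in> set L \<and> i \<notin> \<beta> \<longrightarrow>
      (\<forall>m \<in> pts (tvertex R TK L S (insert i \<beta>)).
         nsrc R TK S' L \<beta> i (\<Phi> (insert i \<beta>) m) = \<Phi> \<beta> (nsrc R TK S L \<beta> i m)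
         \<and> ntgt R TK S' L \<beta> i (\<Phi> (insert i \<beta>) m) = \<Phi> \<beta> (ntgt R TK S L \<beta> i m))
      \<and> (\<forall>p \<in> pts (tvertex R TK L S \<beta>).
         nunit R TK S' L \<beta> i (\<Phi> \<beta> p) = \<Phi> (insert i \<beta>) (nunit R TK S L \<beta> i p))
      \<and> (\<forall>(m', m) \<in> ncomp R TK S L \<beta> i.
         nmul R TK S' L \<beta> i (\<Phi> (insert i \<beta>) m', \<Phi> (insert i \<beta>) m)
           = \<Phi> (insert i \<beta>) (nmul R TK S L \<beta> i (m', m))))"

primrec nfold_map ::
    "'k ring \<Rightarrow> 'k topology \<Rightarrow> nat list \<Rightarrow> ('k, ('v, 'k) pt) tlinset \<Rightarrow> ('k, ('w, 'k) pt) tlinset \<Rightarrow>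
     (('v, 'k) pt \<Rightarrow> ('w, 'k) pt) \<Rightarrow> nat set \<Rightarrow> ('v, 'k) pt \<Rightarrow> ('w, 'k) pt" where
  "nfold_map R TK [] S S' f = (\<lambda>\<alpha> \<in> {{}}. restrict f (pts S))"
| "nfold_map R TK (a # L) S S' f =
    (THE \<Phi>.
      \<Phi> \<in> (\<Pi>\<^sub>E \<alpha> \<in> Pow (set (a # L)).
              pts (tvertex R TK (a # L) S \<alpha>) \<rightarrow>\<^sub>E pts (tvertex R TK (a # L) S' \<alpha>))
      \<and> (\<forall>\<alpha> \<subseteq> set (a # L).
           continuous_map (subspace (tvertex R TK (a # L) S \<alpha>)) (subspace (tvertex R TK (a # L) S' \<alpha>)) (\<Phi> \<alpha>))
      \<and> nfold_morphism R TK (a # L) S S' \<Phi>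
      \<and> (\<forall>\<alpha> \<subseteq> set L. \<forall>p \<in> pts (tvertex R TK L S \<alpha>). \<forall>t \<in> carrier R.
           \<Phi> \<alpha> (Obj (p, t)) = Obj (nfold_map R TK L S S' f \<alpha> p, t)))"


section \<open>Polynomial laws\<close>

text \<open>The tensor product \<open>V \<otimes>\<^sub>R A\<close>: the free abelian group on pairs, modulo the subgroup generated by
  the bilinearity relations.  It is a group in multiplicative notation; its elements are cosets.\<close>

definition tensor_relations ::
    "'k ring \<Rightarrow> ('k, 'a) module \<Rightarrow> ('k, 'b) module \<Rightarrow> ('a \<times> 'b \<Rightarrow>\<^sub>0 int) set" where
  "tensor_relations R V A =
     {frag_of (v \<oplus>\<^bsub>V\<^esub> v', a) - frag_of (v, a) - frag_of (v', a) |v v' a.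
        v \<in> carrier V \<and> v' \<in> carrier V \<and> a \<in> carrier A}
   \<union> {frag_of (v, a \<oplus>\<^bsub>A\<^esub> a') - frag_of (v, a) - frag_of (v, a') |v a a'.
        v \<in> carrier V \<and> a \<in> carrier A \<and> a' \<in> carrier A}
   \<union> {frag_of (k \<odot>\<^bsub>V\<^esub> v, a) - frag_of (v, k \<odot>\<^bsub>A\<^esub> a) |k v a.
        k \<in> carrier R \<and> v \<in> carrier V \<and> a \<in> carrier A}"

abbreviation pairs_group :: "('k, 'a) module \<Rightarrow> ('k, 'b) module \<Rightarrow> ('a \<times> 'b \<Rightarrow>\<^sub>0 int) monoid" where
  "pairs_group V A \<equiv> free_Abelian_group (carrier V \<times> carrier A)"

definition tensor_null ::
    "'k ring \<Rightarrow> ('k, 'a) module \<Rightarrow> ('k, 'b) module \<Rightarrow> ('a \<times> 'b \<Rightarrow>\<^sub>0 int) set" where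
  "tensor_null R V A = generate (pairs_group V A) (tensor_relations R V A)"

definition tensor ::
    "'k ring \<Rightarrow> ('k, 'a) module \<Rightarrow> ('k, 'b) module \<Rightarrow> ('a \<times> 'b \<Rightarrow>\<^sub>0 int) set monoid" where
  "tensor R V A = pairs_group V A Mod tensor_null R V A"

definition pure_tensor ::
    "'k ring \<Rightarrow> ('k, 'a) module \<Rightarrow> ('k, 'b) module \<Rightarrow> 'a \<Rightarrow> 'b \<Rightarrow> ('a \<times> 'b \<Rightarrow>\<^sub>0 int) set" where
  "pure_tensor R V A v a = tensor_null R V A #>\<^bsub>pairs_group V A\<^esub> frag_of (v, a)"

text \<open>The map \<open>g \<otimes> h\<close> into \<open>V' \<otimes> A'\<close> induced by linear maps \<open>g\<close> and \<open>h\<close>; all members of the union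
  are the same coset.\<close>

definition tensor_map ::
    "'k ring \<Rightarrow> ('k, 'c) module \<Rightarrow> ('k, 'd) module \<Rightarrow> ('a \<Rightarrow> 'c) \<Rightarrow> ('b \<Rightarrow> 'd) \<Rightarrow>
     ('a \<times> 'b \<Rightarrow>\<^sub>0 int) set \<Rightarrow> ('c \<times> 'd \<Rightarrow>\<^sub>0 int) set" where
  "tensor_map R V' A' g h z =
    (\<Union>c \<in> z. tensor_null R V' A' #>\<^bsub>pairs_group V' A'\<^esub> frag_extend (\<lambda>(v, a). frag_of (g v, h a)) c)"

text \<open>The algebras over which a polynomial law is evaluated have their elements in the following
  type.  It contains a copy of \<open>'k\<close>, it is closed under passing from \<open>A\<close> to \<open>A[T]\<close>, and as \<open>'u\<close> is
  arbitrary it contains copies of algebras of any given size.\<close>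

datatype ('k, 'u) alg_elt =
    Scalar 'k
  | Extra 'u
  | Poly "nat \<Rightarrow> ('k, 'u) alg_elt"

type_synonym ('k, 'u) alg = "('k, ('k, 'u) alg_elt) module"

type_synonym ('v, 'w, 'k, 'u) law =
  "('k, 'u) alg \<Rightarrow> ('v \<times> ('k, 'u) alg_elt \<Rightarrow>\<^sub>0 int) set \<Rightarrow> ('w \<times> ('k, 'u) alg_elt \<Rightarrow>\<^sub>0 int) set"

definition alg_hom :: "'k ring \<Rightarrow> ('k, 'b) module \<Rightarrow> ('k, 'c) module \<Rightarrow> ('b \<Rightarrow> 'c) \<Rightarrow> bool" where
  "alg_hom R A B h \<longleftrightarrow>
    h \<in> ring_hom A B \<and> (\<forall>k \<in> carrier R. \<forall>a \<in> carrier A. h (k \<odot>\<^bsub>A\<^esub> a) = k \<odot>\<^bsub>B\<^esub> h a)"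

definition polynomial_law ::
    "'k ring \<Rightarrow> ('k, 'v) module \<Rightarrow> ('k, 'w) module \<Rightarrow> ('v, 'w, 'k, 'u) law \<Rightarrow> bool" where
  "polynomial_law R V W f \<longleftrightarrow>
    (\<forall>A. algebra R A \<longrightarrow> f A \<in> carrier (tensor R V A) \<rightarrow> carrier (tensor R W A))
    \<and> (\<forall>A B h. algebra R A \<and> algebra R B \<and> alg_hom R A B h \<longrightarrow>
         (\<forall>z \<in> carrier (tensor R V A). f B (tensor_map R V B id h z) = tensor_map R W B id h (f A z)))"

definition law_eq ::
    "'k ring \<Rightarrow> ('k, 'v) module \<Rightarrow> ('v, 'w, 'k, 'u) law \<Rightarrow> ('v, 'w, 'k, 'u) law \<Rightarrow> bool" where
  "law_eq R V f g \<longleftrightarrow> (\<forall>A. algebra R A \<longrightarrow> (\<forall>z \<in> carrier (tensor R V A). f A z = g A z))"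

text \<open>\<open>A[T]\<close> as an R-algebra.\<close>

definition poly_alg :: "('k, 'u) alg \<Rightarrow> ('k, 'u) alg" where
  "poly_alg A = wrap_mod Poly
    \<lparr>carrier = carrier (UP A), monoid.mult = mult (UP A), monoid.one = \<one>\<^bsub>UP A\<^esub>, ring.zero = \<zero>\<^bsub>UP A\<^esub>,
     ring.add = add (UP A), smult = (\<lambda>k p n. k \<odot>\<^bsub>A\<^esub> p n)\<rparr>"

definition const_poly :: "('k, 'u) alg \<Rightarrow> ('k, 'u) alg_elt \<Rightarrow> ('k, 'u) alg_elt" where
  "const_poly A a = Poly (monom (UP A) a 0)"

definition var_poly :: "('k, 'u) alg \<Rightarrow> ('k, 'u) alg_elt" where
  "var_poly A = Poly (monom (UP A) \<one>\<^bsub>A\<^esub> 1)"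

definition eval_poly :: "('k, 'u) alg \<Rightarrow> ('k, 'u) alg_elt \<Rightarrow> ('k, 'u) alg_elt \<Rightarrow> ('k, 'u) alg_elt" where
  "eval_poly A t p = eval A A id t (the_inv Poly p)"

text \<open>\<open>f\<^sup>[\<^sup>1\<^sup>]\<close>, a law from \<open>E \<times> E \<times> K\<close> to \<open>E'\<close>.  An element \<open>z\<close> of \<open>(E \<times> E \<times> K) \<otimes> A\<close> is the triple of
  its components \<open>x, v \<in> E \<otimes> A\<close> and \<open>t \<in> K \<otimes> A = A\<close>, where \<open>a\<close> corresponds to \<open>1 \<otimes> a\<close>.\<close>

definition law_slope ::
    "'k ring \<Rightarrow> ('k, ('v, 'k) pt) module \<Rightarrow> ('k, ('w, 'k) pt) module \<Rightarrow>
     (('v, 'k) pt, ('w, 'k) pt, 'k, 'u) law \<Rightarrow> (('v, 'k) pt, ('w, 'k) pt, 'k, 'u) law" where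
  "law_slope R E E' f A z =
    (let x = tensor_map R E A bpt id z;
         v = tensor_map R E A vpt id z;
         t = (THE t. t \<in> carrier A \<and>
                tensor_map R (reg_mod R) A tpt id z = pure_tensor R (reg_mod R) A \<one>\<^bsub>R\<^esub> t);
         AT = poly_alg A;
         T = (\<lambda>p. var_poly A \<otimes>\<^bsub>AT\<^esub> p);
         F = (THE F. F \<in> carrier (tensor R E' AT) \<and>
                f AT (tensor_map R E AT id (const_poly A) x
                        \<otimes>\<^bsub>tensor R E AT\<^esub> tensor_map R E AT id T (tensor_map R E AT id (const_poly A) v))
                = tensor_map R E' AT id (const_poly A) (f A x)
                        \<otimes>\<^bsub>tensor R E' AT\<^esub> tensor_map R E' AT id T F)
     in tensor_map R E' A id (eval_poly A t) F)"

text \<open>\<open>f\<^bsup>{k}\<^esup> = (f, f\<^sup>[\<^sup>1\<^sup>], t)\<close>, with the three components put into \<open>E' \<times> E' \<times> K\<close>.\<close>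

definition mor_law ::
    "'k ring \<Rightarrow> ('k, ('v, 'k) pt) module \<Rightarrow> ('k, ('w, 'k) pt) module \<Rightarrow>
     (('v, 'k) pt, ('w, 'k) pt, 'k, 'u) law \<Rightarrow> (('v, 'k) pt, ('w, 'k) pt, 'k, 'u) law" where
  "mor_law R E E' f A z =
    (let W = mor_mod R E' in
       tensor_map R W A (\<lambda>y. Mor (y, \<zero>\<^bsub>E'\<^esub>, \<zero>\<^bsub>R\<^esub>)) id (f A (tensor_map R E A bpt id z))
       \<otimes>\<^bsub>tensor R W A\<^esub> tensor_map R W A (\<lambda>y. Mor (\<zero>\<^bsub>E'\<^esub>, y, \<zero>\<^bsub>R\<^esub>)) id (law_slope R E E' f A z)
       \<otimes>\<^bsub>tensor R W A\<^esub> tensor_map R W A (\<lambda>p. Mor (\<zero>\<^bsub>E'\<^esub>, \<zero>\<^bsub>E'\<^esub>, tpt p)) id z)"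

text \<open>The law \<open>f \<times> id\<close> from \<open>E \<times> K\<^sup>n\<close> to \<open>E' \<times> K\<^sup>n\<close>: the sum of \<open>f\<close> on the component in \<open>E\<close>, put into
  \<open>E' \<times> {0}\<close>, and of the linear map \<open>(x, t) \<mapsto> (0, t)\<close>.\<close>

primrec keep_scalars :: "('k, ('w, 'k) pt) module \<Rightarrow> nat \<Rightarrow> ('v, 'k) pt \<Rightarrow> ('w, 'k) pt" where
  "keep_scalars E' 0 p = \<zero>\<^bsub>E'\<^esub>"
| "keep_scalars E' (Suc n) p = Obj (keep_scalars E' n (bpt p), tpt p)"

definition law_times_id ::
    "'k ring \<Rightarrow> nat \<Rightarrow> ('k, ('v, 'k) pt) module \<Rightarrow> ('k, ('w, 'k) pt) module \<Rightarrow>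
     (('v, 'k) pt, ('w, 'k) pt, 'k, 'u) law \<Rightarrow> (('v, 'k) pt, ('w, 'k) pt, 'k, 'u) law" where
  "law_times_id R n E E' f A z =
    (let W = (obj_mod R ^^ n) E' in
       tensor_map R W A ((\<lambda>y. Obj (y, \<zero>\<^bsub>R\<^esub>)) ^^ n) id (f A (tensor_map R E A (bpt ^^ n) id z))
       \<otimes>\<^bsub>tensor R W A\<^esub> tensor_map R W A (keep_scalars E' n) id z)"

type_synonym ('v, 'w, 'k, 'u) lmap =
  "('k, ('v, 'k) pt) module \<times> ('k, ('w, 'k) pt) module \<times> (('v, 'k) pt, ('w, 'k) pt, 'k, 'u) law"

fun mor_lmap :: "'k ring \<Rightarrow> ('v, 'w, 'k, 'u) lmap \<Rightarrow> ('v, 'w, 'k, 'u) lmap" where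
  "mor_lmap R (E, E', f) = (mor_mod R E, mor_mod R E', mor_law R E E' f)"

fun obj_lmap :: "'k ring \<Rightarrow> ('v, 'w, 'k, 'u) lmap \<Rightarrow> ('v, 'w, 'k, 'u) lmap" where
  "obj_lmap R (E, E', f) = (obj_mod R E, obj_mod R E', law_times_id R 1 E E' f)"

definition law_G :: "'k ring \<Rightarrow> nat set \<Rightarrow> nat \<Rightarrow> ('v, 'w, 'k, 'u) lmap \<Rightarrow> ('v, 'w, 'k, 'u) lmap" where
  "law_G R \<beta> k F = (if \<beta> = {k} then mor_lmap R F else obj_lmap R F)"

definition base_law ::
    "'k ring \<Rightarrow> ('k, 'v) module \<Rightarrow> ('k, 'w) module \<Rightarrow> ('v, 'w, 'k, 'u) law \<Rightarrow>
     (('v, 'k) pt, ('w, 'k) pt, 'k, 'u) law" where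
  "base_law R V W f A z =
    tensor_map R (wrap_mod Base W) A Base id (f A (tensor_map R V A unBase id z))"

definition base_lmap ::
    "'k ring \<Rightarrow> ('k, 'v) module \<Rightarrow> ('k, 'w) module \<Rightarrow> ('v, 'w, 'k, 'u) law \<Rightarrow> ('v, 'w, 'k, 'u) lmap" where
  "base_lmap R V W f = (wrap_mod Base V, wrap_mod Base W, base_law R V W f)"

end

theory Submission
  imports "HOL-Analysis.Abstract_Topological_Spaces" Defs
begin

text \<open>
  The identity of vertex sets, and the one for polynomial laws, is a regrouping of the recursion; at
  the bottom vertex of a law one has to know in addition that \<open>g \<mapsto> g \<otimes> id\<close> is functorial and
  additive.

  The topological case needs that the composite of the functors satisfies the conditions by which
  the n-fold vertex map is characterised, and that these conditions determine it.  For uniqueness, a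
  morphism \<open>(x, v, t)\<close> with invertible \<open>t\<close> is determined by its source and its target, and such
  morphisms are dense.  For existence, \<open>G\<^bsup>{a}\<^esup>\<close> has to preserve groupoid morphisms; for the source, target and
  unit maps this is the chain rule.  The product is only defined on the fibre product of two
  copies of the morphism set, which is not open, so there the chain rule is not available.  However, all products are
  restrictions of affine maps \<open>(m', m) \<mapsto> m + m' - u (l m')\<close>, where the linear maps \<open>l\<close> and \<open>u\<close> extend the
  source and the unit map, and as \<open>l \<circ> u = id\<close>, each point of the fibre product is the value at its
  parameter of a continuous curve in the fibre product.  Hence the equations for products, too,
  only have to be checked at invertible parameters.
\<close>


section \<open>Vertices as composites\<close>

text \<open>The target map, which sends \<open>(x, v, t)\<close> to \<open>(x + t v, t)\<close>, is
  bilinear in \<open>t\<close> and \<open>v\<close>. Unlike source and unit it therefore does not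
  stay linear when the functor is iterated, and it can only be carried along as a map that is smooth
  of every order. This is why smooth maps are closed under sums, scalar products and tuples before
  groupoids appear, while source and unit are kept linear. Linearity of the source turns
  composability of two tangent morphisms into a linear equation for the direction of the left
  factor, and the unit map solves it. The order of differentiability acts as a budget: a morphism
  step puts a slope next to the map and costs one order, so a \<open>C^n\<close> map lasts for
  exactly \<open>n\<close> labels. Existence has to deal with every edge and goes by induction over
  the labels, one edge at a time. Uniqueness uses only the edges in the direction of the last label:
  at vertices without that label the map is prescribed, and every other vertex is the end of one
  such edge.\<close>

lemma vertex_eq_fold:
  "distinct L \<Longrightarrow> vertex G L s \<alpha> = fold (\<lambda>j. G (angle \<alpha> j) j) (rev L) s"
proof (induction L arbitrary: \<alpha>)
  case (Cons a L)
  \<comment> \<open>\<open>vertex\<close> forgets the label \<open>a\<close> once it has been used,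
    the composite does not; as \<open>a\<close> does not occur in \<open>L\<close>, the remaining
    functors see no difference.\<close>
  have "fold (\<lambda>j. G (angle (\<alpha> - {a}) j) j) (rev L) s = fold (\<lambda>j. G (angle \<alpha> j) j) (rev L) s"
    using Cons.prems by (intro fold_cong) (auto simp: angle_def)
  then show ?case
    using Cons by (auto simp: angle_def)
qed simp

lemma distinct_labels [simp]: "distinct (labels N)"
  by (simp add: labels_def)

lemma set_labels [simp]: "finite N \<Longrightarrow> set (labels N) = N"
  by (simp add: labels_def)

lemma length_labels [simp]: "length (labels N) = card N"
  by (simp add: labels_def)

lemma vertex_eq_composite: "vertex G (labels N) s \<alpha> = composite G \<alpha> N s"
  unfolding composite_def vertex_eq_fold[OF distinct_labels] by (simp add: labels_def)

lemma fold_const_fun: "fold (\<lambda>_. h) xs = h ^^ length xs"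
  by (induction xs) (simp_all add: funpow_Suc_right del: funpow.simps)

lemma vertex_top_eq_funpow:
  assumes "\<And>k. G {k} k = H" and "finite N"
  shows "vertex G (labels N) s N = (H ^^ card N) s"
proof -
  have "vertex G (labels N) s N = fold (\<lambda>_. H) (rev (labels N)) s"
    unfolding vertex_eq_fold[OF distinct_labels]
    using assms by (intro fold_cong) (auto simp: angle_def)
  then show ?thesis
    by (simp add: fold_const_fun)
qed

lemma vertex_bottom_eq_funpow:
  assumes "\<And>k. G {} k = H"
  shows "vertex G L s {} = (H ^^ length L) s"
  using assms by (induction L) simp_all


section \<open>Modules and linear maps\<close>

lemma module_cring: "module R M \<Longrightarrow> cring R"
  by (rule module.axioms)

lemma wrap_mod_sel [simp]:
  "carrier (wrap_mod \<phi> M) = \<phi> ` carrier M"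
  "\<zero>\<^bsub>wrap_mod \<phi> M\<^esub> = \<phi> \<zero>\<^bsub>M\<^esub>"
  "inj \<phi> \<Longrightarrow> \<phi> x \<oplus>\<^bsub>wrap_mod \<phi> M\<^esub> \<phi> y = \<phi> (x \<oplus>\<^bsub>M\<^esub> y)"
  "inj \<phi> \<Longrightarrow> k \<odot>\<^bsub>wrap_mod \<phi> M\<^esub> \<phi> x = \<phi> (k \<odot>\<^bsub>M\<^esub> x)"
  by (simp_all add: wrap_mod_def the_inv_f_f)

lemma module_wrap_mod:
  fixes \<phi> :: "'a \<Rightarrow> 'b"
  assumes M: "module R M" and inj: "inj \<phi>"
  shows "module R (wrap_mod \<phi> M)"
proof -
  interpret module R M by fact
  show ?thesis
  proof (rule moduleI)
    show "abelian_group (wrap_mod \<phi> M)"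
    proof (rule abelian_groupI)
      fix y assume "y \<in> carrier (wrap_mod \<phi> M)"
      then obtain x where "y = \<phi> x" "x \<in> carrier M" by auto
      then show "\<exists>z \<in> carrier (wrap_mod \<phi> M). z \<oplus>\<^bsub>wrap_mod \<phi> M\<^esub> y = \<zero>\<^bsub>wrap_mod \<phi> M\<^esub>"
        by (intro bexI[of _ "\<phi> (\<ominus>\<^bsub>M\<^esub> x)"]) (simp_all add: inj M.l_neg)
    qed (auto simp: inj M.a_ac)
  qed (auto simp: inj smult_l_distr smult_r_distr smult_assoc1 R.is_cring)
qed

lemma prod_mod_sel [simp]:
  "carrier (prod_mod E F) = carrier E \<times> carrier F"
  "\<zero>\<^bsub>prod_mod E F\<^esub> = (\<zero>\<^bsub>E\<^esub>, \<zero>\<^bsub>F\<^esub>)"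
  "(x, y) \<oplus>\<^bsub>prod_mod E F\<^esub> (x', y') = (x \<oplus>\<^bsub>E\<^esub> x', y \<oplus>\<^bsub>F\<^esub> y')"
  "k \<odot>\<^bsub>prod_mod E F\<^esub> (x, y) = (k \<odot>\<^bsub>E\<^esub> x, k \<odot>\<^bsub>F\<^esub> y)"
  by (simp_all add: prod_mod_def)

lemma module_prod_mod:
  assumes E: "module R E" and F: "module R F"
  shows "module R (prod_mod E F)"
proof -
  interpret E: module R E by fact
  interpret F: module R F by fact
  show ?thesis
  proof (rule moduleI)
    show "abelian_group (prod_mod E F)"
    proof (rule abelian_groupI)
      fix p assume "p \<in> carrier (prod_mod E F)"
      then obtain x y where "p = (x, y)" "x \<in> carrier E" "y \<in> carrier F" by auto
      then show "\<exists>q \<in> carrier (prod_mod E F). q \<oplus>\<^bsub>prod_mod E F\<^esub> p = \<zero>\<^bsub>prod_mod E F\<^esub>"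
        by (intro bexI[of _ "(\<ominus>\<^bsub>E\<^esub> x, \<ominus>\<^bsub>F\<^esub> y)"]) (simp_all add: E.M.l_neg F.M.l_neg)
    qed (auto simp: E.M.a_ac F.M.a_ac)
  qed (auto simp: E.smult_l_distr F.smult_l_distr E.smult_r_distr F.smult_r_distr
        E.smult_assoc1 F.smult_assoc1 E.R.is_cring)
qed

lemma reg_mod_sel [simp]:
  "carrier (reg_mod R) = carrier R"
  "\<zero>\<^bsub>reg_mod R\<^esub> = \<zero>\<^bsub>R\<^esub>"
  "x \<oplus>\<^bsub>reg_mod R\<^esub> y = x \<oplus>\<^bsub>R\<^esub> y"
  "k \<odot>\<^bsub>reg_mod R\<^esub> x = k \<otimes>\<^bsub>R\<^esub> x"
  by (simp_all add: reg_mod_def)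

lemma module_reg_mod:
  assumes "cring R"
  shows "module R (reg_mod R)"
proof -
  interpret cring R by fact
  show ?thesis
  proof (rule moduleI)
    show "abelian_group (reg_mod R)"
      by (rule abelian_groupI) (auto simp: a_ac intro: l_neg)
  qed (auto simp: l_distr r_distr m_assoc is_cring)
qed

lemma inj_pt [simp]: "inj Base" "inj Obj" "inj Mor"
  by (auto simp: inj_def)

lemma obj_mod_sel [simp]:
  "carrier (obj_mod R E) = Obj ` (carrier E \<times> carrier R)"
  "\<zero>\<^bsub>obj_mod R E\<^esub> = Obj (\<zero>\<^bsub>E\<^esub>, \<zero>\<^bsub>R\<^esub>)"
  "Obj (x, s) \<oplus>\<^bsub>obj_mod R E\<^esub> Obj (y, t) = Obj (x \<oplus>\<^bsub>E\<^esub> y, s \<oplus>\<^bsub>R\<^esub> t)"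
  "k \<odot>\<^bsub>obj_mod R E\<^esub> Obj (x, s) = Obj (k \<odot>\<^bsub>E\<^esub> x, k \<otimes>\<^bsub>R\<^esub> s)"
  by (simp_all add: obj_mod_def)

lemma mor_mod_sel [simp]:
  "carrier (mor_mod R E) = Mor ` (carrier E \<times> carrier E \<times> carrier R)"
  "\<zero>\<^bsub>mor_mod R E\<^esub> = Mor (\<zero>\<^bsub>E\<^esub>, \<zero>\<^bsub>E\<^esub>, \<zero>\<^bsub>R\<^esub>)"
  "Mor (x, v, s) \<oplus>\<^bsub>mor_mod R E\<^esub> Mor (y, w, t) = Mor (x \<oplus>\<^bsub>E\<^esub> y, v \<oplus>\<^bsub>E\<^esub> w, s \<oplus>\<^bsub>R\<^esub> t)"
  "k \<odot>\<^bsub>mor_mod R E\<^esub> Mor (x, v, s) = Mor (k \<odot>\<^bsub>E\<^esub> x, k \<odot>\<^bsub>E\<^esub> v, k \<otimes>\<^bsub>R\<^esub> s)"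
  by (simp_all add: mor_mod_def)

lemma module_obj_mod: "module R E \<Longrightarrow> module R (obj_mod R E)"
  unfolding obj_mod_def
  by (intro module_wrap_mod module_prod_mod module_reg_mod) (auto intro: module_cring)

lemma module_mor_mod: "module R E \<Longrightarrow> module R (mor_mod R E)"
  unfolding mor_mod_def
  by (intro module_wrap_mod module_prod_mod module_reg_mod) (auto intro: module_cring)

definition lin_map :: "'k ring \<Rightarrow> ('k, 'a) module \<Rightarrow> ('k, 'b) module \<Rightarrow> ('a \<Rightarrow> 'b) \<Rightarrow> bool" where
  "lin_map R E F g \<longleftrightarrow>
    g \<in> carrier E \<rightarrow> carrier F
    \<and> (\<forall>x \<in> carrier E. \<forall>y \<in> carrier E. g (x \<oplus>\<^bsub>E\<^esub> y) = g x \<oplus>\<^bsub>F\<^esub> g y)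
    \<and> (\<forall>k \<in> carrier R. \<forall>x \<in> carrier E. g (k \<odot>\<^bsub>E\<^esub> x) = k \<odot>\<^bsub>F\<^esub> g x)"

lemma lin_mapD:
  assumes "lin_map R E F g"
  shows "x \<in> carrier E \<Longrightarrow> g x \<in> carrier F"
    and "x \<in> carrier E \<Longrightarrow> y \<in> carrier E \<Longrightarrow> g (x \<oplus>\<^bsub>E\<^esub> y) = g x \<oplus>\<^bsub>F\<^esub> g y"
    and "k \<in> carrier R \<Longrightarrow> x \<in> carrier E \<Longrightarrow> g (k \<odot>\<^bsub>E\<^esub> x) = k \<odot>\<^bsub>F\<^esub> g x"
  using assms by (auto simp: lin_map_def)

lemma lin_map_id [simp]: "lin_map R E E id"
  by (simp add: lin_map_def)

lemma lin_map_comp: "lin_map R E F g \<Longrightarrow> lin_map R F G h \<Longrightarrow> lin_map R E G (h \<circ> g)"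
  by (simp add: lin_map_def Pi_iff)


section \<open>Induced maps on tensor products\<close>

lemma frag_diff_closed:
  "\<lbrakk>a \<in> carrier (free_Abelian_group S); b \<in> carrier (free_Abelian_group S)\<rbrakk>
    \<Longrightarrow> a - b \<in> carrier (free_Abelian_group S)"
  using keys_diff[of a b] unfolding carrier_free_Abelian_group_iff by blast

lemma frag_add_closed:
  "\<lbrakk>a \<in> carrier (free_Abelian_group S); b \<in> carrier (free_Abelian_group S)\<rbrakk>
    \<Longrightarrow> a + b \<in> carrier (free_Abelian_group S)"
  using keys_add[of a b] unfolding carrier_free_Abelian_group_iff by blast

section \<open>The tensor product as a quotient of a free abelian group\<close>

locale tensor_modules =
  fixes R :: "'k ring" and V :: "('k, 'a) module" and A :: "('k, 'b) module"
  assumes V: "module R V" and A: "module R A"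
begin

interpretation V: module R V by (rule V)
interpretation A: module R A by (rule A)

lemma tensor_relations_subset: "tensor_relations R V A \<subseteq> carrier (pairs_group V A)"
  unfolding tensor_relations_def
  by (auto simp del: carrier_free_Abelian_group_iff intro!: frag_diff_closed)

lemma tensor_null_normal: "tensor_null R V A \<lhd> pairs_group V A"
proof -
  interpret comm_group "pairs_group V A" by (rule abelian_free_Abelian_group)
  show ?thesis
    unfolding tensor_null_def
    by (rule subgroup_imp_normal[OF generate_is_subgroup[OF tensor_relations_subset]])
qed

sublocale null: normal "tensor_null R V A" "pairs_group V A"
  by (rule tensor_null_normal)

lemma null_carrier: "c \<in> tensor_null R V A \<Longrightarrow> c \<in> carrier (pairs_group V A)"
  by (rule subgroup.mem_carrier[OF null.subgroup_axioms])

lemma null_zero: "0 \<in> tensor_null R V A"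
  using subgroup.one_closed[OF null.subgroup_axioms] by simp

lemma null_add: "c \<in> tensor_null R V A \<Longrightarrow> d \<in> tensor_null R V A \<Longrightarrow> c + d \<in> tensor_null R V A"
  using subgroup.m_closed[OF null.subgroup_axioms] by simp

lemma null_uminus: "c \<in> tensor_null R V A \<Longrightarrow> - c \<in> tensor_null R V A"
  using subgroup.m_inv_closed[OF null.subgroup_axioms] null_carrier by fastforce

lemma null_diff: "c \<in> tensor_null R V A \<Longrightarrow> d \<in> tensor_null R V A \<Longrightarrow> c - d \<in> tensor_null R V A"
  using null_add[OF _ null_uminus] by force

lemma comm_group_tensor: "comm_group (tensor R V A)"
  unfolding tensor_def
  by (rule comm_group.abelian_FactGroup[OF abelian_free_Abelian_group null.subgroup_axioms])

lemma tensor_mult: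
  assumes "c \<in> carrier (pairs_group V A)" and "d \<in> carrier (pairs_group V A)"
  shows "(tensor_null R V A #>\<^bsub>pairs_group V A\<^esub> c) \<otimes>\<^bsub>tensor R V A\<^esub> (tensor_null R V A #>\<^bsub>pairs_group V A\<^esub> d)
    = tensor_null R V A #>\<^bsub>pairs_group V A\<^esub> (c + d)"
  unfolding tensor_def using null.rcos_sum[OF assms] by simp

lemma tensor_carrierE:
  assumes "z \<in> carrier (tensor R V A)"
  obtains c where "c \<in> carrier (pairs_group V A)" and "z = tensor_null R V A #>\<^bsub>pairs_group V A\<^esub> c"
  using assms by (auto simp: tensor_def FactGroup_def RCOSETS_def)

lemma tensor_carrierI:
  "c \<in> carrier (pairs_group V A) \<Longrightarrow> tensor_null R V A #>\<^bsub>pairs_group V A\<^esub> c \<in> carrier (tensor R V A)"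
  by (auto simp: tensor_def FactGroup_def RCOSETS_def)

lemma coset_eqI:
  assumes "c \<in> carrier (pairs_group V A)" and "d \<in> carrier (pairs_group V A)"
    and "c - d \<in> tensor_null R V A"
  shows "tensor_null R V A #>\<^bsub>pairs_group V A\<^esub> c = tensor_null R V A #>\<^bsub>pairs_group V A\<^esub> d"
proof -
  have "c \<in> tensor_null R V A #>\<^bsub>pairs_group V A\<^esub> d"
    using assms(3) by (auto simp: r_coset_def intro!: bexI[of _ "c - d"])
  then show ?thesis
    by (metis null.repr_independence[OF _ assms(2) null.subgroup_axioms])
qed

end

text \<open>The identity on the second factor stays visible so that this is literally the term
  inside \<open>tensor_map\<close> with \<open>h = id\<close>.\<close>

abbreviation frag_map :: "('a \<Rightarrow> 'c) \<Rightarrow> ('a \<times> 'b \<Rightarrow>\<^sub>0 int) \<Rightarrow> ('c \<times> 'b \<Rightarrow>\<^sub>0 int)" where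
  "frag_map g \<equiv> frag_extend (\<lambda>(v, a). frag_of (g v, id a))"

lemma frag_map_carrier:
  assumes "g \<in> carrier V \<rightarrow> carrier W" and "c \<in> carrier (pairs_group V A)"
  shows "frag_map g c \<in> carrier (pairs_group W A)"
  using assms keys_frag_extend[of "\<lambda>(v, a). frag_of (g v, id a)" c]
  unfolding carrier_free_Abelian_group_iff by fastforce

text \<open>As \<open>g\<close> is linear, each of the three kinds of bilinearity relation goes to a
  relation of the same kind, and \<open>frag_map g\<close> is additive, so it respects the generated
  subgroups.\<close>

lemma frag_map_null:
  assumes "module R V" and "module R W" and "module R A" and g: "lin_map R V W g"
    and "c \<in> tensor_null R V A"
  shows "frag_map g c \<in> tensor_null R W A"
proof -
  interpret S: tensor_modules R V A by (rule tensor_modules.intro) fact+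
  interpret T: tensor_modules R W A by (rule tensor_modules.intro) fact+
  interpret W: module R W by fact
  note gD = lin_mapD[OF g]
  have rel: "frag_map g r \<in> tensor_relations R W A" if "r \<in> tensor_relations R V A" for r
    using that unfolding tensor_relations_def
    by (elim UnE CollectE exE conjE; simp add: frag_extend_diff gD; use gD(1) in blast)
  from assms(5) have "c \<in> generate (pairs_group V A) (tensor_relations R V A)"
    by (simp add: tensor_null_def)
  then show ?thesis
  proof (induction rule: generate.induct)
    case one
    show ?case using T.null_zero by simp
  next
    case (incl h)
    then show ?case using rel[OF incl] by (auto simp: tensor_null_def intro: generate.incl)
  next
    case (inv h)
    have "h \<in> carrier (pairs_group V A)" using inv S.tensor_relations_subset by blast
    moreover have "frag_map g h \<in> tensor_null R W A"
      using rel[OF inv] by (auto simp: tensor_null_def intro: generate.incl)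
    ultimately show ?case
      using T.null_uminus by (simp add: frag_extend_minus)
  next
    case (eng h1 h2)
    then show ?case using T.null_add by (simp add: frag_extend_add)
  qed
qed

text \<open>Two representatives differ by an element of the null subgroup, which
  \<open>frag_map g\<close> preserves. Hence the union that defines \<open>tensor_map\<close> is
  taken over copies of a single coset.\<close>

lemma tensor_map_coset:
  assumes "module R V" and "module R W" and "module R A" and g: "lin_map R V W g"
    and c: "c \<in> carrier (pairs_group V A)"
  shows "tensor_map R W A g id (tensor_null R V A #>\<^bsub>pairs_group V A\<^esub> c)
    = tensor_null R W A #>\<^bsub>pairs_group W A\<^esub> frag_map g c"
proof -
  interpret S: tensor_modules R V A by (rule tensor_modules.intro) fact+
  interpret T: tensor_modules R W A by (rule tensor_modules.intro) fact+
  have gc: "g \<in> carrier V \<rightarrow> carrier W" using lin_mapD(1)[OF g] by blast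
  have "tensor_null R W A #>\<^bsub>pairs_group W A\<^esub> frag_map g d
      = tensor_null R W A #>\<^bsub>pairs_group W A\<^esub> frag_map g c"
    if d: "d \<in> tensor_null R V A #>\<^bsub>pairs_group V A\<^esub> c" for d
  proof -
    obtain n where n: "n \<in> tensor_null R V A" "d = n + c"
      using d by (auto simp: r_coset_def)
    have dc: "d \<in> carrier (pairs_group V A)"
      unfolding n(2) by (intro frag_add_closed S.null_carrier n(1) c)
    show ?thesis
    proof (rule T.coset_eqI)
      show "frag_map g d - frag_map g c \<in> tensor_null R W A"
        using frag_map_null[OF assms(1-4) n(1)] n(2) by (simp add: frag_extend_add)
    qed (use frag_map_carrier[OF gc] c dc in auto)
  qed
  moreover have "c \<in> tensor_null R V A #>\<^bsub>pairs_group V A\<^esub> c"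
    using S.null.rcos_self[OF c S.null.subgroup_axioms] by simp
  ultimately show ?thesis
    unfolding tensor_map_def by blast
qed

lemma tensor_map_closed:
  assumes "module R V" and "module R W" and "module R A" and g: "lin_map R V W g"
    and z: "z \<in> carrier (tensor R V A)"
  shows "tensor_map R W A g id z \<in> carrier (tensor R W A)"
proof -
  interpret S: tensor_modules R V A by (rule tensor_modules.intro) fact+
  interpret T: tensor_modules R W A by (rule tensor_modules.intro) fact+
  obtain c where c: "c \<in> carrier (pairs_group V A)" "z = tensor_null R V A #>\<^bsub>pairs_group V A\<^esub> c"
    using S.tensor_carrierE[OF z] .
  have "g \<in> carrier V \<rightarrow> carrier W" using lin_mapD(1)[OF g] by blast
  then show ?thesis
    using tensor_map_coset[OF assms(1-4) c(1)] T.tensor_carrierI[OF frag_map_carrier[OF _ c(1)]]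
    by (simp add: c(2))
qed

lemma tensor_map_mult:
  assumes "module R V" and "module R W" and "module R A" and g: "lin_map R V W g"
    and z: "z \<in> carrier (tensor R V A)" and w: "w \<in> carrier (tensor R V A)"
  shows "tensor_map R W A g id (z \<otimes>\<^bsub>tensor R V A\<^esub> w)
    = tensor_map R W A g id z \<otimes>\<^bsub>tensor R W A\<^esub> tensor_map R W A g id w"
proof -
  interpret S: tensor_modules R V A by (rule tensor_modules.intro) fact+
  interpret T: tensor_modules R W A by (rule tensor_modules.intro) fact+
  obtain c where c: "c \<in> carrier (pairs_group V A)" "z = tensor_null R V A #>\<^bsub>pairs_group V A\<^esub> c"
    using S.tensor_carrierE[OF z] .
  obtain d where d: "d \<in> carrier (pairs_group V A)" "w = tensor_null R V A #>\<^bsub>pairs_group V A\<^esub> d"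
    using S.tensor_carrierE[OF w] .
  have cd: "c + d \<in> carrier (pairs_group V A)"
    by (intro frag_add_closed c(1) d(1))
  have "g \<in> carrier V \<rightarrow> carrier W" using lin_mapD(1)[OF g] by blast
  note fc = frag_map_carrier[OF this, of _ A]
  show ?thesis
    unfolding c(2) d(2) S.tensor_mult[OF c(1) d(1)] tensor_map_coset[OF assms(1-4) cd]
      tensor_map_coset[OF assms(1-4) c(1)] tensor_map_coset[OF assms(1-4) d(1)]
      T.tensor_mult[OF fc[OF c(1)] fc[OF d(1)]]
    by (simp add: frag_extend_add)
qed

lemma tensor_map_comp:
  assumes "module R V" and "module R W" and "module R X" and "module R A"
    and g: "lin_map R V W g" and h: "lin_map R W X h"
    and z: "z \<in> carrier (tensor R V A)"
  shows "tensor_map R X A h id (tensor_map R W A g id z) = tensor_map R X A (h \<circ> g) id z"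
proof -
  interpret S: tensor_modules R V A by (rule tensor_modules.intro) fact+
  obtain c where c: "c \<in> carrier (pairs_group V A)" "z = tensor_null R V A #>\<^bsub>pairs_group V A\<^esub> c"
    using S.tensor_carrierE[OF z] .
  have gc: "g \<in> carrier V \<rightarrow> carrier W" using lin_mapD(1)[OF g] by blast
  have "frag_map h (frag_map g c) = frag_map (h \<circ> g) c"
    using c(1) unfolding carrier_free_Abelian_group_iff
    by (induction rule: frag_induction) (auto simp: frag_extend_diff)
  then show ?thesis
    using tensor_map_coset[OF assms(1,2,4) g c(1)]
      tensor_map_coset[OF assms(2,3,4) h frag_map_carrier[OF gc c(1)]]
      tensor_map_coset[OF assms(1,3,4) lin_map_comp[OF g h] c(1)]
    by (simp add: c(2))
qed

lemma tensor_map_id: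
  assumes "module R V" and "module R A" and z: "z \<in> carrier (tensor R V A)"
  shows "tensor_map R V A id id z = z"
proof -
  interpret S: tensor_modules R V A by (rule tensor_modules.intro) fact+
  obtain c where c: "c \<in> carrier (pairs_group V A)" "z = tensor_null R V A #>\<^bsub>pairs_group V A\<^esub> c"
    using S.tensor_carrierE[OF z] .
  have "frag_map id c = c"
    using c(1) unfolding carrier_free_Abelian_group_iff
    by (induction rule: frag_induction) (auto simp: frag_extend_diff)
  then show ?thesis
    using tensor_map_coset[OF assms(1,1,2) lin_map_id c(1)] by (simp add: c(2))
qed

text \<open>In contrast to functoriality, this fails on representatives. On a generator
  \<open>(v, a)\<close> the difference of the two sides is the relation for additivity in the first
  factor, and differences of null elements are null.\<close>

lemma tensor_map_add:
  assumes "module R V" and "module R W" and "module R A"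
    and g: "lin_map R V W g" and h: "lin_map R V W h"
    and k: "lin_map R V W k" "\<And>x. x \<in> carrier V \<Longrightarrow> k x = g x \<oplus>\<^bsub>W\<^esub> h x"
    and z: "z \<in> carrier (tensor R V A)"
  shows "tensor_map R W A k id z = tensor_map R W A g id z \<otimes>\<^bsub>tensor R W A\<^esub> tensor_map R W A h id z"
proof -
  interpret S: tensor_modules R V A by (rule tensor_modules.intro) fact+
  interpret T: tensor_modules R W A by (rule tensor_modules.intro) fact+
  obtain c where c: "c \<in> carrier (pairs_group V A)" "z = tensor_null R V A #>\<^bsub>pairs_group V A\<^esub> c"
    using S.tensor_carrierE[OF z] .
  have car: "frag_map f c \<in> carrier (pairs_group W A)" if "lin_map R V W f" for f
    using that c(1) by (intro frag_map_carrier) (auto dest: lin_mapD)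
  have "frag_map k c - (frag_map g c + frag_map h c) \<in> tensor_null R W A"
    using c(1) unfolding carrier_free_Abelian_group_iff
  proof (induction rule: frag_induction)
    case zero
    then show ?case using T.null_zero by simp
  next
    case (one x)
    obtain v a where va: "x = (v, a)" "v \<in> carrier V" "a \<in> carrier A" using one by auto
    have "frag_of (g v \<oplus>\<^bsub>W\<^esub> h v, a) - frag_of (g v, a) - frag_of (h v, a) \<in> tensor_relations R W A"
      using va lin_mapD(1)[OF g] lin_mapD(1)[OF h] unfolding tensor_relations_def by blast
    then show ?case
      by (auto simp: va k tensor_null_def diff_diff_eq intro: generate.incl)
  next
    case (diff a b)
    let ?d = "\<lambda>c. frag_map k c - (frag_map g c + frag_map h c)"
    have "?d (a - b) = ?d a - ?d b" by (simp add: frag_extend_diff)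
    then show ?case using diff T.null_diff by simp
  qed
  then have "tensor_null R W A #>\<^bsub>pairs_group W A\<^esub> frag_map k c
    = tensor_null R W A #>\<^bsub>pairs_group W A\<^esub> (frag_map g c + frag_map h c)"
    by (intro T.coset_eqI frag_add_closed car g h k(1))
  then show ?thesis
    unfolding c(2) tensor_map_coset[OF assms(1-3) g c(1)] tensor_map_coset[OF assms(1-3) h c(1)]
      tensor_map_coset[OF assms(1-3) k(1) c(1)] T.tensor_mult[OF car[OF g] car[OF h]] .
qed


section \<open>The bottom vertex for polynomial laws\<close>

lemma lin_map_bpt_obj: "lin_map R (obj_mod R E) E bpt"
  by (auto simp: lin_map_def)

lemma lin_map_Obj_zero:
  assumes "module R E"
  shows "lin_map R E (obj_mod R E) (\<lambda>y. Obj (y, \<zero>\<^bsub>R\<^esub>))"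
proof -
  interpret module R E by fact
  show ?thesis by (auto simp: lin_map_def)
qed

lemma lin_map_keep_tpt:
  assumes "module R F"
  shows "lin_map R (obj_mod R E) (obj_mod R F) (\<lambda>p. Obj (\<zero>\<^bsub>F\<^esub>, tpt p))"
proof -
  interpret module R F by fact
  show ?thesis by (auto simp: lin_map_def)
qed

lemma module_funpow_obj_mod: "module R E \<Longrightarrow> module R ((obj_mod R ^^ n) E)"
  by (induction n) (auto intro: module_obj_mod)

lemma lin_map_funpow_bpt: "lin_map R ((obj_mod R ^^ n) E) E (bpt ^^ n)"
proof (induction n)
  case (Suc n)
  have "(bpt ^^ Suc n :: ('b, 'a) pt \<Rightarrow> ('b, 'a) pt) = (bpt ^^ n) \<circ> bpt"
    by (simp add: funpow_Suc_right del: funpow.simps)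
  then show ?case
    using lin_map_comp[OF lin_map_bpt_obj Suc] by (simp add: o_def)
qed (simp flip: id_def)

lemma lin_map_funpow_Obj_zero:
  assumes "module R E"
  shows "lin_map R E ((obj_mod R ^^ n) E) ((\<lambda>y. Obj (y, \<zero>\<^bsub>R\<^esub>)) ^^ n)"
proof (induction n)
  case (Suc n)
  then show ?case
    using lin_map_comp[OF Suc lin_map_Obj_zero[OF module_funpow_obj_mod[OF assms, of n]]] by (simp add: o_def)
qed (simp flip: id_def)

lemma lin_map_keep_scalars:
  assumes "module R E'"
  shows "lin_map R ((obj_mod R ^^ n) E) ((obj_mod R ^^ n) E') (keep_scalars E' n)"
proof (induction n)
  case 0
  interpret module R E' by fact
  show ?case by (auto simp: lin_map_def)
next
  case (Suc n)
  then show ?case by (auto simp: lin_map_def Pi_iff)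
qed

text \<open>Inserting the two summands of \<open>g A y\<close> into the outer inclusion yields three
  summands. The two of them that do not involve \<open>f\<close> come from linear maps: one keeps
  the first \<open>n\<close> scalars, the other the last one. By \<open>tensor_map_add\<close> they
  combine into the map that keeps all \<open>n + 1\<close> scalars.\<close>

lemma law_times_id_Suc:
  fixes R :: "'k ring" and f :: "(('v, 'k) pt, ('w, 'k) pt, 'k, 'u) law"
  assumes E: "module R E" and E': "module R E'" and A: "module R A"
    and f: "f A \<in> carrier (tensor R E A) \<rightarrow> carrier (tensor R E' A)"
    and z: "z \<in> carrier (tensor R ((obj_mod R ^^ Suc n) E) A)"
    and g: "\<And>y. y \<in> carrier (tensor R ((obj_mod R ^^ n) E) A) \<Longrightarrow> g A y = law_times_id R n E E' f A y"
  shows "law_times_id R 1 ((obj_mod R ^^ n) E) ((obj_mod R ^^ n) E') g A z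
    = law_times_id R (Suc n) E E' f A z"
proof -
  define F F' where "F = (obj_mod R ^^ n) E" and "F' = (obj_mod R ^^ n) E'"
  define inc :: "('w, 'k) pt \<Rightarrow> ('w, 'k) pt" where "inc = (\<lambda>y. Obj (y, \<zero>\<^bsub>R\<^esub>))"
  define last :: "('v, 'k) pt \<Rightarrow> ('w, 'k) pt" where "last = (\<lambda>p. Obj (\<zero>\<^bsub>F'\<^esub>, tpt p))"
  have F: "module R F" and F': "module R F'"
    using E E' by (simp_all add: F_def F'_def module_funpow_obj_mod)
  note oF = module_obj_mod[OF F] and oF' = module_obj_mod[OF F']
  interpret E': module R E' by fact
  interpret T: comm_group "tensor R (obj_mod R F') A"
    using oF' A by (intro tensor_modules.comm_group_tensor tensor_modules.intro)
  have bpt1: "lin_map R (obj_mod R F) F bpt" by (rule lin_map_bpt_obj)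
  have bptn: "lin_map R F E (bpt ^^ n)" unfolding F_def by (rule lin_map_funpow_bpt)
  have inc1: "lin_map R F' (obj_mod R F') inc" unfolding inc_def by (rule lin_map_Obj_zero[OF F'])
  have incn: "lin_map R E' F' (inc ^^ n)"
    unfolding inc_def F'_def by (rule lin_map_funpow_Obj_zero[OF E'])
  have keep: "lin_map R F F' (keep_scalars E' n)"
    unfolding F_def F'_def by (rule lin_map_keep_scalars[OF E'])
  have keepS: "lin_map R (obj_mod R F) (obj_mod R F') (keep_scalars E' (Suc n))"
    using lin_map_keep_scalars[OF E', of "Suc n" E] by (simp add: F_def F'_def)
  have last: "lin_map R (obj_mod R F) (obj_mod R F') last"
    unfolding last_def by (rule lin_map_keep_tpt[OF F'])
  have z: "z \<in> carrier (tensor R (obj_mod R F) A)"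
    using z by (simp add: F_def)
  define y where "y = tensor_map R F A bpt id z"
  have y: "y \<in> carrier (tensor R F A)"
    unfolding y_def by (rule tensor_map_closed[OF oF F A bpt1 z])
  define x where "x = tensor_map R E A (bpt ^^ n) id y"
  have x: "x \<in> carrier (tensor R E A)"
    unfolding x_def by (rule tensor_map_closed[OF F E A bptn y])
  have x_eq: "tensor_map R E A (bpt ^^ Suc n) id z = x"
    using tensor_map_comp[OF oF F E A bpt1 bptn z]
    by (simp add: x_def y_def funpow_Suc_right del: funpow.simps)
  have fx: "f A x \<in> carrier (tensor R E' A)" using f x by blast
  define u where "u = tensor_map R F' A (inc ^^ n) id (f A x)"
  have u: "u \<in> carrier (tensor R F' A)"
    unfolding u_def by (rule tensor_map_closed[OF E' F' A incn fx])
  define v where "v = tensor_map R F' A (keep_scalars E' n) id y"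
  have v: "v \<in> carrier (tensor R F' A)"
    unfolding v_def by (rule tensor_map_closed[OF F F' A keep y])
  have "keep_scalars F' (Suc 0) = last"
    by (rule ext) (simp add: last_def)
  then have "law_times_id R 1 F F' g A z
      = tensor_map R (obj_mod R F') A inc id (g A y)
        \<otimes>\<^bsub>tensor R (obj_mod R F') A\<^esub> tensor_map R (obj_mod R F') A last id z"
    by (simp add: law_times_id_def inc_def y_def Let_def)
  also have "g A y = u \<otimes>\<^bsub>tensor R F' A\<^esub> v"
    using g[of y] y by (simp add: law_times_id_def u_def v_def inc_def F_def F'_def x_def Let_def)
  also have "tensor_map R (obj_mod R F') A inc id (u \<otimes>\<^bsub>tensor R F' A\<^esub> v)
      = tensor_map R (obj_mod R F') A inc id u
        \<otimes>\<^bsub>tensor R (obj_mod R F') A\<^esub> tensor_map R (obj_mod R F') A inc id v"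
    by (rule tensor_map_mult[OF F' oF' A inc1 u v])
  also have "tensor_map R (obj_mod R F') A inc id u
      = tensor_map R (obj_mod R F') A (inc ^^ Suc n) id (f A x)"
    using tensor_map_comp[OF E' F' oF' A incn inc1 fx] by (simp add: u_def)
  also have "tensor_map R (obj_mod R F') A inc id v
      = tensor_map R (obj_mod R F') A (inc \<circ> keep_scalars E' n \<circ> bpt) id z"
    using tensor_map_comp[OF F F' oF' A keep inc1 y]
      tensor_map_comp[OF oF F oF' A bpt1 lin_map_comp[OF keep inc1] z]
    by (simp add: v_def y_def)
  also have "tensor_map R (obj_mod R F') A (inc ^^ Suc n) id (f A x)
        \<otimes>\<^bsub>tensor R (obj_mod R F') A\<^esub> tensor_map R (obj_mod R F') A (inc \<circ> keep_scalars E' n \<circ> bpt) id z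
        \<otimes>\<^bsub>tensor R (obj_mod R F') A\<^esub> tensor_map R (obj_mod R F') A last id z
      = tensor_map R (obj_mod R F') A (inc ^^ Suc n) id (f A x)
        \<otimes>\<^bsub>tensor R (obj_mod R F') A\<^esub>
          (tensor_map R (obj_mod R F') A (inc \<circ> keep_scalars E' n \<circ> bpt) id z
          \<otimes>\<^bsub>tensor R (obj_mod R F') A\<^esub> tensor_map R (obj_mod R F') A last id z)"
  proof (rule T.m_assoc)
    show "tensor_map R (obj_mod R F') A (inc ^^ Suc n) id (f A x) \<in> carrier (tensor R (obj_mod R F') A)"
      using tensor_map_closed[OF E' oF' A _ fx] lin_map_comp[OF incn inc1] by simp
    show "tensor_map R (obj_mod R F') A (inc \<circ> keep_scalars E' n \<circ> bpt) id z
        \<in> carrier (tensor R (obj_mod R F') A)"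
      by (rule tensor_map_closed[OF oF oF' A lin_map_comp[OF bpt1 lin_map_comp[OF keep inc1]] z])
    show "tensor_map R (obj_mod R F') A last id z \<in> carrier (tensor R (obj_mod R F') A)"
      by (rule tensor_map_closed[OF oF oF' A last z])
  qed
  also have "tensor_map R (obj_mod R F') A (inc \<circ> keep_scalars E' n \<circ> bpt) id z
        \<otimes>\<^bsub>tensor R (obj_mod R F') A\<^esub> tensor_map R (obj_mod R F') A last id z
      = tensor_map R (obj_mod R F') A (keep_scalars E' (Suc n)) id z"
  proof (rule tensor_map_add[OF oF oF' A lin_map_comp[OF bpt1 lin_map_comp[OF keep inc1]] last keepS _ z,
        symmetric])
    fix p assume "p \<in> carrier (obj_mod R F)"
    then obtain q t where p: "p = Obj (q, t)" "q \<in> carrier F" "t \<in> carrier R" by auto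
    interpret F': module R F' by fact
    show "keep_scalars E' (Suc n) p = (inc \<circ> keep_scalars E' n \<circ> bpt) p \<oplus>\<^bsub>obj_mod R F'\<^esub> last p"
      using p lin_mapD(1)[OF keep p(2)] by (simp add: inc_def last_def)
  qed
  also have "tensor_map R (obj_mod R F') A (inc ^^ Suc n) id (f A x)
        \<otimes>\<^bsub>tensor R (obj_mod R F') A\<^esub> tensor_map R (obj_mod R F') A (keep_scalars E' (Suc n)) id z
      = law_times_id R (Suc n) E E' f A z"
    unfolding law_times_id_def Let_def x_eq by (simp only: inc_def F'_def funpow.simps(2) o_apply)
  finally show ?thesis
    by (simp only: F_def F'_def)
qed

lemma funpow_obj_lmap:
  "fst ((obj_lmap R ^^ n) (E, E', f)) = (obj_mod R ^^ n) E"
  "fst (snd ((obj_lmap R ^^ n) (E, E', f))) = (obj_mod R ^^ n) E'"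
  \<comment> \<open>\<open>obj_lmap\<close> is defined by matching on a triple; this instance
    rewrites it on an arbitrary \<open>F\<close> by means of its projections.\<close>
  by (induction n) (simp_all add: obj_lmap.simps[of R "fst F" "fst (snd F)" "snd (snd F)" for F, simplified])

lemma law_eq_funpow_obj_lmap:
  fixes R :: "'k ring" and f :: "(('v, 'k) pt, ('w, 'k) pt, 'k, 'u) law"
  assumes E: "module R E" and E': "module R E'"
    and f: "\<And>A. algebra R A \<Longrightarrow> f A \<in> carrier (tensor R E A) \<rightarrow> carrier (tensor R E' A)"
  shows "law_eq R ((obj_mod R ^^ n) E) (the_map ((obj_lmap R ^^ n) (E, E', f))) (law_times_id R n E E' f)"
proof (induction n)
  case 0
  show ?case
    unfolding law_eq_def
  proof (intro allI impI ballI)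
    fix A :: "('k, 'u) alg" and z assume A: "algebra R A" and "z \<in> carrier (tensor R ((obj_mod R ^^ 0) E) A)"
    then have z: "z \<in> carrier (tensor R E A)" by simp
    have mA: "module R A" by (rule algebra.module[OF A])
    have fz: "f A z \<in> carrier (tensor R E' A)" using f[OF A] z by blast
    interpret E: module R E by fact
    interpret E': module R E' by fact
    have zero: "lin_map R E E' (\<lambda>_. \<zero>\<^bsub>E'\<^esub>)" by (auto simp: lin_map_def)
    interpret T: comm_group "tensor R E' A"
      using E' mA by (intro tensor_modules.comm_group_tensor tensor_modules.intro)
    \<comment> \<open>For \<open>n = 0\<close> the summand that keeps the scalars comes from the
      zero map. The zero map is the sum of itself with itself, so its value is an idempotent element
      of a group and thus neutral.\<close>
    define o' where "o' = tensor_map R E' A (\<lambda>p. \<zero>\<^bsub>E'\<^esub>) id z"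
    have o': "o' \<in> carrier (tensor R E' A)" "o' = o' \<otimes>\<^bsub>tensor R E' A\<^esub> o'"
      unfolding o'_def using tensor_map_closed[OF E E' mA zero z]
        tensor_map_add[OF E E' mA zero zero zero _ z] by auto
    have "o' = \<one>\<^bsub>tensor R E' A\<^esub>"
      using o' T.r_cancel_one by metis
    moreover have "keep_scalars E' 0 = (\<lambda>p :: ('v, 'k) pt. \<zero>\<^bsub>E'\<^esub>)"
      by (rule ext) simp
    ultimately show "the_map ((obj_lmap R ^^ 0) (E, E', f)) A z = law_times_id R 0 E E' f A z"
      using fz by (simp add: law_times_id_def Let_def tensor_map_id[OF E mA z] tensor_map_id[OF E' mA fz]
          o'_def id_def[symmetric])
  qed
next
  case (Suc n)
  define g where "g = the_map ((obj_lmap R ^^ n) (E, E', f))"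
  have eq: "(obj_lmap R ^^ n) (E, E', f) = ((obj_mod R ^^ n) E, (obj_mod R ^^ n) E', g)"
    by (simp add: prod_eq_iff funpow_obj_lmap g_def)
  show ?case
    unfolding law_eq_def
  proof (intro allI impI ballI)
    fix A :: "('k, 'u) alg" and z
    assume A: "algebra R A" and z: "z \<in> carrier (tensor R ((obj_mod R ^^ Suc n) E) A)"
    have "law_times_id R 1 ((obj_mod R ^^ n) E) ((obj_mod R ^^ n) E') g A z
        = law_times_id R (Suc n) E E' f A z"
      by (rule law_times_id_Suc[where f = f and A = A, OF E E' algebra.module[OF A] f[OF A] z])
        (use Suc A in \<open>simp add: law_eq_def g_def\<close>)
    then show "the_map ((obj_lmap R ^^ Suc n) (E, E', f)) A z = law_times_id R (Suc n) E E' f A z"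
      by (simp add: eq)
  qed
qed

lemma base_law_closed:
  fixes f :: "('v, 'w, 'k, 'u) law"
  assumes V: "module R V" and W: "module R W" and f: "polynomial_law R V W f" and A: "algebra R A"
  shows "base_law R V W f A
    \<in> carrier (tensor R (wrap_mod Base V) A) \<rightarrow> carrier (tensor R (wrap_mod Base W) A)"
proof
  fix z :: "(('v, 'k) pt \<times> ('k, 'u) alg_elt \<Rightarrow>\<^sub>0 int) set"
  assume z: "z \<in> carrier (tensor R (wrap_mod Base V) A)"
  note A' = algebra.module[OF A]
  have "lin_map R (wrap_mod Base V) V unBase" by (auto simp: lin_map_def)
  from tensor_map_closed[OF module_wrap_mod[OF V] V A' this z]
  have "f A (tensor_map R V A unBase id z) \<in> carrier (tensor R W A)"
    using f A by (auto simp: polynomial_law_def)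
  moreover have "lin_map R W (wrap_mod Base W) Base" by (auto simp: lin_map_def)
  ultimately show "base_law R V W f A z \<in> carrier (tensor R (wrap_mod Base W) A)"
    unfolding base_law_def by (intro tensor_map_closed[OF W module_wrap_mod[OF W] A']) auto
qed

lemma law_eq_vertex:
  fixes R :: "'k ring" and f :: "('v, 'w, 'k, 'u) law"
  assumes "finite N" and V: "module R V" and W: "module R W" and f: "polynomial_law R V W f"
  shows "law_eq R (fst (vertex (law_G R) (labels N) (base_lmap R V W f) \<alpha>))
      (the_map (vertex (law_G R) (labels N) (base_lmap R V W f) \<alpha>))
      (the_map (composite (law_G R) \<alpha> N (base_lmap R V W f)))"
    and "law_eq R (fst (vertex (law_G R) (labels N) (base_lmap R V W f) N))
      (the_map (vertex (law_G R) (labels N) (base_lmap R V W f) N))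
      (the_map ((mor_lmap R ^^ card N) (base_lmap R V W f)))"
    and "law_eq R (fst (vertex (law_G R) (labels N) (base_lmap R V W f) {}))
      (the_map (vertex (law_G R) (labels N) (base_lmap R V W f) {}))
      (law_times_id R (card N) (wrap_mod Base V) (wrap_mod Base W) (base_law R V W f))"
proof -
  have G: "law_G R {k} k = (mor_lmap R :: ('v, 'w, 'k, 'u) lmap \<Rightarrow> _)"
    "law_G R {} k = (obj_lmap R :: ('v, 'w, 'k, 'u) lmap \<Rightarrow> _)" for k
    by (auto simp: law_G_def)
  show "law_eq R (fst (vertex (law_G R) (labels N) (base_lmap R V W f) \<alpha>))
      (the_map (vertex (law_G R) (labels N) (base_lmap R V W f) \<alpha>))
      (the_map (composite (law_G R) \<alpha> N (base_lmap R V W f)))"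
    by (simp add: vertex_eq_composite law_eq_def)
  show "law_eq R (fst (vertex (law_G R) (labels N) (base_lmap R V W f) N))
      (the_map (vertex (law_G R) (labels N) (base_lmap R V W f) N))
      (the_map ((mor_lmap R ^^ card N) (base_lmap R V W f)))"
    by (simp add: vertex_top_eq_funpow[of "law_G R", OF G(1) assms(1)] law_eq_def)
  show "law_eq R (fst (vertex (law_G R) (labels N) (base_lmap R V W f) {}))
      (the_map (vertex (law_G R) (labels N) (base_lmap R V W f) {}))
      (law_times_id R (card N) (wrap_mod Base V) (wrap_mod Base W) (base_law R V W f))"
    unfolding vertex_bottom_eq_funpow[of "law_G R", OF G(2)] base_lmap_def
    using law_eq_funpow_obj_lmap[OF module_wrap_mod[OF V] module_wrap_mod[OF W] base_law_closed[OF V W f],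
        where n = "card N"]
    by (simp add: funpow_obj_lmap)
qed


section \<open>Topological modules\<close>

lemma topspace_wrap_top [simp]:
  fixes \<phi> :: "'a \<Rightarrow> 'b"
  shows "inj \<phi> \<Longrightarrow> topspace (wrap_top \<phi> T) = \<phi> ` topspace T"
  by (auto simp: wrap_top_def topspace_pullback_topology the_inv_f_f)

lemma continuous_map_wrap_top:
  fixes \<phi> :: "'a \<Rightarrow> 'b"
  assumes "inj \<phi>" and "continuous_map X T f"
  shows "continuous_map X (wrap_top \<phi> T) (\<lambda>x. \<phi> (f x))"
  unfolding wrap_top_def
proof (rule continuous_map_pullback')
  show "continuous_map X T (the_inv \<phi> \<circ> (\<lambda>x. \<phi> (f x)))"
    using assms by (simp add: o_def the_inv_f_f)
  show "topspace X \<subseteq> (\<lambda>x. \<phi> (f x)) -` \<phi> ` topspace T"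
    using continuous_map_image_subset_topspace[OF assms(2)] by auto
qed

lemma continuous_map_the_inv_wrap_top: "continuous_map (wrap_top \<phi> T) T (the_inv \<phi>)"
  unfolding wrap_top_def using continuous_map_pullback[OF continuous_map_id] by (simp add: id_def o_def)

lemma Hausdorff_space_wrap_top:
  fixes \<phi> :: "'a \<Rightarrow> 'b"
  assumes "inj \<phi>" and "Hausdorff_space T"
  shows "Hausdorff_space (wrap_top \<phi> T)"
  by (rule Hausdorff_space_injective_preimage[OF assms(2) continuous_map_the_inv_wrap_top])
    (use assms(1) in \<open>auto simp: inj_on_def the_inv_f_f\<close>)

lemma the_inv_Obj [simp]: "the_inv Obj (Obj q) = q"
  by (simp add: the_inv_f_f)

lemma the_inv_Mor [simp]: "the_inv Mor (Mor q) = q"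
  by (simp add: the_inv_f_f)

locale tdc =
  fixes R :: "'k ring" (structure) and TK :: "'k topology"
  assumes top_ring: "top_ring R TK" and Hausdorff_TK: "Hausdorff_space TK"
    and dense_Units: "TK closure_of Units R = carrier R"
begin

sublocale R: cring R
  using top_ring by (simp add: top_ring_def)

lemma topspace_TK [simp]: "topspace TK = carrier R"
  using top_ring by (simp add: top_ring_def)

definition tmod :: "('k, 'a) module \<Rightarrow> 'a topology \<Rightarrow> bool" where
  "tmod E T \<longleftrightarrow> top_module R TK E T \<and> Hausdorff_space T"

lemma tmodD:
  assumes "tmod E T"
  shows "module R E" and "topspace T = carrier E" and "Hausdorff_space T"
  using assms by (auto simp: tmod_def top_module_def)

lemma continuous_add:
  assumes "tmod E T" and "continuous_map X T f" and "continuous_map X T g"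
  shows "continuous_map X T (\<lambda>x. f x \<oplus>\<^bsub>E\<^esub> g x)"
  using continuous_map_compose[OF continuous_map_pairedI[OF assms(2,3)], of T "\<lambda>(x, y). x \<oplus>\<^bsub>E\<^esub> y"] assms(1)
  by (simp add: tmod_def top_module_def o_def)

lemma continuous_smult:
  assumes "tmod E T" and "continuous_map X TK f" and "continuous_map X T g"
  shows "continuous_map X T (\<lambda>x. f x \<odot>\<^bsub>E\<^esub> g x)"
  using continuous_map_compose[OF continuous_map_pairedI[OF assms(2,3)], of T "\<lambda>(x, y). x \<odot>\<^bsub>E\<^esub> y"] assms(1)
  by (simp add: tmod_def top_module_def o_def)

lemma continuous_minus:
  assumes "tmod E T" and "continuous_map X T f" and "continuous_map X T g"
  shows "continuous_map X T (\<lambda>x. f x \<ominus>\<^bsub>E\<^esub> g x)"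
proof -
  have "continuous_map X T (\<lambda>x. \<ominus>\<^bsub>E\<^esub> g x)"
    using continuous_map_compose[OF assms(3), of T "\<lambda>x. \<ominus>\<^bsub>E\<^esub> x"] assms(1)
    by (simp add: tmod_def top_module_def o_def)
  from continuous_add[OF assms(1,2) this] show ?thesis
    by (simp add: a_minus_def)
qed

lemma continuous_carrier:
  "tmod E T \<Longrightarrow> continuous_map X T f \<Longrightarrow> x \<in> topspace X \<Longrightarrow> f x \<in> carrier E"
  using continuous_map_image_subset_topspace[of X T f] tmodD(2)[of E T] by blast

lemma module_eq_smult_minus_one:
  assumes "module R E" and x: "x \<in> carrier E"
  shows "\<ominus>\<^bsub>E\<^esub> x = (\<ominus> \<one>) \<odot>\<^bsub>E\<^esub> x"
proof -
  interpret E: module R E by fact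
  show ?thesis using x by (simp add: E.smult_l_minus)
qed

text \<open>Negation is multiplication by \<open>- 1\<close>, so its continuity comes with that of
  the scalar multiplication.\<close>

lemma tmodI:
  assumes E: "module R E" and T: "topspace T = carrier E" and "Hausdorff_space T"
    and add: "continuous_map (prod_topology T T) T (\<lambda>p. fst p \<oplus>\<^bsub>E\<^esub> snd p)"
    and smult: "continuous_map (prod_topology TK T) T (\<lambda>p. fst p \<odot>\<^bsub>E\<^esub> snd p)"
  shows "tmod E T"
proof -
  interpret E: module R E by fact
  have "continuous_map T (prod_topology TK T) (\<lambda>x. (\<ominus> \<one>, x))"
    by (intro continuous_map_pairedI) auto
  from continuous_map_compose[OF this smult]
  have "continuous_map T T (\<lambda>x. (\<ominus> \<one>) \<odot>\<^bsub>E\<^esub> x)"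
    by (simp add: o_def)
  then have "continuous_map T T (\<lambda>x. \<ominus>\<^bsub>E\<^esub> x)"
    by (rule continuous_map_eq) (simp add: T module_eq_smult_minus_one[OF E])
  then show ?thesis
    using assms by (simp add: tmod_def top_module_def split_def)
qed

lemma tmod_wrap:
  fixes \<phi> :: "'a \<Rightarrow> 'b"
  assumes E: "tmod E T" and inj: "inj \<phi>"
  shows "tmod (wrap_mod \<phi> E) (wrap_top \<phi> T)"
proof (rule tmodI)
  note c = continuous_map_compose[OF _ continuous_map_the_inv_wrap_top, unfolded o_def]
  show "continuous_map (prod_topology (wrap_top \<phi> T) (wrap_top \<phi> T)) (wrap_top \<phi> T)
      (\<lambda>p. fst p \<oplus>\<^bsub>wrap_mod \<phi> E\<^esub> snd p)"
    by (rule continuous_map_eq[OF continuous_map_wrap_top[OF inj continuous_add[OF E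
            c[OF continuous_map_fst] c[OF continuous_map_snd]]]])
      (auto simp: inj the_inv_f_f)
  show "continuous_map (prod_topology TK (wrap_top \<phi> T)) (wrap_top \<phi> T)
      (\<lambda>p. fst p \<odot>\<^bsub>wrap_mod \<phi> E\<^esub> snd p)"
    by (rule continuous_map_eq[OF continuous_map_wrap_top[OF inj continuous_smult[OF E
            continuous_map_fst c[OF continuous_map_snd]]]])
      (auto simp: inj the_inv_f_f)
qed (use tmodD[OF E] inj in \<open>auto intro: module_wrap_mod Hausdorff_space_wrap_top\<close>)

lemma tmod_prod:
  assumes E: "tmod E T" and F: "tmod F T'"
  shows "tmod (prod_mod E F) (prod_topology T T')"
proof (rule tmodI)
  note c1 = continuous_map_compose[OF _ continuous_map_fst, unfolded o_def]
  note c2 = continuous_map_compose[OF _ continuous_map_snd, unfolded o_def]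
  note f = continuous_map_fst and s = continuous_map_snd
  show "continuous_map (prod_topology (prod_topology T T') (prod_topology T T')) (prod_topology T T')
      (\<lambda>p. fst p \<oplus>\<^bsub>prod_mod E F\<^esub> snd p)"
    by (rule continuous_map_eq[OF continuous_map_pairedI[OF
            continuous_add[OF E c1[OF f] c1[OF s]] continuous_add[OF F c2[OF f] c2[OF s]]]]) auto
  show "continuous_map (prod_topology TK (prod_topology T T')) (prod_topology T T')
      (\<lambda>p. fst p \<odot>\<^bsub>prod_mod E F\<^esub> snd p)"
    by (rule continuous_map_eq[OF continuous_map_pairedI[OF
            continuous_smult[OF E f c1[OF s]] continuous_smult[OF F f c2[OF s]]]]) auto
  show "Hausdorff_space (prod_topology T T')"
    using tmodD(3)[OF E] tmodD(3)[OF F] by (simp add: Hausdorff_space_prod_topology)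
qed (use tmodD[OF E] tmodD[OF F] in \<open>auto intro: module_prod_mod\<close>)

lemma tmod_reg: "tmod (reg_mod R) TK"
  by (rule tmodI) (use top_ring Hausdorff_TK in
    \<open>auto simp: top_ring_def split_def intro: module_reg_mod R.is_cring\<close>)

lemma tmod_obj: "tmod E T \<Longrightarrow> tmod (obj_mod R E) (wrap_top Obj (prod_topology T TK))"
  unfolding obj_mod_def by (intro tmod_wrap tmod_prod tmod_reg inj_pt)

lemma tmod_mor:
  "tmod E T \<Longrightarrow> tmod (mor_mod R E) (wrap_top Mor (prod_topology T (prod_topology T TK)))"
  unfolding mor_mod_def by (intro tmod_wrap tmod_prod tmod_reg inj_pt)

lemma continuous_map_Obj:
  assumes "continuous_map X T f" and "continuous_map X TK t"
  shows "continuous_map X (wrap_top Obj (prod_topology T TK)) (\<lambda>x. Obj (f x, t x))"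
  by (intro continuous_map_wrap_top continuous_map_pairedI assms inj_pt)

lemma continuous_map_Mor:
  assumes "continuous_map X T f" and "continuous_map X T g" and "continuous_map X TK t"
  shows "continuous_map X (wrap_top Mor (prod_topology T (prod_topology T TK))) (\<lambda>x. Mor (f x, g x, t x))"
  by (intro continuous_map_wrap_top continuous_map_pairedI assms inj_pt)

lemma continuous_map_Obj_sel:
  shows "continuous_map (wrap_top Obj (prod_topology T TK)) T bpt"
    and "continuous_map (wrap_top Obj (prod_topology T TK)) TK tpt"
proof -
  note c = continuous_map_the_inv_wrap_top[of Obj "prod_topology T TK"]
  show "continuous_map (wrap_top Obj (prod_topology T TK)) T bpt"
    by (rule continuous_map_eq[OF continuous_map_compose[OF c continuous_map_fst]]) auto
  show "continuous_map (wrap_top Obj (prod_topology T TK)) TK tpt"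
    by (rule continuous_map_eq[OF continuous_map_compose[OF c continuous_map_snd]]) auto
qed

lemma continuous_map_Mor_sel:
  shows "continuous_map (wrap_top Mor (prod_topology T (prod_topology T TK))) T bpt"
    and "continuous_map (wrap_top Mor (prod_topology T (prod_topology T TK))) T vpt"
    and "continuous_map (wrap_top Mor (prod_topology T (prod_topology T TK))) TK tpt"
proof -
  note c = continuous_map_the_inv_wrap_top[of Mor "prod_topology T (prod_topology T TK)"]
  note cs = continuous_map_compose[OF c continuous_map_snd]
  show "continuous_map (wrap_top Mor (prod_topology T (prod_topology T TK))) T bpt"
    by (rule continuous_map_eq[OF continuous_map_compose[OF c continuous_map_fst]]) auto
  show "continuous_map (wrap_top Mor (prod_topology T (prod_topology T TK))) T vpt"
    by (rule continuous_map_eq[OF continuous_map_compose[OF cs continuous_map_fst]]) auto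
  show "continuous_map (wrap_top Mor (prod_topology T (prod_topology T TK))) TK tpt"
    by (rule continuous_map_eq[OF continuous_map_compose[OF cs continuous_map_snd]]) auto
qed

section \<open>Open subsets of topological modules and their object and morphism sets\<close>

definition tset :: "('k, 'a) tlinset \<Rightarrow> bool" where
  "tset S \<longleftrightarrow> tmod (amb S) (tau S) \<and> openin (tau S) (pts S)"

lemma tsetD:
  assumes "tset S"
  shows "tmod (amb S) (tau S)" and "module R (amb S)" and "topspace (tau S) = carrier (amb S)"
    and "openin (tau S) (pts S)" and "x \<in> pts S \<Longrightarrow> x \<in> carrier (amb S)"
  using assms tmodD[of "amb S" "tau S"] openin_subset[of "tau S" "pts S"] by (auto simp: tset_def)

lemma topspace_subspace: "tset S \<Longrightarrow> topspace (subspace S) = pts S"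
  using tsetD[of S] by auto

lemma open_set_imp_tset: "open_set R TK S \<Longrightarrow> tset S"
  by (simp add: open_set_def tset_def tmod_def)

lemma openin_wrap_image:
  fixes \<phi> :: "'a \<Rightarrow> 'b"
  assumes inj: "inj \<phi>" and U: "openin T U"
  shows "openin (wrap_top \<phi> T) (\<phi> ` U)"
proof -
  have "\<phi> ` U = the_inv \<phi> -` U \<inter> \<phi> ` topspace T"
    using openin_subset[OF U] by (auto simp: the_inv_f_f[OF inj])
  then show ?thesis
    unfolding wrap_top_def openin_pullback_topology using U by blast
qed

lemma tset_base: "tset S \<Longrightarrow> tset (base_top S)"
  by (simp add: tset_def base_top_def tmod_wrap openin_wrap_image)

lemma tset_obj:
  assumes "tset S"
  shows "tset (obj_top R TK S)"
proof -
  have "openin TK (carrier R)" using openin_topspace[of TK] by simp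
  then have "openin (prod_topology (tau S) TK) (pts S \<times> carrier R)"
    using tsetD(4)[OF assms] by (simp add: openin_prod_Times_iff)
  then show ?thesis
    using tsetD(1)[OF assms] by (simp add: tset_def obj_top_def tmod_obj openin_wrap_image)
qed

lemma openin_dom1:
  assumes S: "tset S"
  shows "openin (prod_topology (tau S) (prod_topology (tau S) TK)) (dom1 R S)"
proof -
  let ?P = "prod_topology (tau S) (prod_topology (tau S) TK)"
  note E = tsetD(1)[OF S]
  have 1: "continuous_map ?P (tau S) fst" by (rule continuous_map_fst)
  have 2: "continuous_map ?P (tau S) (\<lambda>p. fst (snd p))" and 3: "continuous_map ?P TK (\<lambda>p. snd (snd p))"
    using continuous_map_compose[OF continuous_map_snd continuous_map_fst]
      continuous_map_compose[OF continuous_map_snd continuous_map_snd] by (auto simp: o_def)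
  have "openin ?P {p \<in> topspace ?P. fst p \<in> pts S}"
    by (rule openin_continuous_map_preimage[OF 1 tsetD(4)[OF S]])
  moreover have "openin ?P {p \<in> topspace ?P.
      fst p \<oplus>\<^bsub>amb S\<^esub> (snd (snd p) \<odot>\<^bsub>amb S\<^esub> fst (snd p)) \<in> pts S}"
    by (rule openin_continuous_map_preimage[OF continuous_add[OF E 1 continuous_smult[OF E 3 2]] tsetD(4)[OF S]])
  ultimately have "openin ?P ({p \<in> topspace ?P. fst p \<in> pts S} \<inter> {p \<in> topspace ?P.
      fst p \<oplus>\<^bsub>amb S\<^esub> (snd (snd p) \<odot>\<^bsub>amb S\<^esub> fst (snd p)) \<in> pts S})"
    by (rule openin_Int)
  also have "\<dots> = dom1 R S"
    using tsetD(3,5)[OF S] by (auto simp: dom1_def)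
  finally show ?thesis .
qed

lemma tset_mor:
  assumes "tset S"
  shows "tset (mor_top R TK S)"
  using openin_dom1[OF assms] tsetD(1)[OF assms]
  by (simp add: tset_def mor_top_def tmod_mor openin_wrap_image)

lemma mor_top_sel [simp]:
  "pts (mor_top R TK S) = Mor ` dom1 R S" "amb (mor_top R TK S) = mor_mod R (amb S)"
  "tau (mor_top R TK S) = wrap_top Mor (prod_topology (tau S) (prod_topology (tau S) TK))"
  by (simp_all add: mor_top_def)

lemma obj_top_sel [simp]:
  "pts (obj_top R TK S) = Obj ` (pts S \<times> carrier R)" "amb (obj_top R TK S) = obj_mod R (amb S)"
  "tau (obj_top R TK S) = wrap_top Obj (prod_topology (tau S) TK)"
  by (simp_all add: obj_top_def)

lemma whole_sel [simp]: "pts (whole S) = carrier (amb S)" "amb (whole S) = amb S" "tau (whole S) = tau S"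
  by (simp_all add: whole_def)

lemma mor_ptsE:
  assumes "m \<in> pts (mor_top R TK S)"
  obtains x v t where "m = Mor (x, v, t)" "x \<in> pts S" "v \<in> carrier (amb S)" "t \<in> carrier R"
    "x \<oplus>\<^bsub>amb S\<^esub> (t \<odot>\<^bsub>amb S\<^esub> v) \<in> pts S"
  using assms by (auto simp: dom1_def)

lemma mor_ptsI:
  "x \<in> pts S \<Longrightarrow> v \<in> carrier (amb S) \<Longrightarrow> t \<in> carrier R \<Longrightarrow>
    x \<oplus>\<^bsub>amb S\<^esub> (t \<odot>\<^bsub>amb S\<^esub> v) \<in> pts S \<Longrightarrow> Mor (x, v, t) \<in> pts (mor_top R TK S)"
  by (simp add: dom1_def)

lemma Mor_mem_iff: "Mor q \<in> pts (mor_top R TK S) \<longleftrightarrow> q \<in> dom1 R S"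
  by auto

end


section \<open>Density of the units\<close>

context tdc
begin

text \<open>The density of the units enters the proof only here. For open \<open>W\<close> the units
  in \<open>W\<close> are dense in \<open>W\<close>, and continuous maps into a Hausdorff space that
  agree on a set agree on its closure.\<close>

lemma eq_of_eq_on_Units:
  assumes W: "openin TK W" and s: "s \<in> W" and T: "Hausdorff_space T"
    and g: "continuous_map (subtopology TK W) T g" and h: "continuous_map (subtopology TK W) T h"
    and eq: "\<And>u. u \<in> W \<Longrightarrow> u \<in> Units R \<Longrightarrow> g u = h u"
  shows "g s = h s"
proof (rule forall_in_closure_of_eq[OF _ T g h])
  have "s \<in> carrier R" using openin_subset[OF W] s by auto
  then have "s \<in> W \<inter> TK closure_of Units R" using dense_Units s by simp
  then show "s \<in> subtopology TK W closure_of (W \<inter> Units R)"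
    using W by (metis closure_of_subtopology closure_of_subtopology_open Int_absorb1 inf_le1 inf_left_idem)
qed (use eq in auto)

lemma Units_smult_cancel:
  assumes "module R E" and t: "t \<in> Units R" and x: "x \<in> carrier E" and y: "y \<in> carrier E"
    and eq: "t \<odot>\<^bsub>E\<^esub> x = t \<odot>\<^bsub>E\<^esub> y"
  shows "x = y"
proof -
  interpret E: module R E by fact
  have "(inv t \<otimes> t) \<odot>\<^bsub>E\<^esub> x = (inv t \<otimes> t) \<odot>\<^bsub>E\<^esub> y"
    using t x y eq by (simp add: E.smult_assoc1 R.Units_closed del: R.Units_l_inv)
  then show ?thesis using t x y by simp
qed

lemma Units_smult_inv:
  assumes "module R E" and t: "t \<in> Units R" and x: "x \<in> carrier E"
  shows "t \<odot>\<^bsub>E\<^esub> (inv t \<odot>\<^bsub>E\<^esub> x) = x" and "inv t \<odot>\<^bsub>E\<^esub> (t \<odot>\<^bsub>E\<^esub> x) = x"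
proof -
  interpret E: module R E by fact
  show "t \<odot>\<^bsub>E\<^esub> (inv t \<odot>\<^bsub>E\<^esub> x) = x" "inv t \<odot>\<^bsub>E\<^esub> (t \<odot>\<^bsub>E\<^esub> x) = x"
    using t x by (simp_all add: R.Units_closed flip: E.smult_assoc1)
qed

text \<open>Through each morphism runs the curve that moves only the parameter. It stays in the
  morphism set for parameters near \<open>s\<close> because \<open>pts S\<close> is open, and it
  transfers density from the ring to the morphism set.\<close>

lemma line_curve:
  assumes S: "tset S" and m: "Mor (x, v, s) \<in> pts (mor_top R TK S)"
  obtains W where "openin TK W" and "s \<in> W"
    and "\<And>u. u \<in> W \<Longrightarrow> Mor (x, v, u) \<in> pts (mor_top R TK S)"
    and "continuous_map (subtopology TK W) (subspace (mor_top R TK S)) (\<lambda>u. Mor (x, v, u))"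
proof
  note E = tsetD(1)[OF S]
  have x: "x \<in> pts S" "x \<in> carrier (amb S)" and v: "v \<in> carrier (amb S)"
    using m tsetD(5)[OF S] by (auto simp: dom1_def)
  let ?W = "{u \<in> topspace TK. x \<oplus>\<^bsub>amb S\<^esub> (u \<odot>\<^bsub>amb S\<^esub> v) \<in> pts S}"
  have const: "continuous_map TK (tau S) (\<lambda>_. y)" if "y \<in> carrier (amb S)" for y
    using that tsetD(3)[OF S] by simp
  have id: "continuous_map TK TK (\<lambda>u. u)" using continuous_map_id[of TK] by (simp add: id_def)
  show "openin TK ?W"
    by (rule openin_continuous_map_preimage[OF continuous_add[OF E const[OF x(2)]
            continuous_smult[OF E id const[OF v]]] tsetD(4)[OF S]])
  show "s \<in> ?W" using m by (auto simp: dom1_def)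
  show *: "Mor (x, v, u) \<in> pts (mor_top R TK S)" if "u \<in> ?W" for u
    using that x v by (auto simp: dom1_def)
  have "continuous_map TK (tau (mor_top R TK S)) (\<lambda>u. Mor (x, v, u))"
    unfolding mor_top_sel by (intro continuous_map_Mor const x v id)
  then show "continuous_map (subtopology TK ?W) (subspace (mor_top R TK S)) (\<lambda>u. Mor (x, v, u))"
    using * by (intro continuous_map_into_subtopology continuous_map_from_subtopology) auto
qed

text \<open>The two maps are compared along the curve through \<open>m\<close> that fixes
  \<open>x\<close> and \<open>v\<close>, where the question becomes one about maps on an open set of
  the ring.\<close>

lemma mor_eq_of_eq_on_Units:
  assumes S: "tset S" and T: "Hausdorff_space T"
    and g: "continuous_map (subspace (mor_top R TK S)) T g"
    and h: "continuous_map (subspace (mor_top R TK S)) T h"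
    and eq: "\<And>x v t. Mor (x, v, t) \<in> pts (mor_top R TK S) \<Longrightarrow> t \<in> Units R \<Longrightarrow>
      g (Mor (x, v, t)) = h (Mor (x, v, t))"
    and m: "m \<in> pts (mor_top R TK S)"
  shows "g m = h m"
proof -
  obtain x v s where mm: "m = Mor (x, v, s)" using m by auto
  then obtain W where W: "openin TK W" "s \<in> W"
    "\<And>u. u \<in> W \<Longrightarrow> Mor (x, v, u) \<in> pts (mor_top R TK S)"
    "continuous_map (subtopology TK W) (subspace (mor_top R TK S)) (\<lambda>u. Mor (x, v, u))"
    using line_curve[OF S] m by metis
  show ?thesis
    unfolding mm
    by (rule eq_of_eq_on_Units[OF W(1,2) T, where g = "\<lambda>u. g (Mor (x, v, u))" and h = "\<lambda>u. h (Mor (x, v, u))"])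
      (use continuous_map_compose[OF W(4) g] continuous_map_compose[OF W(4) h] W(3) eq in \<open>auto simp: o_def\<close>)
qed

end


section \<open>Slopes and iterated slopes\<close>

lemma (in abelian_group) add_minus_cancel:
  assumes "x \<in> carrier G" and "y \<in> carrier G"
  shows "x \<oplus> (y \<ominus> x) = y" and "(x \<oplus> y) \<ominus> x = y"
  using assms a_lcomm[of x y "\<ominus> x"] by (simp_all add: a_minus_def a_assoc r_neg a_comm[of x y])

context tdc
begin

text \<open>Multiplied by \<open>t\<close>, the difference quotient equation makes sense, and by density holds, for all
  \<open>t\<close>.\<close>

definition has_slope ::
    "('k, ('v, 'k) pt) tlinset \<Rightarrow> ('k, 'b) module \<Rightarrow> 'b topology \<Rightarrow>
     (('v, 'k) pt \<Rightarrow> 'b) \<Rightarrow> (('v, 'k) pt \<Rightarrow> 'b) \<Rightarrow> bool" where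
  "has_slope S E T f G \<longleftrightarrow>
    continuous_map (subspace (mor_top R TK S)) T G
    \<and> (\<forall>x v t. Mor (x, v, t) \<in> pts (mor_top R TK S) \<longrightarrow>
         f (x \<oplus>\<^bsub>amb S\<^esub> (t \<odot>\<^bsub>amb S\<^esub> v)) = f x \<oplus>\<^bsub>E\<^esub> (t \<odot>\<^bsub>E\<^esub> G (Mor (x, v, t))))"

lemma Mor_ptsD:
  assumes "Mor (x, v, t) \<in> pts (mor_top R TK S)"
  shows "x \<in> pts S" and "v \<in> carrier (amb S)" and "t \<in> carrier R"
    and "x \<oplus>\<^bsub>amb S\<^esub> (t \<odot>\<^bsub>amb S\<^esub> v) \<in> pts S"
  using assms by (auto simp: dom1_def)

lemma continuous_mor_sel:
  shows "continuous_map (subspace (mor_top R TK S)) (subspace S) bpt"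
    and "continuous_map (subspace (mor_top R TK S)) (tau S) bpt"
    and "continuous_map (subspace (mor_top R TK S)) (tau S) vpt"
    and "continuous_map (subspace (mor_top R TK S)) TK tpt"
proof -
  show *: "continuous_map (subspace (mor_top R TK S)) (tau S) bpt"
    and "continuous_map (subspace (mor_top R TK S)) (tau S) vpt"
    and "continuous_map (subspace (mor_top R TK S)) TK tpt"
    using continuous_map_Mor_sel[of "tau S"] by (auto intro: continuous_map_from_subtopology)
  show "continuous_map (subspace (mor_top R TK S)) (subspace S) bpt"
    by (rule continuous_map_into_subtopology[OF *]) (auto simp: dom1_def)
qed

lemma continuous_mor_tgt:
  assumes "tset S"
  shows "continuous_map (subspace (mor_top R TK S)) (subspace S)
    (\<lambda>m. bpt m \<oplus>\<^bsub>amb S\<^esub> (tpt m \<odot>\<^bsub>amb S\<^esub> vpt m))"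
  by (rule continuous_map_into_subtopology[OF continuous_add[OF tsetD(1)[OF assms] continuous_mor_sel(2)
          continuous_smult[OF tsetD(1)[OF assms] continuous_mor_sel(4,3)]]])
    (auto simp: dom1_def)

lemma continuous_Mor_dom1:
  "continuous_map (subtopology (prod_topology (tau S) (prod_topology (tau S) TK)) (dom1 R S))
    (subspace (mor_top R TK S)) Mor"
proof (rule continuous_map_into_subtopology)
  have "continuous_map (prod_topology (tau S) (prod_topology (tau S) TK)) (tau (mor_top R TK S)) (\<lambda>q. Mor (id q))"
    unfolding mor_top_sel by (intro continuous_map_wrap_top inj_pt continuous_map_id)
  then show "continuous_map (subtopology (prod_topology (tau S) (prod_topology (tau S) TK)) (dom1 R S))
      (tau (mor_top R TK S)) Mor"
    by (intro continuous_map_from_subtopology) simp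
qed auto

lemma continuous_mor_triple:
  "continuous_map (subspace (mor_top R TK S))
    (subtopology (prod_topology (tau S) (prod_topology (tau S) TK)) (dom1 R S)) (\<lambda>m. (bpt m, vpt m, tpt m))"
  by (intro continuous_map_into_subtopology continuous_map_pairedI continuous_mor_sel) auto

lemma has_slope_continuous: "has_slope S E T f G \<Longrightarrow> continuous_map (subspace (mor_top R TK S)) T G"
  by (simp add: has_slope_def)

lemma has_slopeD:
  "has_slope S E T f G \<Longrightarrow> Mor (x, v, t) \<in> pts (mor_top R TK S) \<Longrightarrow>
    f (x \<oplus>\<^bsub>amb S\<^esub> (t \<odot>\<^bsub>amb S\<^esub> v)) = f x \<oplus>\<^bsub>E\<^esub> (t \<odot>\<^bsub>E\<^esub> G (Mor (x, v, t)))"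
  by (simp add: has_slope_def)

lemma has_slope_carrier:
  assumes "tset S" and "tmod E T" and "has_slope S E T f G" and "m \<in> pts (mor_top R TK S)"
  shows "G m \<in> carrier E"
  using continuous_carrier[OF assms(2) has_slope_continuous[OF assms(3)]] assms(4)
    topspace_subspace[OF tset_mor[OF assms(1)]] by blast

lemma continuous_on_pts_carrier:
  assumes "tset S" and "tmod E T" and "continuous_map (subspace S) T f" and "x \<in> pts S"
  shows "f x \<in> carrier E"
  using continuous_carrier[OF assms(2,3)] assms(4) topspace_subspace[OF assms(1)] by blast

lemma has_slope_unique:
  assumes S: "tset S" and E: "tmod E T" and f: "continuous_map (subspace S) T f"
    and G: "has_slope S E T f G" and H: "has_slope S E T f H" and m: "m \<in> pts (mor_top R TK S)"
  shows "G m = H m"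
proof (rule mor_eq_of_eq_on_Units[OF S tmodD(3)[OF E] has_slope_continuous[OF G] has_slope_continuous[OF H] _ m])
  fix x v t assume m: "Mor (x, v, t) \<in> pts (mor_top R TK S)" and t: "t \<in> Units R"
  interpret E: module R E by (rule tmodD(1)[OF E])
  have c: "f x \<in> carrier E" "G (Mor (x, v, t)) \<in> carrier E" "H (Mor (x, v, t)) \<in> carrier E"
    using continuous_on_pts_carrier[OF S E f] has_slope_carrier[OF S E G m] has_slope_carrier[OF S E H m] m
    by (auto simp: dom1_def)
  show "G (Mor (x, v, t)) = H (Mor (x, v, t))"
    by (rule Units_smult_cancel[OF E.module_axioms t c(2,3)])
      (use has_slopeD[OF G m] has_slopeD[OF H m] c t R.Units_closed in simp)
qed

lemma is_slope_imp_has_slope: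
  assumes S: "tset S" and E: "tmod E T" and f: "continuous_map (subspace S) T f"
    and g: "is_slope R TK (amb S) (tau S) E T (dom1 R S) f g"
  shows "has_slope S E T f (\<lambda>m. g (bpt m, vpt m, tpt m))"
proof -
  interpret E: module R E by (rule tmodD(1)[OF E])
  let ?G = "\<lambda>m. g (bpt m, vpt m, tpt m)"
  have G: "continuous_map (subspace (mor_top R TK S)) T ?G"
    using continuous_map_compose[OF continuous_mor_triple, of S T g] g by (simp add: is_slope_def o_def)
  let ?a = "\<lambda>m. f (bpt m \<oplus>\<^bsub>amb S\<^esub> (tpt m \<odot>\<^bsub>amb S\<^esub> vpt m))"
  let ?b = "\<lambda>m. f (bpt m) \<oplus>\<^bsub>E\<^esub> (tpt m \<odot>\<^bsub>E\<^esub> ?G m)"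
  have eq: "?a m = ?b m" if "m \<in> pts (mor_top R TK S)" for m
  proof (rule mor_eq_of_eq_on_Units[OF S tmodD(3)[OF E] _ _ _ that])
    show "continuous_map (subspace (mor_top R TK S)) T ?a"
      using continuous_map_compose[OF continuous_mor_tgt[OF S] f] by (simp add: o_def)
    show "continuous_map (subspace (mor_top R TK S)) T ?b"
      using continuous_map_compose[OF continuous_mor_sel(1) f]
      by (intro continuous_add[OF E] continuous_smult[OF E] continuous_mor_sel(4) G) (simp add: o_def)
    fix x v t assume m: "Mor (x, v, t) \<in> pts (mor_top R TK S)" and t: "t \<in> Units R"
    then have q: "(x, v, t) \<in> dom1 R S" by auto
    then have "f x \<in> carrier E" "f (x \<oplus>\<^bsub>amb S\<^esub> (t \<odot>\<^bsub>amb S\<^esub> v)) \<in> carrier E"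
      using continuous_on_pts_carrier[OF S E f] by (auto simp: dom1_def)
    moreover have "g (x, v, t) = inv t \<odot>\<^bsub>E\<^esub> (f (x \<oplus>\<^bsub>amb S\<^esub> (t \<odot>\<^bsub>amb S\<^esub> v)) \<ominus>\<^bsub>E\<^esub> f x)"
      using g q t by (auto simp: is_slope_def)
    ultimately show "?a (Mor (x, v, t)) = ?b (Mor (x, v, t))"
      by (simp add: Units_smult_inv[OF E.module_axioms t] E.M.add_minus_cancel)
  qed
  show ?thesis
    unfolding has_slope_def
  proof (intro conjI allI impI G)
    fix x v t assume "Mor (x, v, t) \<in> pts (mor_top R TK S)"
    then show "f (x \<oplus>\<^bsub>amb S\<^esub> (t \<odot>\<^bsub>amb S\<^esub> v)) = f x \<oplus>\<^bsub>E\<^esub> (t \<odot>\<^bsub>E\<^esub> ?G (Mor (x, v, t)))"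
      using eq[of "Mor (x, v, t)"] by simp
  qed
qed

lemma has_slope_imp_is_slope:
  assumes S: "tset S" and E: "tmod E T" and f: "continuous_map (subspace S) T f"
    and G: "has_slope S E T f G"
  shows "is_slope R TK (amb S) (tau S) E T (dom1 R S) f (\<lambda>q. G (Mor q))"
  unfolding is_slope_def
proof (intro conjI ballI, safe)
  interpret E: module R E by (rule tmodD(1)[OF E])
  show "continuous_map (subtopology (prod_topology (tau S) (prod_topology (tau S) TK)) (dom1 R S)) T (\<lambda>q. G (Mor q))"
    using continuous_map_compose[OF continuous_Mor_dom1 has_slope_continuous[OF G]] by (simp add: o_def)
  fix x v t assume q: "(x, v, t) \<in> dom1 R S" and t: "t \<in> Units R"
  then have m: "Mor (x, v, t) \<in> pts (mor_top R TK S)" by simp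
  have c: "f x \<in> carrier E" using q continuous_on_pts_carrier[OF S E f] by (auto simp: dom1_def)
  note Gc = has_slope_carrier[OF S E G m]
  show "G (Mor (x, v, t)) = inv t \<odot>\<^bsub>E\<^esub> (f (x \<oplus>\<^bsub>amb S\<^esub> (t \<odot>\<^bsub>amb S\<^esub> v)) \<ominus>\<^bsub>E\<^esub> f x)"
    unfolding has_slopeD[OF G m]
    using c Gc t by (simp add: Units_smult_inv(2)[OF E.module_axioms t Gc] E.M.add_minus_cancel R.Units_closed)
qed

text \<open>\<open>slope\<close> is a definite description among extensional functions. This lemma
  evaluates it, so that any function that satisfies \<open>has_slope\<close> can serve as the slope
  on the points.\<close>

lemma slope_map_eq:
  assumes S: "tset S" and S': "tset S'" and f: "continuous_map (subspace S) (tau S') f"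
    and G: "has_slope S (amb S') (tau S') f G" and m: "m \<in> pts (mor_top R TK S)"
  shows "slope_map R TK S S' f m = G m"
proof -
  note E = tsetD(1)[OF S']
  let ?Z = "dom1 R S"
  have slope: "slope R TK (amb S) (tau S) (amb S') (tau S') ?Z f = restrict (\<lambda>q. G (Mor q)) ?Z"
    unfolding slope_def
  proof (rule the_equality, intro conjI)
    have "is_slope R TK (amb S) (tau S) (amb S') (tau S') ?Z f (\<lambda>q. G (Mor q))"
      by (rule has_slope_imp_is_slope[OF S E f G])
    then show "is_slope R TK (amb S) (tau S) (amb S') (tau S') ?Z f (restrict (\<lambda>q. G (Mor q)) ?Z)"
      unfolding is_slope_def by (auto elim: continuous_map_eq)
    fix g assume g: "g \<in> extensional ?Z \<and> is_slope R TK (amb S) (tau S) (amb S') (tau S') ?Z f g"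
    show "g = restrict (\<lambda>q. G (Mor q)) ?Z"
    proof (rule extensionalityI)
      fix q assume q: "q \<in> ?Z"
      then have "g (bpt (Mor q), vpt (Mor q), tpt (Mor q)) = G (Mor q)"
        by (intro has_slope_unique[OF S E f is_slope_imp_has_slope[OF S E f conjunct2[OF g]] G]) simp
      then show "g q = restrict (\<lambda>q. G (Mor q)) ?Z q"
        using q by (cases q) auto
    qed (use g in auto)
  qed simp
  show ?thesis
    using m by (auto simp: slope_map_def slope)
qed

text \<open>\<open>Cn\<close> appends every further slope at the end of an iterate built from
  definite descriptions. Here the first slope is split off instead, and some slope is asked to be
  smooth again; this suits inductions on the order in which the domain varies.\<close>

primrec smooth ::
    "nat \<Rightarrow> ('k, ('v, 'k) pt) tlinset \<Rightarrow> ('k, 'b) module \<Rightarrow> 'b topology \<Rightarrow> (('v, 'k) pt \<Rightarrow> 'b) \<Rightarrow> bool" where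
  "smooth 0 S E T f \<longleftrightarrow> continuous_map (subspace S) T f"
| "smooth (Suc n) S E T f \<longleftrightarrow>
    continuous_map (subspace S) T f \<and> (\<exists>G. has_slope S E T f G \<and> smooth n (mor_top R TK S) E T G)"

lemma smooth_continuous: "smooth n S E T f \<Longrightarrow> continuous_map (subspace S) T f"
  by (cases n) auto

lemma smooth_SucD: "smooth (Suc n) S E T f \<Longrightarrow> smooth n S E T f"
proof (induction n arbitrary: S f)
  case (Suc n)
  then obtain G where "continuous_map (subspace S) T f" "has_slope S E T f G"
    "smooth (Suc n) (mor_top R TK S) E T G"
    by (auto simp only: smooth.simps(2)[of "Suc n"])
  then show ?case using Suc.IH[of "mor_top R TK S" G] by auto
qed simp

lemma smooth_mono: "smooth n S E T f \<Longrightarrow> m \<le> n \<Longrightarrow> smooth m S E T f"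
  by (induction n) (auto simp: le_Suc_eq dest: smooth_SucD simp del: smooth.simps(2))

lemma has_slope_cong:
  assumes "\<And>x. x \<in> pts S \<Longrightarrow> f x = g x" and "has_slope S E T f G"
  shows "has_slope S E T g G"
  unfolding has_slope_def
proof (intro conjI allI impI has_slope_continuous[OF assms(2)])
  fix x v t assume m: "Mor (x, v, t) \<in> pts (mor_top R TK S)"
  then show "g (x \<oplus>\<^bsub>amb S\<^esub> (t \<odot>\<^bsub>amb S\<^esub> v)) = g x \<oplus>\<^bsub>E\<^esub> (t \<odot>\<^bsub>E\<^esub> G (Mor (x, v, t)))"
    using has_slopeD[OF assms(2) m] Mor_ptsD[OF m] assms(1) by simp
qed

lemma continuous_cong_pts:
  assumes "tset S" and "\<And>x. x \<in> pts S \<Longrightarrow> f x = g x" and "continuous_map (subspace S) T f"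
  shows "continuous_map (subspace S) T g"
  by (rule continuous_map_eq[OF assms(3)]) (use assms topspace_subspace in auto)

lemma smooth_cong:
  assumes "tset S" and "\<And>x. x \<in> pts S \<Longrightarrow> f x = g x" and "smooth n S E T f"
  shows "smooth n S E T g"
  using assms by (cases n) (auto intro: has_slope_cong continuous_cong_pts)

section \<open>Linear maps, and closure properties of smooth maps\<close>

definition lin_on :: "('k, 'a) tlinset \<Rightarrow> ('k, 'b) tlinset \<Rightarrow> ('a \<Rightarrow> 'b) \<Rightarrow> bool" where
  "lin_on S S' l \<longleftrightarrow>
    lin_map R (amb S) (amb S') l \<and> continuous_map (tau S) (tau S') l \<and> l \<in> pts S \<rightarrow> pts S'"

lemma lin_onD:
  assumes "lin_on S S' l"
  shows "lin_map R (amb S) (amb S') l" and "continuous_map (tau S) (tau S') l"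
    and "x \<in> pts S \<Longrightarrow> l x \<in> pts S'" and "continuous_map (subspace S) (subspace S') l"
proof -
  show "lin_map R (amb S) (amb S') l" and *: "continuous_map (tau S) (tau S') l"
    and "x \<in> pts S \<Longrightarrow> l x \<in> pts S'"
    using assms by (auto simp: lin_on_def)
  show "continuous_map (subspace S) (subspace S') l"
    by (rule continuous_map_into_subtopology[OF continuous_map_from_subtopology[OF *]])
      (use assms in \<open>auto simp: lin_on_def\<close>)
qed

text \<open>The extended tangent map of a linear \<open>l\<close>, whose slope at
  \<open>(x, v, t)\<close> is \<open>l v\<close> (see \<open>mor_map_lin_on\<close>). In this form
  it is defined and linear on the whole ambient module.\<close>

definition lin_mor :: "(('v, 'k) pt \<Rightarrow> ('w, 'k) pt) \<Rightarrow> ('v, 'k) pt \<Rightarrow> ('w, 'k) pt" where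
  "lin_mor l m = Mor (l (bpt m), l (vpt m), tpt m)"

lemma lin_mor_Mor [simp]: "lin_mor l (Mor (x, v, t)) = Mor (l x, l v, t)"
  by (simp add: lin_mor_def)

lemma obj_map_Obj [simp]: "obj_map f (Obj (x, t)) = Obj (f x, t)"
  by (simp add: obj_map_def)

lemma lin_on_mor:
  assumes S: "tset S" and l: "lin_on S S' l"
  shows "lin_on (mor_top R TK S) (mor_top R TK S') (lin_mor l)"
proof -
  note ll = lin_mapD[OF lin_onD(1)[OF l]]
  have "continuous_map (tau (mor_top R TK S)) (tau (mor_top R TK S')) (lin_mor l)"
    unfolding mor_top_sel lin_mor_def
    using continuous_map_compose[OF continuous_map_Mor_sel(1) lin_onD(2)[OF l]]
      continuous_map_compose[OF continuous_map_Mor_sel(2) lin_onD(2)[OF l]]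
    by (intro continuous_map_Mor continuous_map_Mor_sel) (auto simp: o_def)
  moreover have "lin_mor l \<in> pts (mor_top R TK S) \<rightarrow> pts (mor_top R TK S')"
  proof
    interpret E: module R "amb S" by (rule tsetD(2)[OF S])
    fix m assume "m \<in> pts (mor_top R TK S)"
    then obtain x v t where m: "m = Mor (x, v, t)" "x \<in> pts S" "v \<in> carrier (amb S)" "t \<in> carrier R"
      "x \<oplus>\<^bsub>amb S\<^esub> (t \<odot>\<^bsub>amb S\<^esub> v) \<in> pts S" by (rule mor_ptsE)
    then have "l (x \<oplus>\<^bsub>amb S\<^esub> (t \<odot>\<^bsub>amb S\<^esub> v)) = l x \<oplus>\<^bsub>amb S'\<^esub> (t \<odot>\<^bsub>amb S'\<^esub> l v)"
      using tsetD(5)[OF S] by (simp add: ll)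
    then show "lin_mor l m \<in> pts (mor_top R TK S')"
      unfolding m(1) lin_mor_Mor using m lin_onD(3)[OF l] ll(1) by (intro mor_ptsI) force+
  qed
  ultimately show ?thesis
    unfolding lin_on_def by (auto simp: lin_map_def ll)
qed

lemma lin_on_obj:
  assumes l: "lin_on S S' l"
  shows "lin_on (obj_top R TK S) (obj_top R TK S') (obj_map l)"
proof -
  note ll = lin_mapD[OF lin_onD(1)[OF l]]
  have "continuous_map (tau (obj_top R TK S)) (tau (obj_top R TK S')) (obj_map l)"
    unfolding obj_top_sel obj_map_def
    using continuous_map_compose[OF continuous_map_Obj_sel(1) lin_onD(2)[OF l]]
    by (intro continuous_map_Obj continuous_map_Obj_sel) (auto simp: o_def)
  then show ?thesis
    unfolding lin_on_def using lin_onD(3)[OF l] by (auto simp: lin_map_def ll obj_map_def)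
qed

lemma lin_on_mor_bpt: "lin_on (mor_top R TK S) S bpt"
  unfolding lin_on_def mor_top_sel using continuous_map_Mor_sel(1) by (auto simp: lin_map_def dom1_def)

lemma lin_on_mor_vpt: "lin_on (mor_top R TK S) (whole S) vpt"
  unfolding lin_on_def mor_top_sel using continuous_map_Mor_sel(2) by (auto simp: lin_map_def dom1_def)

lemma lin_on_obj_bpt: "lin_on (obj_top R TK S) S bpt"
  unfolding lin_on_def obj_top_sel using continuous_map_Obj_sel(1) by (auto simp: lin_map_def)

text \<open>Covers the maps whose values are only required to lie in a module, such as the parameter
  \<open>tpt\<close> and the slope \<open>l \<circ> vpt\<close> of a linear map.\<close>

definition lin_cont :: "('k, 'a) module \<Rightarrow> 'a topology \<Rightarrow> ('k, 'b) module \<Rightarrow> 'b topology \<Rightarrow> ('a \<Rightarrow> 'b) \<Rightarrow> bool" where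
  "lin_cont E T F T' l \<longleftrightarrow> lin_map R E F l \<and> continuous_map T T' l"

lemma lin_cont_comp: "lin_cont E T F T' l \<Longrightarrow> lin_cont F T' G T'' k \<Longrightarrow> lin_cont E T G T'' (k \<circ> l)"
  unfolding lin_cont_def by (auto intro: lin_map_comp continuous_map_compose)

lemma lin_on_imp_lin_cont: "lin_on S S' l \<Longrightarrow> lin_cont (amb S) (tau S) (amb S') (tau S') l"
  by (simp add: lin_on_def lin_cont_def)

lemma lin_cont_mor_tpt: "lin_cont (amb (mor_top R TK S)) (tau (mor_top R TK S)) (reg_mod R) TK tpt"
  unfolding lin_cont_def mor_top_sel using continuous_map_Mor_sel(3) by (auto simp: lin_map_def)

lemma lin_cont_obj_tpt: "lin_cont (amb (obj_top R TK S)) (tau (obj_top R TK S)) (reg_mod R) TK tpt"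
  unfolding lin_cont_def obj_top_sel using continuous_map_Obj_sel(2) by (auto simp: lin_map_def)

text \<open>The slope of \<open>f \<circ> l\<close> is \<open>G \<circ> lin_mor l\<close>, and
  \<open>lin_mor l\<close> is again of the same kind on the next domain, so the induction reproduces
  the situation.\<close>

lemma smooth_comp_lin_on:
  assumes "tset S\<^sub>1" and "lin_on S\<^sub>1 S l" and "smooth n S E T f"
  shows "smooth n S\<^sub>1 E T (f \<circ> l)"
  using assms
proof (induction n arbitrary: S\<^sub>1 S l f)
  case 0
  then show ?case using continuous_map_compose[OF lin_onD(4)[OF 0(2)], of T f] by (simp add: o_def)
next
  case (Suc n)
  note S1 = Suc.prems(1) and l = Suc.prems(2)
  obtain G where f: "continuous_map (subspace S) T f" and G: "has_slope S E T f G"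
    and sG: "smooth n (mor_top R TK S) E T G"
    using Suc.prems(3) by auto
  note lm = lin_on_mor[OF S1 l] and ll = lin_mapD[OF lin_onD(1)[OF l]]
  interpret E: module R "amb S\<^sub>1" by (rule tsetD(2)[OF S1])
  have "has_slope S\<^sub>1 E T (f \<circ> l) (G \<circ> lin_mor l)"
    unfolding has_slope_def
  proof (intro conjI allI impI)
    show "continuous_map (subspace (mor_top R TK S\<^sub>1)) T (G \<circ> lin_mor l)"
      by (rule continuous_map_compose[OF lin_onD(4)[OF lm] has_slope_continuous[OF G]])
    fix x v t assume m: "Mor (x, v, t) \<in> pts (mor_top R TK S\<^sub>1)"
    then have "l (x \<oplus>\<^bsub>amb S\<^sub>1\<^esub> (t \<odot>\<^bsub>amb S\<^sub>1\<^esub> v)) = l x \<oplus>\<^bsub>amb S\<^esub> (t \<odot>\<^bsub>amb S\<^esub> l v)"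
      using tsetD(5)[OF S1] Mor_ptsD[OF m] by (simp add: ll)
    then show "(f \<circ> l) (x \<oplus>\<^bsub>amb S\<^sub>1\<^esub> (t \<odot>\<^bsub>amb S\<^sub>1\<^esub> v))
        = (f \<circ> l) x \<oplus>\<^bsub>E\<^esub> (t \<odot>\<^bsub>E\<^esub> (G \<circ> lin_mor l) (Mor (x, v, t)))"
      using has_slopeD[OF G, of "l x" "l v" t] lin_onD(3)[OF lm m] by simp
  qed
  moreover have "continuous_map (subspace S\<^sub>1) T (f \<circ> l)"
    by (rule continuous_map_compose[OF lin_onD(4)[OF l] f])
  ultimately show ?case
    using Suc.IH[OF tset_mor[OF S1] lm sG] by (auto simp: o_def)
qed

text \<open>The slope of \<open>l\<close> is \<open>l \<circ> vpt\<close>, again linear and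
  continuous, so the induction never leaves the linear maps.\<close>

lemma smooth_lin_cont:
  assumes "tset S" and "lin_cont (amb S) (tau S) E T l"
  shows "smooth n S E T l"
  using assms
proof (induction n arbitrary: S l)
  case 0
  then show ?case by (auto simp: lin_cont_def intro: continuous_map_from_subtopology)
next
  case (Suc n)
  note S = Suc.prems(1)
  have ll: "lin_map R (amb S) E l" and cl: "continuous_map (tau S) T l"
    using Suc.prems(2) by (auto simp: lin_cont_def)
  have lv: "lin_cont (amb (mor_top R TK S)) (tau (mor_top R TK S)) E T (l \<circ> vpt)"
    using lin_cont_comp[OF lin_on_imp_lin_cont[OF lin_on_mor_vpt], of S E T l] Suc.prems(2) by simp
  then have cv: "continuous_map (subspace (mor_top R TK S)) T (l \<circ> vpt)"
    unfolding lin_cont_def by (intro continuous_map_from_subtopology) simp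
  interpret E: module R "amb S" by (rule tsetD(2)[OF S])
  have "has_slope S E T l (l \<circ> vpt)"
    unfolding has_slope_def
  proof (intro conjI allI impI cv)
    fix x v t assume m: "Mor (x, v, t) \<in> pts (mor_top R TK S)"
    show "l (x \<oplus>\<^bsub>amb S\<^esub> (t \<odot>\<^bsub>amb S\<^esub> v)) = l x \<oplus>\<^bsub>E\<^esub> (t \<odot>\<^bsub>E\<^esub> (l \<circ> vpt) (Mor (x, v, t)))"
      using Mor_ptsD[OF m] tsetD(5)[OF S] by (simp add: lin_mapD[OF ll])
  qed
  then show ?case
    using Suc.IH[OF tset_mor[OF S] lv] continuous_map_from_subtopology[OF cl, of "pts S"]
    unfolding smooth.simps by blast
qed

lemma smooth_add:
  assumes "tset S" and E: "tmod E T" and "smooth n S E T f" and "smooth n S E T g"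
  shows "smooth n S E T (\<lambda>x. f x \<oplus>\<^bsub>E\<^esub> g x)"
  using assms(1,3,4)
proof (induction n arbitrary: S f g)
  case 0
  then show ?case using continuous_add[OF E] by simp
next
  case (Suc n)
  note S = Suc.prems(1)
  obtain F where f: "continuous_map (subspace S) T f" and F: "has_slope S E T f F"
    and sF: "smooth n (mor_top R TK S) E T F"
    using Suc.prems(2) by auto
  obtain G where g: "continuous_map (subspace S) T g" and G: "has_slope S E T g G"
    and sG: "smooth n (mor_top R TK S) E T G"
    using Suc.prems(3) by auto
  interpret E: module R E by (rule tmodD(1)[OF E])
  have "has_slope S E T (\<lambda>x. f x \<oplus>\<^bsub>E\<^esub> g x) (\<lambda>m. F m \<oplus>\<^bsub>E\<^esub> G m)"
    unfolding has_slope_def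
  proof (intro conjI allI impI)
    show "continuous_map (subspace (mor_top R TK S)) T (\<lambda>m. F m \<oplus>\<^bsub>E\<^esub> G m)"
      by (rule continuous_add[OF E has_slope_continuous[OF F] has_slope_continuous[OF G]])
    fix x v t assume m: "Mor (x, v, t) \<in> pts (mor_top R TK S)"
    then have "x \<in> pts S" "t \<in> carrier R" by (auto simp: dom1_def)
    then show "f (x \<oplus>\<^bsub>amb S\<^esub> (t \<odot>\<^bsub>amb S\<^esub> v)) \<oplus>\<^bsub>E\<^esub> g (x \<oplus>\<^bsub>amb S\<^esub> (t \<odot>\<^bsub>amb S\<^esub> v))
        = f x \<oplus>\<^bsub>E\<^esub> g x \<oplus>\<^bsub>E\<^esub> (t \<odot>\<^bsub>E\<^esub> (F (Mor (x, v, t)) \<oplus>\<^bsub>E\<^esub> G (Mor (x, v, t))))"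
      unfolding has_slopeD[OF F m] has_slopeD[OF G m]
      using has_slope_carrier[OF S E F m] has_slope_carrier[OF S E G m]
        continuous_on_pts_carrier[OF S E f] continuous_on_pts_carrier[OF S E g]
      by (simp add: E.smult_r_distr E.M.a_ac)
  qed
  then show ?case
    using Suc.IH[OF tset_mor[OF S] sF sG] continuous_add[OF E f g] by auto
qed

lemma smooth_smult:
  assumes "tset S" and E: "tmod E T" and "smooth n S (reg_mod R) TK f" and "smooth n S E T g"
  shows "smooth n S E T (\<lambda>x. f x \<odot>\<^bsub>E\<^esub> g x)"
  using assms(1,3,4)
proof (induction n arbitrary: S f g)
  case 0
  then show ?case using continuous_smult[OF E] by simp
next
  case (Suc n)
  note S = Suc.prems(1)
  obtain F where f: "continuous_map (subspace S) TK f" and F: "has_slope S (reg_mod R) TK f F"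
    and sF: "smooth n (mor_top R TK S) (reg_mod R) TK F"
    using Suc.prems(2) by auto
  obtain G where g: "continuous_map (subspace S) T g" and G: "has_slope S E T g G"
    and sG: "smooth n (mor_top R TK S) E T G"
    using Suc.prems(3) by auto
  interpret E: module R E by (rule tmodD(1)[OF E])
  note mS = tset_mor[OF S]
  have sf: "smooth n (mor_top R TK S) (reg_mod R) TK (f \<circ> bpt)"
    and sg: "smooth n (mor_top R TK S) E T (g \<circ> bpt)"
    using smooth_SucD[OF Suc.prems(2)] smooth_SucD[OF Suc.prems(3)]
    by (auto intro: smooth_comp_lin_on[OF mS lin_on_mor_bpt])
  have st: "smooth n (mor_top R TK S) (reg_mod R) TK tpt"
    by (rule smooth_lin_cont[OF mS lin_cont_mor_tpt])
  \<comment> \<open>The product rule for a finite increment: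
    \<open>(f + tF)(g + tG) = fg + t(Fg + fG + tFG)\<close>. The last term is the reason why the
    parameter itself has to be smooth.\<close>
  let ?G = "\<lambda>m. ((F m \<odot>\<^bsub>E\<^esub> (g \<circ> bpt) m) \<oplus>\<^bsub>E\<^esub> ((f \<circ> bpt) m \<odot>\<^bsub>E\<^esub> G m))
    \<oplus>\<^bsub>E\<^esub> (tpt m \<odot>\<^bsub>E\<^esub> (F m \<odot>\<^bsub>E\<^esub> G m))"
  have sG': "smooth n (mor_top R TK S) E T ?G"
    using sF sG sf sg st by (intro smooth_add[OF mS E] Suc.IH[OF mS])
  have "has_slope S E T (\<lambda>x. f x \<odot>\<^bsub>E\<^esub> g x) ?G"
    unfolding has_slope_def
  proof (intro conjI allI impI)
    show "continuous_map (subspace (mor_top R TK S)) T ?G"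
      by (rule smooth_continuous[OF sG'])
    fix x v t assume m: "Mor (x, v, t) \<in> pts (mor_top R TK S)"
    then have x: "x \<in> pts S" and t: "t \<in> carrier R" by (auto simp: dom1_def)
    have c: "f x \<in> carrier R" "g x \<in> carrier E" "F (Mor (x, v, t)) \<in> carrier R" "G (Mor (x, v, t)) \<in> carrier E"
      using has_slope_carrier[OF S tmod_reg F m] has_slope_carrier[OF S E G m]
        continuous_on_pts_carrier[OF S tmod_reg f x] continuous_on_pts_carrier[OF S E g x] by auto
    show "f (x \<oplus>\<^bsub>amb S\<^esub> (t \<odot>\<^bsub>amb S\<^esub> v)) \<odot>\<^bsub>E\<^esub> g (x \<oplus>\<^bsub>amb S\<^esub> (t \<odot>\<^bsub>amb S\<^esub> v))
        = (f x \<odot>\<^bsub>E\<^esub> g x) \<oplus>\<^bsub>E\<^esub> (t \<odot>\<^bsub>E\<^esub> ?G (Mor (x, v, t)))"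
      unfolding has_slopeD[OF F m] has_slopeD[OF G m]
      using c t
      by (simp add: E.smult_r_distr E.smult_l_distr E.M.a_ac R.m_ac R.r_distr flip: E.smult_assoc1)
  qed
  then show ?case
    using sG' continuous_smult[OF E f g] by auto
qed

lemma smooth_Mor:
  assumes "tset S" and E: "tmod E T" and "smooth n S E T a" and "smooth n S E T b"
    and "smooth n S (reg_mod R) TK c"
  shows "smooth n S (mor_mod R E) (wrap_top Mor (prod_topology T (prod_topology T TK)))
    (\<lambda>x. Mor (a x, b x, c x))"
  using assms(1,3-5)
proof (induction n arbitrary: S a b c)
  case 0
  then show ?case using continuous_map_Mor by simp
next
  case (Suc n)
  note S = Suc.prems(1)
  obtain A where a: "continuous_map (subspace S) T a" and A: "has_slope S E T a A"
    and sA: "smooth n (mor_top R TK S) E T A"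
    using Suc.prems(2) by auto
  obtain B where b: "continuous_map (subspace S) T b" and B: "has_slope S E T b B"
    and sB: "smooth n (mor_top R TK S) E T B"
    using Suc.prems(3) by auto
  obtain C where c: "continuous_map (subspace S) TK c" and C: "has_slope S (reg_mod R) TK c C"
    and sC: "smooth n (mor_top R TK S) (reg_mod R) TK C"
    using Suc.prems(4) by auto
  have "has_slope S (mor_mod R E) (wrap_top Mor (prod_topology T (prod_topology T TK)))
      (\<lambda>x. Mor (a x, b x, c x)) (\<lambda>x. Mor (A x, B x, C x))"
    unfolding has_slope_def
    by (intro conjI allI impI continuous_map_Mor has_slope_continuous[OF A] has_slope_continuous[OF B]
        has_slope_continuous[OF C])
      (simp add: has_slopeD[OF A] has_slopeD[OF B] has_slopeD[OF C] Mor_mem_iff del: mor_top_sel)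
  then show ?case
    using Suc.IH[OF tset_mor[OF S] sA sB sC] continuous_map_Mor[OF a b c] by auto
qed

lemma smooth_Obj:
  assumes "tset S" and E: "tmod E T" and "smooth n S E T a" and "smooth n S (reg_mod R) TK c"
  shows "smooth n S (obj_mod R E) (wrap_top Obj (prod_topology T TK)) (\<lambda>x. Obj (a x, c x))"
  using assms(1,3-4)
proof (induction n arbitrary: S a c)
  case 0
  then show ?case using continuous_map_Obj by simp
next
  case (Suc n)
  note S = Suc.prems(1)
  obtain A where a: "continuous_map (subspace S) T a" and A: "has_slope S E T a A"
    and sA: "smooth n (mor_top R TK S) E T A"
    using Suc.prems(2) by auto
  obtain C where c: "continuous_map (subspace S) TK c" and C: "has_slope S (reg_mod R) TK c C"
    and sC: "smooth n (mor_top R TK S) (reg_mod R) TK C"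
    using Suc.prems(3) by auto
  have "has_slope S (obj_mod R E) (wrap_top Obj (prod_topology T TK))
      (\<lambda>x. Obj (a x, c x)) (\<lambda>x. Obj (A x, C x))"
    unfolding has_slope_def
    by (intro conjI allI impI continuous_map_Obj has_slope_continuous[OF A] has_slope_continuous[OF C])
      (simp add: has_slopeD[OF A] has_slopeD[OF C] Mor_mem_iff del: mor_top_sel)
  then show ?case
    using Suc.IH[OF tset_mor[OF S] sA sC] continuous_map_Obj[OF a c] by auto
qed

end


section \<open>Functoriality of the extended tangent map\<close>

context tdc
begin

definition smooth_map ::
    "nat \<Rightarrow> ('k, ('v, 'k) pt) tlinset \<Rightarrow> ('k, 'b) tlinset \<Rightarrow> (('v, 'k) pt \<Rightarrow> 'b) \<Rightarrow> bool" where
  "smooth_map n S S' f \<longleftrightarrow> smooth n S (amb S') (tau S') f \<and> f \<in> pts S \<rightarrow> pts S'"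

lemma smooth_mapD:
  assumes "smooth_map n S S' f"
  shows "smooth n S (amb S') (tau S') f" and "x \<in> pts S \<Longrightarrow> f x \<in> pts S'"
    and "continuous_map (subspace S) (tau S') f"
  using assms smooth_continuous by (auto simp: smooth_map_def)

lemma smooth_map_continuous:
  assumes "tset S" and "smooth_map n S S' f"
  shows "continuous_map (subspace S) (subspace S') f"
  using smooth_mapD[OF assms(2)] topspace_subspace[OF assms(1)]
  by (auto intro!: continuous_map_into_subtopology)

lemma smooth_map_mono: "smooth_map n S S' f \<Longrightarrow> m \<le> n \<Longrightarrow> smooth_map m S S' f"
  by (auto simp: smooth_map_def intro: smooth_mono)

lemma smooth_map_cong:
  assumes "tset S" and "\<And>x. x \<in> pts S \<Longrightarrow> f x = g x" and "smooth_map n S S' f"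
  shows "smooth_map n S S' g"
  unfolding smooth_map_def
proof
  show "smooth n S (amb S') (tau S') g"
    by (rule smooth_cong[OF assms(1,2) smooth_mapD(1)[OF assms(3)]])
  show "g \<in> pts S \<rightarrow> pts S'"
    using smooth_mapD(2)[OF assms(3)] assms(2) by (simp add: Pi_iff)
qed

lemma smooth_map_lin_on: "tset S \<Longrightarrow> lin_on S S' l \<Longrightarrow> smooth_map n S S' l"
  using smooth_lin_cont[OF _ lin_on_imp_lin_cont] by (auto simp: smooth_map_def lin_on_def)

lemma smooth_map_slope:
  assumes "smooth_map (Suc n) S S' f"
  obtains G where "has_slope S (amb S') (tau S') f G" and "smooth n (mor_top R TK S) (amb S') (tau S') G"
  using assms by (auto simp: smooth_map_def)

lemma mor_map_eq:
  assumes "tset S" and "tset S'" and "smooth_map n S S' f" and "has_slope S (amb S') (tau S') f G"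
    and "m \<in> pts (mor_top R TK S)"
  shows "mor_map R TK S S' f m = Mor (f (bpt m), G m, tpt m)"
  using slope_map_eq[OF assms(1,2) smooth_mapD(3)[OF assms(3)] assms(4,5)] by (simp add: mor_map_def)

text \<open>The target of the new triple is \<open>f x + t G\<close>, which by the slope equation is
  \<open>f (x + t v)\<close>, a point of \<open>S'\<close>.\<close>

lemma Mor_slope_pts:
  assumes S: "tset S" and S': "tset S'" and f: "smooth_map n S S' f"
    and G: "has_slope S (amb S') (tau S') f G" and m: "m \<in> pts (mor_top R TK S)"
  shows "Mor (f (bpt m), G m, tpt m) \<in> pts (mor_top R TK S')"
proof -
  obtain x v t where mm: "m = Mor (x, v, t)" using m by auto
  note mD = Mor_ptsD[OF m[unfolded mm]]
  show ?thesis
    using mD smooth_mapD(2)[OF f] has_slope_carrier[OF S tsetD(1)[OF S'] G m] has_slopeD[OF G m[unfolded mm]]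
    unfolding mm by (intro mor_ptsI) force+
qed

text \<open>Of the three components, the slope is the one that costs an order;
  \<open>f \<circ> bpt\<close> inherits the order of \<open>f\<close>, and the parameter is
  linear.\<close>

lemma smooth_map_mor:
  assumes S: "tset S" and S': "tset S'" and f: "smooth_map (Suc n) S S' f"
  shows "smooth_map n (mor_top R TK S) (mor_top R TK S') (mor_map R TK S S' f)"
proof -
  obtain G where G: "has_slope S (amb S') (tau S') f G" "smooth n (mor_top R TK S) (amb S') (tau S') G"
    by (rule smooth_map_slope[OF f])
  let ?M = "\<lambda>m. Mor ((f \<circ> bpt) m, G m, tpt m)"
  have "smooth n (mor_top R TK S) (amb (mor_top R TK S')) (tau (mor_top R TK S')) ?M"
    unfolding mor_top_sel(2,3)
    using smooth_comp_lin_on[OF tset_mor[OF S] lin_on_mor_bpt smooth_SucD[OF smooth_mapD(1)[OF f]]]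
    by (intro smooth_Mor tset_mor S tsetD(1)[OF S'] G(2) smooth_lin_cont[OF tset_mor[OF S] lin_cont_mor_tpt])
  then have "smooth_map n (mor_top R TK S) (mor_top R TK S') ?M"
    unfolding smooth_map_def using Mor_slope_pts[OF S S' f G(1)] by auto
  then show ?thesis
    by (rule smooth_map_cong[OF tset_mor[OF S], rotated]) (simp add: mor_map_eq[OF S S' f G(1)] del: mor_top_sel)
qed

lemma smooth_map_obj:
  assumes S: "tset S" and S': "tset S'" and f: "smooth_map n S S' f"
  shows "smooth_map n (obj_top R TK S) (obj_top R TK S') (obj_map f)"
proof -
  have "smooth n (obj_top R TK S) (obj_mod R (amb S')) (wrap_top Obj (prod_topology (tau S') TK))
      (\<lambda>p. Obj ((f \<circ> bpt) p, tpt p))"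
    by (intro smooth_Obj tset_obj S tsetD(1)[OF S'] smooth_comp_lin_on[OF tset_obj[OF S] lin_on_obj_bpt]
        smooth_mapD(1)[OF f] smooth_lin_cont[OF tset_obj[OF S] lin_cont_obj_tpt])
  then show ?thesis
    using smooth_mapD(2)[OF f] by (auto simp: smooth_map_def obj_map_def[abs_def])
qed

text \<open>Agreement with \<open>l\<close> is asked for on the points only, because the source and
  unit maps of iterated edges involve definite descriptions and are controlled only there.\<close>

lemma mor_map_lin_on:
  assumes S: "tset S" and S': "tset S'" and l: "lin_on S S' l" and f: "\<And>x. x \<in> pts S \<Longrightarrow> f x = l x"
    and m: "m \<in> pts (mor_top R TK S)"
  shows "mor_map R TK S S' f m = lin_mor l m"
proof -
  have sf: "smooth_map 0 S S' f"
    by (rule smooth_map_cong[OF S _ smooth_map_lin_on[OF S l]]) (simp add: f)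
  have "has_slope S (amb S') (tau S') l (l \<circ> vpt)"
    unfolding has_slope_def
  proof (intro conjI allI impI)
    show "continuous_map (subspace (mor_top R TK S)) (tau S') (l \<circ> vpt)"
      by (rule continuous_map_compose[OF continuous_mor_sel(3) lin_onD(2)[OF l]])
    fix x v t assume m: "Mor (x, v, t) \<in> pts (mor_top R TK S)"
    interpret E: module R "amb S" by (rule tsetD(2)[OF S])
    show "l (x \<oplus>\<^bsub>amb S\<^esub> (t \<odot>\<^bsub>amb S\<^esub> v)) = l x \<oplus>\<^bsub>amb S'\<^esub> (t \<odot>\<^bsub>amb S'\<^esub> (l \<circ> vpt) (Mor (x, v, t)))"
      using Mor_ptsD[OF m] tsetD(5)[OF S] by (simp add: lin_mapD[OF lin_onD(1)[OF l]])
  qed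
  then have "has_slope S (amb S') (tau S') f (l \<circ> vpt)"
    by (rule has_slope_cong[rotated]) (simp add: f)
  moreover have "bpt m \<in> pts S"
    using m by (auto simp: dom1_def)
  ultimately show ?thesis
    using mor_map_eq[OF S S' sf _ m] by (simp add: lin_mor_def f)
qed

text \<open>Chain rule: the slope equation of \<open>f\<close> turns the increment
  \<open>t v\<close> of \<open>x\<close> into the increment \<open>t F\<close> of
  \<open>f x\<close>, with the same parameter, and the slope equation of \<open>g\<close> takes over
  from there.\<close>

lemma has_slope_comp:
  assumes S: "tset S" and S\<^sub>1: "tset S\<^sub>1" and f: "smooth_map n S S\<^sub>1 f"
    and F: "has_slope S (amb S\<^sub>1) (tau S\<^sub>1) f F" and G: "has_slope S\<^sub>1 E T g G"
  shows "has_slope S E T (g \<circ> f) (\<lambda>m. G (Mor (f (bpt m), F m, tpt m)))"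
  unfolding has_slope_def
proof (intro conjI allI impI)
  have "continuous_map (subspace (mor_top R TK S)) (tau S\<^sub>1) (\<lambda>m. f (bpt m))"
    using continuous_map_compose[OF continuous_mor_sel(1) smooth_mapD(3)[OF f]] by (simp add: o_def)
  from continuous_map_Mor[OF this has_slope_continuous[OF F] continuous_mor_sel(4)]
  have "continuous_map (subspace (mor_top R TK S)) (tau (mor_top R TK S\<^sub>1)) (\<lambda>m. Mor (f (bpt m), F m, tpt m))"
    by simp
  moreover have "(\<lambda>m. Mor (f (bpt m), F m, tpt m)) \<in> topspace (subspace (mor_top R TK S)) \<rightarrow> pts (mor_top R TK S\<^sub>1)"
    unfolding topspace_subspace[OF tset_mor[OF S]] using Mor_slope_pts[OF S S\<^sub>1 f F] by blast
  ultimately have "continuous_map (subspace (mor_top R TK S)) (subspace (mor_top R TK S\<^sub>1))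
      (\<lambda>m. Mor (f (bpt m), F m, tpt m))"
    by (rule continuous_map_into_subtopology)
  from continuous_map_compose[OF this has_slope_continuous[OF G]]
  show "continuous_map (subspace (mor_top R TK S)) T (\<lambda>m. G (Mor (f (bpt m), F m, tpt m)))"
    by (simp add: o_def)
  fix x v t assume m: "Mor (x, v, t) \<in> pts (mor_top R TK S)"
  have "Mor (f x, F (Mor (x, v, t)), t) \<in> pts (mor_top R TK S\<^sub>1)"
    using Mor_slope_pts[OF S S\<^sub>1 f F m] by simp
  then show "(g \<circ> f) (x \<oplus>\<^bsub>amb S\<^esub> (t \<odot>\<^bsub>amb S\<^esub> v))
      = (g \<circ> f) x \<oplus>\<^bsub>E\<^esub> (t \<odot>\<^bsub>E\<^esub> G (Mor (f (bpt (Mor (x, v, t))), F (Mor (x, v, t)), tpt (Mor (x, v, t)))))"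
    using has_slopeD[OF F m] has_slopeD[OF G, of "f x" "F (Mor (x, v, t))" t] by simp
qed

text \<open>Functoriality in the form in which it is applied to sources, targets and units. The
  chain rule gives a slope for either way around the square; the two composites agree on the points,
  so uniqueness of slopes identifies the results.\<close>

lemma mor_map_square:
  assumes S: "tset S" and A: "tset A" and A': "tset A'" and B: "tset B"
    and f: "smooth_map 1 S A f" and g: "smooth_map 1 A B g"
    and f': "smooth_map 1 S A' f'" and g': "smooth_map 1 A' B g'"
    and eq: "\<And>x. x \<in> pts S \<Longrightarrow> g (f x) = g' (f' x)"
    and m: "m \<in> pts (mor_top R TK S)"
  shows "mor_map R TK A B g (mor_map R TK S A f m) = mor_map R TK A' B g' (mor_map R TK S A' f' m)"
proof -
  obtain F where F: "has_slope S (amb A) (tau A) f F"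
    by (rule smooth_map_slope[OF f[unfolded One_nat_def]])
  obtain G where G: "has_slope A (amb B) (tau B) g G"
    by (rule smooth_map_slope[OF g[unfolded One_nat_def]])
  obtain F' where F': "has_slope S (amb A') (tau A') f' F'"
    by (rule smooth_map_slope[OF f'[unfolded One_nat_def]])
  obtain G' where G': "has_slope A' (amb B) (tau B) g' G'"
    by (rule smooth_map_slope[OF g'[unfolded One_nat_def]])
  have c: "continuous_map (subspace S) (tau B) (g \<circ> f)"
    by (rule continuous_map_compose[OF smooth_map_continuous[OF S f] smooth_mapD(3)[OF g]])
  have "has_slope S (amb B) (tau B) (g \<circ> f) (\<lambda>m. G' (Mor (f' (bpt m), F' m, tpt m)))"
    by (rule has_slope_cong[OF _ has_slope_comp[OF S A' f' F' G']]) (simp add: eq)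
  then have "G (Mor (f (bpt m), F m, tpt m)) = G' (Mor (f' (bpt m), F' m, tpt m))"
    by (rule has_slope_unique[OF S tsetD(1)[OF B] c has_slope_comp[OF S A f F G] _ m])
  moreover have "bpt m \<in> pts S"
    using m by (auto simp: dom1_def)
  ultimately show ?thesis
    using mor_map_eq[OF A B g G Mor_slope_pts[OF S A f F m]] mor_map_eq[OF A' B g' G' Mor_slope_pts[OF S A' f' F' m]]
    by (simp add: mor_map_eq[OF S A f F m] mor_map_eq[OF S A' f' F' m] eq)
qed

section \<open>From the conditions on iterated slopes to recursive smoothness\<close>

lemma slope_iter_shift:
  "slope_iter R TK (Suc n) S S' f = slope_iter R TK n (mor_top R TK S) S' (slope_map R TK S S' f)"
  by (induction n) (simp_all add: funpow_swap1)

lemma Cn_imp_C1: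
  "Cn R TK n S S' f \<Longrightarrow> k < n \<Longrightarrow> C1 R TK ((mor_top R TK ^^ k) S) (whole S') (slope_iter R TK k S S' f)"
  by (induction n) (auto simp: less_Suc_eq)

text \<open>The condition at stage \<open>k + 1\<close> for \<open>f\<close> is the condition at
  stage \<open>k\<close> for its first slope, by \<open>slope_iter_shift\<close>. The slope obtained
  from the definite description agrees with the given one on the points, which lets smoothness pass
  between them.\<close>

lemma C1_iterates_imp_smooth:
  assumes "tset S" and S': "tset S'" and "continuous_map (subspace S) (tau S') f"
    and "\<And>k. k < n \<Longrightarrow> C1 R TK ((mor_top R TK ^^ k) S) (whole S') (slope_iter R TK k S S' f)"
  shows "smooth n S (amb S') (tau S') f"
  using assms(1,3,4)
proof (induction n arbitrary: S f)
  case (Suc n)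
  note S = Suc.prems(1) and f = Suc.prems(2)
  obtain g where "is_slope R TK (amb S) (tau S) (amb S') (tau S') (dom1 R S) f g"
    using Suc.prems(3)[of 0] by (auto simp: C1_def)
  then have G: "has_slope S (amb S') (tau S') f (\<lambda>m. g (bpt m, vpt m, tpt m))" (is "has_slope _ _ _ _ ?G")
    by (rule is_slope_imp_has_slope[OF S tsetD(1)[OF S'] f])
  have eq: "slope_map R TK S S' f m = ?G m" if "m \<in> pts (mor_top R TK S)" for m
    by (rule slope_map_eq[OF S S' f G that])
  have "smooth n (mor_top R TK S) (amb S') (tau S') (slope_map R TK S S' f)"
  proof (rule Suc.IH[OF tset_mor[OF S]])
    show "continuous_map (subspace (mor_top R TK S)) (tau S') (slope_map R TK S S' f)"
      by (rule continuous_cong_pts[OF tset_mor[OF S] _ has_slope_continuous[OF G]]) (simp add: eq del: mor_top_sel)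
    fix k assume "k < n"
    then show "C1 R TK ((mor_top R TK ^^ k) (mor_top R TK S)) (whole S')
        (slope_iter R TK k (mor_top R TK S) S' (slope_map R TK S S' f))"
      using Suc.prems(3)[of "Suc k"] by (simp add: slope_iter_shift funpow_swap1 del: slope_iter.simps)
  qed
  then have "smooth n (mor_top R TK S) (amb S') (tau S') ?G"
    by (rule smooth_cong[OF tset_mor[OF S], rotated]) (simp add: eq del: mor_top_sel)
  then show ?case using f G by auto
qed simp

lemma Cn_imp_smooth_map:
  assumes S: "tset S" and S': "tset S'" and "Cn R TK n S S' f"
  shows "smooth_map n S S' f"
proof -
  have "Cn R TK 0 S S' f"
    using assms(3) by (induction n) auto
  then have c: "continuous_map (subspace S) (subspace S') f" by simp
  then have "f \<in> pts S \<rightarrow> pts S'"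
    using topspace_subspace[OF S] topspace_subspace[OF S'] unfolding continuous_map_def by simp
  moreover have "smooth n S (amb S') (tau S') f"
    using c by (intro C1_iterates_imp_smooth[OF S S'] Cn_imp_C1[OF assms(3)])
      (auto simp: continuous_map_in_subtopology)
  ultimately show ?thesis by (simp add: smooth_map_def)
qed

end


section \<open>The edges of an n-fold groupoid\<close>

text \<open>Bundling the structure maps of an edge merges the recursions of \<open>nsrc\<close>,
  \<open>ntgt\<close>, \<open>nunit\<close> and \<open>nmul\<close> into a single one, which applies
  operations to whole edges. Properties of edges can then be proved by induction over the
  labels.\<close>

record ('v, 'k) edge =
  mors :: "('k, ('v, 'k) pt) tlinset"
  objs :: "('k, ('v, 'k) pt) tlinset"
  esrc :: "('v, 'k) pt \<Rightarrow> ('v, 'k) pt"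
  etgt :: "('v, 'k) pt \<Rightarrow> ('v, 'k) pt"
  eunit :: "('v, 'k) pt \<Rightarrow> ('v, 'k) pt"
  emul :: "('v, 'k) pt \<times> ('v, 'k) pt \<Rightarrow> ('v, 'k) pt"

definition ecomp :: "('v, 'k) edge \<Rightarrow> (('v, 'k) pt \<times> ('v, 'k) pt) set" where
  "ecomp e = {(m', m). m' \<in> pts (mors e) \<and> m \<in> pts (mors e) \<and> esrc e m' = etgt e m}"

lemma mem_ecomp: "(m', m) \<in> ecomp e \<longleftrightarrow> m' \<in> pts (mors e) \<and> m \<in> pts (mors e) \<and> esrc e m' = etgt e m"
  by (simp add: ecomp_def)

definition edge_morph ::
    "('v, 'k) edge \<Rightarrow> ('w, 'k) edge \<Rightarrow> (('v, 'k) pt \<Rightarrow> ('w, 'k) pt) \<Rightarrow> (('v, 'k) pt \<Rightarrow> ('w, 'k) pt) \<Rightarrow> bool" where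
  "edge_morph e e' F\<^sub>0 F\<^sub>1 \<longleftrightarrow>
    (\<forall>m \<in> pts (mors e). esrc e' (F\<^sub>1 m) = F\<^sub>0 (esrc e m) \<and> etgt e' (F\<^sub>1 m) = F\<^sub>0 (etgt e m))
    \<and> (\<forall>p \<in> pts (objs e). eunit e' (F\<^sub>0 p) = F\<^sub>1 (eunit e p))
    \<and> (\<forall>(m', m) \<in> ecomp e. emul e' (F\<^sub>1 m', F\<^sub>1 m) = F\<^sub>1 (emul e (m', m)))"

lemma edge_morphD:
  assumes "edge_morph e e' F\<^sub>0 F\<^sub>1"
  shows "m \<in> pts (mors e) \<Longrightarrow> esrc e' (F\<^sub>1 m) = F\<^sub>0 (esrc e m)"
    and "m \<in> pts (mors e) \<Longrightarrow> etgt e' (F\<^sub>1 m) = F\<^sub>0 (etgt e m)"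
    and "p \<in> pts (objs e) \<Longrightarrow> eunit e' (F\<^sub>0 p) = F\<^sub>1 (eunit e p)"
    and "(m', m) \<in> ecomp e \<Longrightarrow> emul e' (F\<^sub>1 m', F\<^sub>1 m) = F\<^sub>1 (emul e (m', m))"
  using assms by (auto simp: edge_morph_def)

text \<open>On composable pairs, the product of an n-fold groupoid is \<open>m + m' - u (l m')\<close> with linear
  \<open>l\<close> and \<open>u\<close>.\<close>

definition aff ::
    "('k, 'a) module \<Rightarrow> ('a \<Rightarrow> 'b) \<Rightarrow> ('b \<Rightarrow> 'a) \<Rightarrow> 'a \<Rightarrow> 'a \<Rightarrow> 'a" where
  "aff E l u m' m = (m \<oplus>\<^bsub>E\<^esub> m') \<ominus>\<^bsub>E\<^esub> u (l m')"

lemma aff_linear: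
  assumes E: "module R E" and F: "module R F" and l: "lin_map R E F l" and u: "lin_map R F E u"
    and x: "x \<in> carrier E" and x': "x' \<in> carrier E"
  shows "aff E l u x' x \<in> carrier E"
    and "\<lbrakk>y \<in> carrier E; y' \<in> carrier E\<rbrakk> \<Longrightarrow>
      aff E l u (x' \<oplus>\<^bsub>E\<^esub> y') (x \<oplus>\<^bsub>E\<^esub> y) = aff E l u x' x \<oplus>\<^bsub>E\<^esub> aff E l u y' y"
    and "k \<in> carrier R \<Longrightarrow> aff E l u (k \<odot>\<^bsub>E\<^esub> x') (k \<odot>\<^bsub>E\<^esub> x) = k \<odot>\<^bsub>E\<^esub> aff E l u x' x"
proof -
  interpret E: module R E by fact
  interpret F: module R F by fact
  note ll = lin_mapD[OF l] and uu = lin_mapD[OF u]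
  show "aff E l u x' x \<in> carrier E"
    using x x' by (simp add: aff_def ll uu)
  show "aff E l u (x' \<oplus>\<^bsub>E\<^esub> y') (x \<oplus>\<^bsub>E\<^esub> y) = aff E l u x' x \<oplus>\<^bsub>E\<^esub> aff E l u y' y"
    if "y \<in> carrier E" "y' \<in> carrier E"
    using that x x' by (simp add: aff_def a_minus_def ll uu E.M.minus_add E.M.a_ac)
  show "aff E l u (k \<odot>\<^bsub>E\<^esub> x') (k \<odot>\<^bsub>E\<^esub> x) = k \<odot>\<^bsub>E\<^esub> aff E l u x' x" if "k \<in> carrier R"
    using that x x' by (simp add: aff_def a_minus_def ll uu E.smult_r_distr E.smult_r_minus)
qed

context tdc
begin

section \<open>The edge of a single groupoid, and the effect of the functors on edges\<close>

definition base_edge :: "('k, ('v, 'k) pt) tlinset \<Rightarrow> ('v, 'k) edge" where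
  "base_edge S =
    \<lparr>mors = mor_top R TK S, objs = obj_top R TK S,
     esrc = (\<lambda>m. Obj (bpt m, tpt m)),
     etgt = (\<lambda>m. Obj (bpt m \<oplus>\<^bsub>amb S\<^esub> (tpt m \<odot>\<^bsub>amb S\<^esub> vpt m), tpt m)),
     eunit = (\<lambda>p. Mor (bpt p, \<zero>\<^bsub>amb S\<^esub>, tpt p)),
     emul = (\<lambda>(m', m). Mor (bpt m, vpt m \<oplus>\<^bsub>amb S\<^esub> vpt m', tpt m))\<rparr>"

definition obj_edge :: "('v, 'k) edge \<Rightarrow> ('v, 'k) edge" where
  "obj_edge e =
    \<lparr>mors = obj_top R TK (mors e), objs = obj_top R TK (objs e),
     esrc = obj_map (esrc e), etgt = obj_map (etgt e), eunit = obj_map (eunit e),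
     emul = (\<lambda>(m', m). Obj (emul e (bpt m', bpt m), tpt m))\<rparr>"

definition mor_comp :: "('v, 'k) edge \<Rightarrow> (('v, 'k) pt \<times> ('v, 'k) pt) set" where
  "mor_comp e = {(m', m). m' \<in> pts (mor_top R TK (mors e)) \<and> m \<in> pts (mor_top R TK (mors e))
    \<and> mor_map R TK (mors e) (objs e) (esrc e) m' = mor_map R TK (mors e) (objs e) (etgt e) m}"

text \<open>The composable pairs of the new edge, regrouped as point, direction and parameter in the
  product of the old morphism module with itself. This is the set \<open>Z\<close> of
  \<open>nmul\<close>.\<close>

definition mor_comp_triples ::
    "('v, 'k) edge \<Rightarrow> ((('v, 'k) pt \<times> ('v, 'k) pt) \<times> (('v, 'k) pt \<times> ('v, 'k) pt) \<times> 'k) set" where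
  "mor_comp_triples e = {((p', p), (w', w), t). (Mor (p', w', t), Mor (p, w, t)) \<in> mor_comp e}"

definition mor_edge :: "('v, 'k) edge \<Rightarrow> ('v, 'k) edge" where
  "mor_edge e =
    \<lparr>mors = mor_top R TK (mors e), objs = mor_top R TK (objs e),
     esrc = mor_map R TK (mors e) (objs e) (esrc e), etgt = mor_map R TK (mors e) (objs e) (etgt e),
     eunit = mor_map R TK (objs e) (mors e) (eunit e),
     emul = (\<lambda>(m', m). Mor (emul e (bpt m', bpt m),
       slope R TK (prod_mod (amb (mors e)) (amb (mors e))) (prod_topology (tau (mors e)) (tau (mors e)))
         (amb (mors e)) (tau (mors e)) (mor_comp_triples e) (emul e)
         ((bpt m', bpt m), (vpt m', vpt m), tpt m),
       tpt m))\<rparr>"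

lemma base_edge_sel [simp]:
  "mors (base_edge S) = mor_top R TK S" "objs (base_edge S) = obj_top R TK S"
  by (simp_all add: base_edge_def)

lemma obj_edge_sel [simp]:
  "mors (obj_edge e) = obj_top R TK (mors e)" "objs (obj_edge e) = obj_top R TK (objs e)"
  by (simp_all add: obj_edge_def)

lemma mor_edge_sel [simp]:
  "mors (mor_edge e) = mor_top R TK (mors e)" "objs (mor_edge e) = mor_top R TK (objs e)"
  by (simp_all add: mor_edge_def)

lemma ecomp_mor_edge: "ecomp (mor_edge e) = mor_comp e"
  by (simp add: ecomp_def mor_comp_def mor_edge_def)

text \<open>The invariant of the induction over the labels. The maps \<open>l\<close> and
  \<open>u\<close> live on the whole ambient modules, since they are also applied to directions,
  which need not be points; likewise \<open>l (u x) = x\<close> is asked for on the whole module.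
  The target is only smooth, but of every order, as every morphism step costs one.\<close>

definition affine_edge ::
    "('v, 'k) edge \<Rightarrow> (('v, 'k) pt \<Rightarrow> ('v, 'k) pt) \<Rightarrow> (('v, 'k) pt \<Rightarrow> ('v, 'k) pt) \<Rightarrow> bool" where
  "affine_edge e l u \<longleftrightarrow>
    tset (mors e) \<and> tset (objs e) \<and> lin_on (mors e) (objs e) l \<and> lin_on (objs e) (mors e) u
    \<and> (\<forall>x \<in> carrier (amb (objs e)). l (u x) = x)
    \<and> (\<forall>m \<in> pts (mors e). esrc e m = l m) \<and> (\<forall>p \<in> pts (objs e). eunit e p = u p)
    \<and> (\<forall>n. smooth_map n (mors e) (objs e) (etgt e))
    \<and> (\<forall>(m', m) \<in> ecomp e. emul e (m', m) = aff (amb (mors e)) l u m' m \<and> emul e (m', m) \<in> pts (mors e))"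

lemma affine_edgeD:
  assumes "affine_edge e l u"
  shows "tset (mors e)" and "tset (objs e)" and "lin_on (mors e) (objs e) l" and "lin_on (objs e) (mors e) u"
    and "x \<in> carrier (amb (objs e)) \<Longrightarrow> l (u x) = x"
    and "m \<in> pts (mors e) \<Longrightarrow> esrc e m = l m" and "p \<in> pts (objs e) \<Longrightarrow> eunit e p = u p"
    and "smooth_map n (mors e) (objs e) (etgt e)"
    and "(m', m) \<in> ecomp e \<Longrightarrow> emul e (m', m) = aff (amb (mors e)) l u m' m"
    and "(m', m) \<in> ecomp e \<Longrightarrow> emul e (m', m) \<in> pts (mors e)"
  using assms by (auto simp: affine_edge_def)

lemma affine_edge_aff:
  assumes e: "affine_edge e l u" and x: "x \<in> carrier (amb (mors e))" and x': "x' \<in> carrier (amb (mors e))"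
  shows "aff (amb (mors e)) l u x' x \<in> carrier (amb (mors e))"
    and "\<lbrakk>y \<in> carrier (amb (mors e)); y' \<in> carrier (amb (mors e)); k \<in> carrier R\<rbrakk> \<Longrightarrow>
      aff (amb (mors e)) l u (x' \<oplus>\<^bsub>amb (mors e)\<^esub> (k \<odot>\<^bsub>amb (mors e)\<^esub> y')) (x \<oplus>\<^bsub>amb (mors e)\<^esub> (k \<odot>\<^bsub>amb (mors e)\<^esub> y))
      = aff (amb (mors e)) l u x' x \<oplus>\<^bsub>amb (mors e)\<^esub> (k \<odot>\<^bsub>amb (mors e)\<^esub> aff (amb (mors e)) l u y' y)"
proof -
  note eD = affine_edgeD[OF e]
  interpret E: module R "amb (mors e)" by (rule tsetD(2)[OF eD(1)])
  note a = aff_linear[OF tsetD(2)[OF eD(1)] tsetD(2)[OF eD(2)] lin_onD(1)[OF eD(3)] lin_onD(1)[OF eD(4)]]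
  show "aff (amb (mors e)) l u x' x \<in> carrier (amb (mors e))"
    by (rule a(1)[OF x x'])
  show "aff (amb (mors e)) l u (x' \<oplus>\<^bsub>amb (mors e)\<^esub> (k \<odot>\<^bsub>amb (mors e)\<^esub> y')) (x \<oplus>\<^bsub>amb (mors e)\<^esub> (k \<odot>\<^bsub>amb (mors e)\<^esub> y))
      = aff (amb (mors e)) l u x' x \<oplus>\<^bsub>amb (mors e)\<^esub> (k \<odot>\<^bsub>amb (mors e)\<^esub> aff (amb (mors e)) l u y' y)"
    if "y \<in> carrier (amb (mors e))" "y' \<in> carrier (amb (mors e))" "k \<in> carrier R"
    using that x x' by (simp add: a(2,3))
qed

lemma continuous_aff:
  assumes e: "affine_edge e l u" and f: "continuous_map X (tau (mors e)) f" and g: "continuous_map X (tau (mors e)) g"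
  shows "continuous_map X (tau (mors e)) (\<lambda>x. aff (amb (mors e)) l u (f x) (g x))"
proof -
  note eD = affine_edgeD[OF e]
  have "continuous_map X (tau (mors e)) (\<lambda>x. u (l (f x)))"
    using continuous_map_compose[OF continuous_map_compose[OF f lin_onD(2)[OF eD(3)]] lin_onD(2)[OF eD(4)]]
    by (simp add: o_def)
  then show ?thesis
    unfolding aff_def by (intro continuous_minus continuous_add tsetD(1)[OF eD(1)] f g)
qed

lemma affine_edge_base:
  assumes S: "tset S"
  shows "affine_edge (base_edge S) (\<lambda>m. Obj (bpt m, tpt m)) (\<lambda>p. Mor (bpt p, \<zero>\<^bsub>amb S\<^esub>, tpt p))"
proof -
  interpret E: module R "amb S" by (rule tsetD(2)[OF S])
  note mS = tset_mor[OF S]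
  have l: "lin_on (mor_top R TK S) (obj_top R TK S) (\<lambda>m. Obj (bpt m, tpt m))"
    unfolding lin_on_def
    by (auto simp: lin_map_def dom1_def intro: continuous_map_Obj continuous_map_Mor_sel)
  have u: "lin_on (obj_top R TK S) (mor_top R TK S) (\<lambda>p. Mor (bpt p, \<zero>\<^bsub>amb S\<^esub>, tpt p))"
    unfolding lin_on_def
    using tsetD(3,5)[OF S]
    by (auto simp: lin_map_def dom1_def intro!: continuous_map_Mor continuous_map_Obj_sel)
  have tgt: "smooth_map n (mor_top R TK S) (obj_top R TK S) (etgt (base_edge S))" for n
  proof -
    have "smooth n (mor_top R TK S) (amb S) (tau S) bpt" "smooth n (mor_top R TK S) (amb S) (tau S) vpt"
      using smooth_lin_cont[OF mS lin_on_imp_lin_cont[OF lin_on_mor_bpt]]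
        smooth_lin_cont[OF mS lin_on_imp_lin_cont[OF lin_on_mor_vpt]] by auto
    then have "smooth n (mor_top R TK S) (obj_mod R (amb S)) (wrap_top Obj (prod_topology (tau S) TK)) (etgt (base_edge S))"
      unfolding base_edge_def edge.simps
      by (intro smooth_Obj[OF mS tsetD(1)[OF S]] smooth_add[OF mS tsetD(1)[OF S]]
          smooth_smult[OF mS tsetD(1)[OF S]] smooth_lin_cont[OF mS lin_cont_mor_tpt])
    then show ?thesis
      by (auto simp: smooth_map_def base_edge_def dom1_def)
  qed
  have mul: "emul (base_edge S) (m', m)
      = aff (amb (mor_top R TK S)) (\<lambda>m. Obj (bpt m, tpt m)) (\<lambda>p. Mor (bpt p, \<zero>\<^bsub>amb S\<^esub>, tpt p)) m' m
    \<and> emul (base_edge S) (m', m) \<in> pts (mor_top R TK S)"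
    if c: "(m', m) \<in> ecomp (base_edge S)" for m' m
  proof -
    obtain x v t x' v' t' where m: "m = Mor (x, v, t)" and m': "m' = Mor (x', v', t')"
      and x: "x \<in> pts S" "v \<in> carrier (amb S)" "t \<in> carrier R" "x \<oplus>\<^bsub>amb S\<^esub> (t \<odot>\<^bsub>amb S\<^esub> v) \<in> pts S"
      and x': "x' \<in> pts S" "v' \<in> carrier (amb S)" "t' \<in> carrier R" "x' \<oplus>\<^bsub>amb S\<^esub> (t' \<odot>\<^bsub>amb S\<^esub> v') \<in> pts S"
      and eq: "x' = x \<oplus>\<^bsub>amb S\<^esub> (t \<odot>\<^bsub>amb S\<^esub> v)" "t' = t"
      using c by (auto simp: mem_ecomp base_edge_def dom1_def)
    have pos: "Mor (x, v \<oplus>\<^bsub>amb S\<^esub> v', t) \<in> pts (mor_top R TK S)"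
      using x x' tsetD(5)[OF S] unfolding eq by (intro mor_ptsI) (auto simp: E.smult_r_distr E.M.a_assoc)
    interpret M: module R "mor_mod R (amb S)" by (rule module_mor_mod[OF E.module_axioms])
    have c: "Mor (x, v \<oplus>\<^bsub>amb S\<^esub> v', t) \<in> carrier (mor_mod R (amb S))"
      "Mor (x', \<zero>\<^bsub>amb S\<^esub>, t) \<in> carrier (mor_mod R (amb S))"
      using x x' tsetD(5)[OF S] by auto
    \<comment> \<open>In the sum of the two factors the middle object \<open>(x', t)\<close> is
      counted once too often. It is removed by subtracting the unit at it, which is
      \<open>u (l m')\<close>.\<close>
    have "m \<oplus>\<^bsub>mor_mod R (amb S)\<^esub> m' = Mor (x', \<zero>\<^bsub>amb S\<^esub>, t) \<oplus>\<^bsub>mor_mod R (amb S)\<^esub> Mor (x, v \<oplus>\<^bsub>amb S\<^esub> v', t)"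
      using x x' tsetD(5)[OF S] by (simp add: m m' \<open>t' = t\<close> E.M.a_ac)
    then show ?thesis
      using pos M.add_minus_cancel(2)[OF c(2,1)] by (simp add: aff_def base_edge_def m m' \<open>t' = t\<close>)
  qed
  show ?thesis
    unfolding affine_edge_def base_edge_sel
    using mS tset_obj[OF S] l u tgt mul by (auto simp: base_edge_def simp del: mor_top_sel)
qed

lemma affine_edge_obj:
  assumes e: "affine_edge e l u"
  shows "affine_edge (obj_edge e) (obj_map l) (obj_map u)"
proof -
  note eD = affine_edgeD[OF e]
  interpret E: module R "amb (mors e)" by (rule tsetD(2)[OF eD(1)])
  have mul: "emul (obj_edge e) (m', m) = aff (amb (obj_top R TK (mors e))) (obj_map l) (obj_map u) m' m
      \<and> emul (obj_edge e) (m', m) \<in> pts (obj_top R TK (mors e))"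
    if c: "(m', m) \<in> ecomp (obj_edge e)" for m' m
  proof -
    obtain x t x' where m: "m = Obj (x, t)" and m': "m' = Obj (x', t)"
      and x: "(x', x) \<in> ecomp e" and t: "t \<in> carrier R"
      using c by (auto simp: mem_ecomp obj_edge_def)
    have xc: "x \<in> carrier (amb (mors e))" "x' \<in> carrier (amb (mors e))"
      using x tsetD(5)[OF eD(1)] by (auto simp: mem_ecomp)
    note ul = lin_mapD(1)[OF lin_onD(1)[OF eD(4)] lin_mapD(1)[OF lin_onD(1)[OF eD(3)] xc(2)]]
    interpret O: module R "obj_mod R (amb (mors e))" by (rule module_obj_mod[OF E.module_axioms])
    have mul: "emul e (x', x) = aff (amb (mors e)) l u x' x" by (rule eD(9)[OF x])
    have c: "Obj (emul e (x', x), t) \<in> carrier (obj_mod R (amb (mors e)))"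
      "Obj (u (l x'), t) \<in> carrier (obj_mod R (amb (mors e)))"
      using affine_edge_aff(1)[OF e xc] ul t by (auto simp: mul)
    have "m \<oplus>\<^bsub>obj_mod R (amb (mors e))\<^esub> m'
      = Obj (u (l x'), t) \<oplus>\<^bsub>obj_mod R (amb (mors e))\<^esub> Obj (emul e (x', x), t)"
      using xc ul t by (simp add: m m' mul aff_def E.M.add_minus_cancel)
    then show ?thesis
      using O.add_minus_cancel(2)[OF c(2,1)] eD(10)[OF x] t by (simp add: aff_def obj_edge_def m m')
  qed
  show ?thesis
    unfolding affine_edge_def obj_edge_sel
    using tset_obj[OF eD(1)] tset_obj[OF eD(2)] lin_on_obj[OF eD(3)] lin_on_obj[OF eD(4)]
      smooth_map_obj[OF eD(1,2,8)] mul eD(5,6,7)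
    by (auto simp: obj_edge_def)
qed

text \<open>Since the source is linear, composability constrains the direction of the left factor by
  the linear equation \<open>l w' = T (...)\<close>, whose right-hand side depends on the right
  factor only.\<close>

lemma mor_comp_iff:
  assumes e: "affine_edge e l u" and T: "has_slope (mors e) (amb (objs e)) (tau (objs e)) (etgt e) T"
  shows "(Mor (p', w', s'), Mor (p, w, s)) \<in> mor_comp e \<longleftrightarrow>
    Mor (p', w', s') \<in> pts (mor_top R TK (mors e)) \<and> Mor (p, w, s) \<in> pts (mor_top R TK (mors e))
    \<and> s' = s \<and> l p' = etgt e p \<and> l w' = T (Mor (p, w, s))"
proof -
  note eD = affine_edgeD[OF e]
  have "mor_map R TK (mors e) (objs e) (esrc e) m = lin_mor l m" if "m \<in> pts (mor_top R TK (mors e))" for m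
    by (rule mor_map_lin_on[OF eD(1,2,3) eD(6) that])
  moreover have "mor_map R TK (mors e) (objs e) (etgt e) m = Mor (etgt e (bpt m), T m, tpt m)"
    if "m \<in> pts (mor_top R TK (mors e))" for m
    by (rule mor_map_eq[OF eD(1,2,8) T that])
  ultimately show ?thesis
    unfolding mor_comp_def by (auto simp del: mor_top_sel)
qed

text \<open>A tangent composable pair starts and ends in a composable pair:
  \<open>l (p' + s w') = l p' + s (l w')\<close> is the value of the target map at \<open>p\<close>,
  plus \<open>s\<close> times its slope, hence its value at \<open>p + s w\<close>.\<close>

lemma mor_compE:
  assumes e: "affine_edge e l u" and c: "(m', m) \<in> mor_comp e"
  obtains p' w' p w s where "m' = Mor (p', w', s)" and "m = Mor (p, w, s)"
    and "Mor (p', w', s) \<in> pts (mor_top R TK (mors e))" and "Mor (p, w, s) \<in> pts (mor_top R TK (mors e))"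
    and "(p', p) \<in> ecomp e"
    and "(p' \<oplus>\<^bsub>amb (mors e)\<^esub> (s \<odot>\<^bsub>amb (mors e)\<^esub> w'), p \<oplus>\<^bsub>amb (mors e)\<^esub> (s \<odot>\<^bsub>amb (mors e)\<^esub> w)) \<in> ecomp e"
proof -
  note eD = affine_edgeD[OF e]
  obtain T where T: "has_slope (mors e) (amb (objs e)) (tau (objs e)) (etgt e) T"
    by (rule smooth_map_slope[OF eD(8)])
  have "m' \<in> pts (mor_top R TK (mors e))" "m \<in> pts (mor_top R TK (mors e))"
    using c by (auto simp: mor_comp_def simp del: mor_top_sel)
  then obtain p' w' s' p w s where mm: "m' = Mor (p', w', s')" "m = Mor (p, w, s)"
    by (metis mor_ptsE)
  have c: "Mor (p', w', s) \<in> pts (mor_top R TK (mors e))" "Mor (p, w, s) \<in> pts (mor_top R TK (mors e))"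
    "s' = s" "l p' = etgt e p" "l w' = T (Mor (p, w, s))"
    using c[unfolded mm mor_comp_iff[OF e T]] by auto
  note d' = Mor_ptsD[OF c(1)] and d = Mor_ptsD[OF c(2)]
  note ll = lin_mapD[OF lin_onD(1)[OF eD(3)]]
  interpret E: module R "amb (mors e)" by (rule tsetD(2)[OF eD(1)])
  have "l (p' \<oplus>\<^bsub>amb (mors e)\<^esub> (s \<odot>\<^bsub>amb (mors e)\<^esub> w'))
      = etgt e (p \<oplus>\<^bsub>amb (mors e)\<^esub> (s \<odot>\<^bsub>amb (mors e)\<^esub> w))"
    using d' tsetD(5)[OF eD(1)] by (simp add: ll c has_slopeD[OF T c(2)])
  then have "(p' \<oplus>\<^bsub>amb (mors e)\<^esub> (s \<odot>\<^bsub>amb (mors e)\<^esub> w'), p \<oplus>\<^bsub>amb (mors e)\<^esub> (s \<odot>\<^bsub>amb (mors e)\<^esub> w)) \<in> ecomp e"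
    using d'(4) d(4) by (simp add: mem_ecomp eD(6))
  moreover have "(p', p) \<in> ecomp e"
    using d'(1) d(1) c by (simp add: mem_ecomp eD(6))
  ultimately show ?thesis
    using that mm c by metis
qed

text \<open>The curve fixes \<open>p'\<close>, \<open>p\<close> and \<open>w\<close> and varies the parameter; the component of \<open>w'\<close> that
  composability determines is corrected by \<open>u\<close>.\<close>

lemma mor_comp_curve:
  assumes e: "affine_edge e l u" and c: "(Mor (p', w', s), Mor (p, w, s)) \<in> mor_comp e"
  obtains W c where "openin TK W" and "s \<in> W" and "c s = w'"
    and "\<And>r. r \<in> W \<Longrightarrow> (Mor (p', c r, r), Mor (p, w, r)) \<in> mor_comp e"
    and "continuous_map (subtopology TK W) (tau (mors e)) c"
proof -
  note eD = affine_edgeD[OF e]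
  obtain T where T: "has_slope (mors e) (amb (objs e)) (tau (objs e)) (etgt e) T"
    by (rule smooth_map_slope[OF eD(8)])
  let ?E = "amb (mors e)"
  note E = tsetD(1)[OF eD(1)]
  interpret E: module R ?E by (rule tsetD(2)[OF eD(1)])
  note ll = lin_mapD[OF lin_onD(1)[OF eD(3)]] and uu = lin_mapD[OF lin_onD(1)[OF eD(4)]]
  interpret O: module R "amb (objs e)" by (rule tsetD(2)[OF eD(2)])
  have mc: "Mor (p', w', s) \<in> pts (mor_top R TK (mors e))" "Mor (p, w, s) \<in> pts (mor_top R TK (mors e))"
    "l p' = etgt e p" "l w' = T (Mor (p, w, s))"
    using c[unfolded mor_comp_iff[OF e T]] by auto
  note d' = Mor_ptsD[OF mc(1)] and d = Mor_ptsD[OF mc(2)]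
  obtain W where W: "openin TK W" "s \<in> W"
    "\<And>r. r \<in> W \<Longrightarrow> Mor (p, w, r) \<in> pts (mor_top R TK (mors e))"
    "continuous_map (subtopology TK W) (subspace (mor_top R TK (mors e))) (\<lambda>r. Mor (p, w, r))"
    using line_curve[OF eD(1) mc(2)] by metis
  \<comment> \<open>The second summand is in the kernel of \<open>l\<close>, because
    \<open>l \<circ> u\<close> is the identity; so \<open>l (c r)\<close> is the value required at
    parameter \<open>r\<close>. At \<open>r = s\<close> that value is \<open>l w'\<close>, and the
    terms with \<open>u\<close> cancel.\<close>
  define c where "c r = u (T (Mor (p, w, r))) \<oplus>\<^bsub>?E\<^esub> (w' \<ominus>\<^bsub>?E\<^esub> u (l w'))" for r
  have cons: "continuous_map X (tau (mors e)) (\<lambda>_. x)" if "x \<in> carrier ?E" for x and X :: "'k topology"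
    using that tsetD(3)[OF eD(1)] by simp
  have "continuous_map (subtopology TK W) (tau (mors e)) (\<lambda>r. u (T (Mor (p, w, r))))"
    using continuous_map_compose[OF continuous_map_compose[OF W(4) has_slope_continuous[OF T]] lin_onD(2)[OF eD(4)]]
    by (simp add: o_def)
  moreover have "w' \<ominus>\<^bsub>?E\<^esub> u (l w') \<in> carrier ?E" using d' by (simp add: ll uu)
  ultimately have cc: "continuous_map (subtopology TK W) (tau (mors e)) c"
    unfolding c_def by (intro continuous_add[OF E] cons)
  \<comment> \<open>\<open>W\<close> takes care of the right factor only; the parameters are
    restricted further so that the endpoint of the left factor, whose direction now varies with
    \<open>r\<close>, remains in the open set of points.\<close>
  let ?W = "{r \<in> topspace (subtopology TK W). p' \<oplus>\<^bsub>?E\<^esub> (r \<odot>\<^bsub>?E\<^esub> c r) \<in> pts (mors e)}"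
  have "continuous_map (subtopology TK W) TK (\<lambda>r. r)"
    using continuous_map_from_subtopology[OF continuous_map_id] by (simp add: id_def)
  then have "openin (subtopology TK W) ?W"
    using d'(1) tsetD(5)[OF eD(1)]
    by (intro openin_continuous_map_preimage[OF _ tsetD(4)[OF eD(1)]] continuous_add[OF E] cons continuous_smult[OF E] cc)
      auto
  then have oW: "openin TK ?W"
    using W(1) by (simp add: openin_open_subtopology)
  have cs: "c s = w'"
    using d'(2) by (simp add: c_def flip: mc(4)) (simp add: ll uu E.M.add_minus_cancel)
  have Wc: "r \<in> carrier R" if "r \<in> W" for r
    using openin_subset[OF W(1)] that by auto
  show ?thesis
  proof
    show "openin TK ?W" by (rule oW)
    show "s \<in> ?W" using W(2) d' cs Wc by simp
    show "c s = w'" by (rule cs)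
    show "continuous_map (subtopology TK ?W) (tau (mors e)) c"
      by (rule continuous_map_from_subtopology_mono[OF cc]) auto
    fix r assume r: "r \<in> ?W"
    have Tc: "T (Mor (p, w, r)) \<in> carrier (amb (objs e))"
      using has_slope_carrier[OF eD(1) tsetD(1)[OF eD(2)] T] W(3) r by simp
    have "c r \<in> carrier ?E" using d' Tc by (simp add: c_def ll uu)
    then have "Mor (p', c r, r) \<in> pts (mor_top R TK (mors e))"
      using r d' Wc by (intro mor_ptsI) auto
    moreover have "l (w' \<ominus>\<^bsub>?E\<^esub> u (l w')) = \<zero>\<^bsub>amb (objs e)\<^esub>"
    proof -
      have w: "u (l w') \<in> carrier ?E" "l w' \<in> carrier (amb (objs e))" using d' by (simp_all add: ll uu)
      then have "l (u (l w') \<oplus>\<^bsub>?E\<^esub> (w' \<ominus>\<^bsub>?E\<^esub> u (l w')))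
          = l w' \<oplus>\<^bsub>amb (objs e)\<^esub> l (w' \<ominus>\<^bsub>?E\<^esub> u (l w'))"
        using d' by (simp add: ll eD(5))
      then show ?thesis
        using w d' by (simp add: E.M.add_minus_cancel ll)
    qed
    then have "l (c r) = T (Mor (p, w, r))"
      unfolding c_def using d' Tc by (simp add: ll uu eD(5))
    ultimately show "(Mor (p', c r, r), Mor (p, w, r)) \<in> mor_comp e"
      using r W(3) mc(3) by (simp add: mor_comp_iff[OF e T] del: mor_top_sel)
  qed
qed

section \<open>The fibre product of tangent morphisms, and the slope of the product\<close>

abbreviation mor_comp_top :: "('v, 'k) edge \<Rightarrow> (('v, 'k) pt \<times> ('v, 'k) pt) topology" where
  "mor_comp_top e \<equiv>
    subtopology (prod_topology (tau (mor_top R TK (mors e))) (tau (mor_top R TK (mors e)))) (mor_comp e)"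

text \<open>The analogue of \<open>mor_eq_of_eq_on_Units\<close> on the fibre product. Varying the
  parameter alone would break composability, so the curves of \<open>mor_comp_curve\<close> replace
  the straight ones.\<close>

lemma mor_comp_eq_of_eq_on_Units:
  assumes e: "affine_edge e l u" and T: "Hausdorff_space T"
    and g: "continuous_map (mor_comp_top e) T g" and h: "continuous_map (mor_comp_top e) T h"
    and eq: "\<And>p' w' p w t. (Mor (p', w', t), Mor (p, w, t)) \<in> mor_comp e \<Longrightarrow> t \<in> Units R \<Longrightarrow>
      g (Mor (p', w', t), Mor (p, w, t)) = h (Mor (p', w', t), Mor (p, w, t))"
    and c: "q \<in> mor_comp e"
  shows "g q = h q"
proof -
  note eD = affine_edgeD[OF e]
  obtain p' w' p w s where q: "q = (Mor (p', w', s), Mor (p, w, s))"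
    using mor_compE[OF e] c by (metis surj_pair)
  obtain W c where W: "openin TK W" "s \<in> W" "c s = w'"
    "\<And>r. r \<in> W \<Longrightarrow> (Mor (p', c r, r), Mor (p, w, r)) \<in> mor_comp e"
    "continuous_map (subtopology TK W) (tau (mors e)) c"
    using mor_comp_curve[OF e] c[unfolded q] by metis
  have id: "continuous_map (subtopology TK W) TK (\<lambda>r. r)"
    using continuous_map_from_subtopology[OF continuous_map_id] by (simp add: id_def)
  have "Mor (p', w', s) \<in> pts (mor_top R TK (mors e))" "Mor (p, w, s) \<in> pts (mor_top R TK (mors e))"
    using c q by (auto simp: mor_comp_def simp del: mor_top_sel)
  note d' = Mor_ptsD[OF this(1)] and d = Mor_ptsD[OF this(2)]
  have cons: "continuous_map (subtopology TK W) (tau (mors e)) (\<lambda>_. x)" if "x \<in> carrier (amb (mors e))" for x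
    using that tsetD(3)[OF eD(1)] by simp
  have k: "continuous_map (subtopology TK W) (mor_comp_top e) (\<lambda>r. (Mor (p', c r, r), Mor (p, w, r)))"
    unfolding mor_top_sel(3) using W(4,5) d d' tsetD(5)[OF eD(1)]
    by (intro continuous_map_into_subtopology continuous_map_pairedI continuous_map_Mor cons id) auto
  have "g (Mor (p', c s, s), Mor (p, w, s)) = h (Mor (p', c s, s), Mor (p, w, s))"
    by (rule eq_of_eq_on_Units[OF W(1,2) T, where g = "\<lambda>r. g (Mor (p', c r, r), Mor (p, w, r))"
          and h = "\<lambda>r. h (Mor (p', c r, r), Mor (p, w, r))"])
      (use continuous_map_compose[OF k g] continuous_map_compose[OF k h] eq W(4) in \<open>auto simp: o_def\<close>)
  then show ?thesis by (simp add: q W(3))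
qed

lemma continuous_mor_comp_sel:
  shows "continuous_map (mor_comp_top e) (subspace (mor_top R TK (mors e))) fst"
    and "continuous_map (mor_comp_top e) (subspace (mor_top R TK (mors e))) snd"
  by (intro continuous_map_into_subtopology continuous_map_from_subtopology continuous_map_fst continuous_map_snd;
      auto simp: mor_comp_def simp del: mor_top_sel)+

text \<open>The expression \<open>aff\<close> is linear in the pair of its arguments, and by
  \<open>mor_compE\<close> it computes the product at both ends of the line. Its increment is
  therefore \<open>s\<close> times its value on the directions.\<close>

lemma emul_line:
  assumes e: "affine_edge e l u" and c: "(Mor (p', w', s), Mor (p, w, s)) \<in> mor_comp e"
  shows "emul e (p' \<oplus>\<^bsub>amb (mors e)\<^esub> (s \<odot>\<^bsub>amb (mors e)\<^esub> w'), p \<oplus>\<^bsub>amb (mors e)\<^esub> (s \<odot>\<^bsub>amb (mors e)\<^esub> w))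
    = emul e (p', p) \<oplus>\<^bsub>amb (mors e)\<^esub> (s \<odot>\<^bsub>amb (mors e)\<^esub> aff (amb (mors e)) l u w' w)"
    and "emul e (p', p) \<in> pts (mors e)"
    and "Mor (emul e (p', p), aff (amb (mors e)) l u w' w, s) \<in> pts (mor_top R TK (mors e))"
proof -
  note eD = affine_edgeD[OF e]
  have m: "Mor (p', w', s) \<in> pts (mor_top R TK (mors e))" "Mor (p, w, s) \<in> pts (mor_top R TK (mors e))"
    and ec: "(p', p) \<in> ecomp e"
    and ec': "(p' \<oplus>\<^bsub>amb (mors e)\<^esub> (s \<odot>\<^bsub>amb (mors e)\<^esub> w'), p \<oplus>\<^bsub>amb (mors e)\<^esub> (s \<odot>\<^bsub>amb (mors e)\<^esub> w)) \<in> ecomp e"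
    using mor_compE[OF e c] by (metis pt.inject(3) prod.inject)+
  note d' = Mor_ptsD[OF m(1)] and d = Mor_ptsD[OF m(2)]
  note c = tsetD(5)[OF eD(1) d'(1)] tsetD(5)[OF eD(1) d(1)]
  show *: "emul e (p' \<oplus>\<^bsub>amb (mors e)\<^esub> (s \<odot>\<^bsub>amb (mors e)\<^esub> w'), p \<oplus>\<^bsub>amb (mors e)\<^esub> (s \<odot>\<^bsub>amb (mors e)\<^esub> w))
    = emul e (p', p) \<oplus>\<^bsub>amb (mors e)\<^esub> (s \<odot>\<^bsub>amb (mors e)\<^esub> aff (amb (mors e)) l u w' w)"
    unfolding eD(9)[OF ec] eD(9)[OF ec'] by (rule affine_edge_aff(2)[OF e c(2,1) d(2) d'(2) d(3)])
  show "emul e (p', p) \<in> pts (mors e)"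
    by (rule eD(10)[OF ec])
  then show "Mor (emul e (p', p), aff (amb (mors e)) l u w' w, s) \<in> pts (mor_top R TK (mors e))"
    using eD(10)[OF ec'] affine_edge_aff(1)[OF e d(2) d'(2)] d(3) unfolding * by (intro mor_ptsI) auto
qed

text \<open>For an invertible parameter, \<open>emul_line\<close> shows that the difference quotient
  of the product is \<open>aff\<close> applied to the directions, which is continuous everywhere.
  Uniqueness of the extension is density in the fibre product.\<close>

lemma slope_emul:
  fixes e :: "('v, 'k) edge"
  assumes e: "affine_edge e l u" and c: "(Mor (p', w', s), Mor (p, w, s)) \<in> mor_comp e"
  shows "slope R TK (prod_mod (amb (mors e)) (amb (mors e))) (prod_topology (tau (mors e)) (tau (mors e)))
      (amb (mors e)) (tau (mors e)) (mor_comp_triples e) (emul e) ((p', p), (w', w), s)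
    = aff (amb (mors e)) l u w' w"
proof -
  note eD = affine_edgeD[OF e]
  let ?E = "amb (mors e)" and ?T = "tau (mors e)" and ?Z = "mor_comp_triples e"
  let ?E2 = "prod_mod ?E ?E" and ?T2 = "prod_topology ?T ?T"
  let ?P = "prod_topology ?T2 (prod_topology ?T2 TK)"
  interpret E: module R ?E by (rule tsetD(2)[OF eD(1)])
  \<comment> \<open>The density lemma speaks of pairs of morphisms, \<open>slope\<close> of triples
    of point, direction and parameter; \<open>k\<close> passes from the former to the
    latter.\<close>
  define k :: "('v, 'k) pt \<times> ('v, 'k) pt \<Rightarrow> _"
    where "k = (\<lambda>q. ((bpt (fst q), bpt (snd q)), (vpt (fst q), vpt (snd q)), tpt (snd q)))"
  define a where "a q = aff ?E l u (fst (fst (snd q))) (snd (fst (snd q)))"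
    for q :: "(('v, 'k) pt \<times> ('v, 'k) pt) \<times> (('v, 'k) pt \<times> ('v, 'k) pt) \<times> 'k"
  have quot: "a q = inv (snd (snd q)) \<odot>\<^bsub>?E\<^esub>
      (emul e (fst q \<oplus>\<^bsub>?E2\<^esub> (snd (snd q) \<odot>\<^bsub>?E2\<^esub> fst (snd q))) \<ominus>\<^bsub>?E\<^esub> emul e (fst q))"
    if q: "q \<in> ?Z" and t: "snd (snd q) \<in> Units R" for q
  proof -
    obtain p' p w' w t where qq: "q = ((p', p), (w', w), t)"
        by (rule that[of "fst (fst q)" "snd (fst q)" "fst (fst (snd q))" "snd (fst (snd q))" "snd (snd q)"]) simp
    then have c: "(Mor (p', w', t), Mor (p, w, t)) \<in> mor_comp e" using q by (simp add: mor_comp_triples_def)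
    note line = emul_line[OF e c]
    have tU: "t \<in> Units R" using t by (simp add: qq)
    have car: "emul e (p', p) \<in> carrier ?E" "aff ?E l u w' w \<in> carrier ?E"
      using tsetD(5)[OF eD(1) line(2)] Mor_ptsD(2)[OF line(3)] by auto
    show ?thesis
      using car tU by (simp add: qq a_def line(1) E.M.add_minus_cancel R.Units_closed
          Units_smult_inv(2)[OF E.module_axioms])
  qed
  have "continuous_map ?P ?T (\<lambda>q. fst (fst (snd q)))" "continuous_map ?P ?T (\<lambda>q. snd (fst (snd q)))"
    using continuous_map_compose[OF continuous_map_compose[OF continuous_map_snd continuous_map_fst] continuous_map_fst]
      continuous_map_compose[OF continuous_map_compose[OF continuous_map_snd continuous_map_fst] continuous_map_snd]
    by (auto simp: o_def)
  then have ca: "continuous_map (subtopology ?P ?Z) ?T a"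
    unfolding a_def by (intro continuous_map_from_subtopology continuous_aff[OF e])
  have ia: "is_slope R TK ?E2 ?T2 ?E ?T ?Z (emul e) (restrict a ?Z)"
    unfolding is_slope_def
  proof (intro conjI ballI)
    show "continuous_map (subtopology ?P ?Z) ?T (restrict a ?Z)"
      by (rule continuous_map_eq[OF ca]) simp
  qed (use quot in \<open>auto simp: split_def\<close>)
  have ck: "continuous_map (mor_comp_top e) (subtopology ?P ?Z) k"
    unfolding k_def
  proof (intro continuous_map_into_subtopology continuous_map_pairedI)
    note s = continuous_mor_comp_sel[of e]
    note f = continuous_map_compose[OF s(1) continuous_mor_sel(2), unfolded o_def]
      continuous_map_compose[OF s(2) continuous_mor_sel(2), unfolded o_def]
      continuous_map_compose[OF s(1) continuous_mor_sel(3), unfolded o_def]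
      continuous_map_compose[OF s(2) continuous_mor_sel(3), unfolded o_def]
      continuous_map_compose[OF s(2) continuous_mor_sel(4), unfolded o_def]
    show "continuous_map (mor_comp_top e) ?T (\<lambda>q. bpt (fst q))" by (rule f)
    show "continuous_map (mor_comp_top e) ?T (\<lambda>q. bpt (snd q))" by (rule f)
    show "continuous_map (mor_comp_top e) ?T (\<lambda>q. vpt (fst q))" by (rule f)
    show "continuous_map (mor_comp_top e) ?T (\<lambda>q. vpt (snd q))" by (rule f)
    show "continuous_map (mor_comp_top e) TK (\<lambda>q. tpt (snd q))" by (rule f)
    show "(\<lambda>q. ((bpt (fst q), bpt (snd q)), (vpt (fst q), vpt (snd q)), tpt (snd q)))
        \<in> topspace (mor_comp_top e) \<rightarrow> ?Z"
    proof
      fix q assume "q \<in> topspace (mor_comp_top e)"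
      then have q: "(fst q, snd q) \<in> mor_comp e" by simp
      from mor_compE[OF e q] obtain p' w' p w s where "fst q = Mor (p', w', s)" "snd q = Mor (p, w, s)"
        by metis
      then show "((bpt (fst q), bpt (snd q)), (vpt (fst q), vpt (snd q)), tpt (snd q)) \<in> ?Z"
        using q by (simp add: mor_comp_triples_def)
    qed
  qed
  have "slope R TK ?E2 ?T2 ?E ?T ?Z (emul e) = restrict a ?Z"
    unfolding slope_def
  proof (rule the_equality, intro conjI)
    fix g assume g: "g \<in> extensional ?Z \<and> is_slope R TK ?E2 ?T2 ?E ?T ?Z (emul e) g"
    then have cg: "continuous_map (subtopology ?P ?Z) ?T g" by (simp add: is_slope_def)
    show "g = restrict a ?Z"
    proof (rule extensionalityI)
      fix q assume q: "q \<in> ?Z"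
      obtain p' p w' w t where qq: "q = ((p', p), (w', w), t)"
        by (rule that[of "fst (fst q)" "snd (fst q)" "fst (fst (snd q))" "snd (fst (snd q))" "snd (snd q)"]) simp
      then have c: "(Mor (p', w', t), Mor (p, w, t)) \<in> mor_comp e" using q by (simp add: mor_comp_triples_def)
      have "(g \<circ> k) (Mor (p', w', t), Mor (p, w, t)) = (a \<circ> k) (Mor (p', w', t), Mor (p, w, t))"
      proof (rule mor_comp_eq_of_eq_on_Units[OF e tmodD(3)[OF tsetD(1)[OF eD(1)]]
            continuous_map_compose[OF ck cg] continuous_map_compose[OF ck ca] _ c])
        fix p' w' p w t assume c: "(Mor (p', w', t), Mor (p, w, t)) \<in> mor_comp e" and t: "t \<in> Units R"
        then have Z: "((p', p), (w', w), t) \<in> ?Z" by (simp add: mor_comp_triples_def)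
        show "(g \<circ> k) (Mor (p', w', t), Mor (p, w, t)) = (a \<circ> k) (Mor (p', w', t), Mor (p, w, t))"
          using g t quot[OF Z] bspec[OF conjunct2[OF conjunct2[OF g, unfolded is_slope_def]] Z] by (simp add: k_def)
      qed
      then show "g q = restrict a ?Z q"
        using q by (simp add: k_def qq)
    qed (use g in auto)
  qed (use ia in auto)
  moreover have "((p', p), (w', w), s) \<in> ?Z" using c by (simp add: mor_comp_triples_def)
  ultimately show ?thesis by (simp add: a_def)
qed

lemma emul_mor_edge:
  assumes e: "affine_edge e l u" and c: "(Mor (p', w', s), Mor (p, w, s)) \<in> mor_comp e"
  shows "emul (mor_edge e) (Mor (p', w', s), Mor (p, w, s)) = Mor (emul e (p', p), aff (amb (mors e)) l u w' w, s)"
  using slope_emul[OF e c] by (simp add: mor_edge_def)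

text \<open>With the slope known, the new product applies \<open>aff\<close> to the points and to
  the directions, while \<open>lin_mor l\<close> and \<open>lin_mor u\<close> act in the same two
  components. The parameter fits as well: \<open>s + s - s = s\<close>. Hence the affine form
  persists.\<close>

lemma affine_edge_mor:
  assumes e: "affine_edge e l u"
  shows "affine_edge (mor_edge e) (lin_mor l) (lin_mor u)"
proof -
  note eD = affine_edgeD[OF e]
  interpret E: module R "amb (mors e)" by (rule tsetD(2)[OF eD(1)])
  have mul: "emul (mor_edge e) (m', m) = aff (amb (mor_top R TK (mors e))) (lin_mor l) (lin_mor u) m' m
      \<and> emul (mor_edge e) (m', m) \<in> pts (mor_top R TK (mors e))"
    if c: "(m', m) \<in> ecomp (mor_edge e)" for m' m
  proof -
    have c: "(m', m) \<in> mor_comp e" using c by (simp add: ecomp_mor_edge)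
    obtain p' w' p w s where mm: "m' = Mor (p', w', s)" "m = Mor (p, w, s)"
      and m: "Mor (p', w', s) \<in> pts (mor_top R TK (mors e))" "Mor (p, w, s) \<in> pts (mor_top R TK (mors e))"
      and ec: "(p', p) \<in> ecomp e"
      using mor_compE[OF e c] by metis
    note c = c[unfolded mm] and d' = Mor_ptsD[OF m(1)] and d = Mor_ptsD[OF m(2)]
    have pc: "p \<in> carrier (amb (mors e))" "p' \<in> carrier (amb (mors e))"
      using d'(1) d(1) tsetD(5)[OF eD(1)] by auto
    note ul = lin_mapD(1)[OF lin_onD(1)[OF eD(4)] lin_mapD(1)[OF lin_onD(1)[OF eD(3)]]]
    interpret M: module R "mor_mod R (amb (mors e))" by (rule module_mor_mod[OF E.module_axioms])
    have mul: "emul (mor_edge e) (m', m) = Mor (aff (amb (mors e)) l u p' p, aff (amb (mors e)) l u w' w, s)"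
      unfolding mm emul_mor_edge[OF e c] eD(9)[OF ec] ..
    have cr: "Mor (aff (amb (mors e)) l u p' p, aff (amb (mors e)) l u w' w, s) \<in> carrier (mor_mod R (amb (mors e)))"
      "Mor (u (l p'), u (l w'), s) \<in> carrier (mor_mod R (amb (mors e)))"
      using affine_edge_aff(1)[OF e] pc d d' ul by auto
    have "m \<oplus>\<^bsub>mor_mod R (amb (mors e))\<^esub> m' = Mor (u (l p'), u (l w'), s) \<oplus>\<^bsub>mor_mod R (amb (mors e))\<^esub>
        Mor (aff (amb (mors e)) l u p' p, aff (amb (mors e)) l u w' w, s)"
      using pc d d' ul by (simp add: mm aff_def E.M.add_minus_cancel)
    then have "emul (mor_edge e) (m', m) = aff (amb (mor_top R TK (mors e))) (lin_mor l) (lin_mor u) m' m"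
      using M.add_minus_cancel(2)[OF cr(2,1)] unfolding mul by (simp add: aff_def[of "mor_mod R _"] mm)
    moreover have "emul (mor_edge e) (m', m) \<in> pts (mor_top R TK (mors e))"
      using emul_line(3)[OF e c] unfolding mm emul_mor_edge[OF e c] .
    ultimately show ?thesis ..
  qed
  have "lin_mor l (lin_mor u x) = x" if "x \<in> carrier (amb (mor_top R TK (objs e)))" for x
    using that eD(5) by auto
  moreover have "esrc (mor_edge e) m = lin_mor l m" if "m \<in> pts (mor_top R TK (mors e))" for m
    using mor_map_lin_on[OF eD(1,2,3) eD(6) that] by (simp add: mor_edge_def)
  moreover have "eunit (mor_edge e) m = lin_mor u m" if "m \<in> pts (mor_top R TK (objs e))" for m
    using mor_map_lin_on[OF eD(2,1,4) eD(7) that] by (simp add: mor_edge_def)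
  moreover have "smooth_map n (mor_top R TK (mors e)) (mor_top R TK (objs e)) (etgt (mor_edge e))" for n
    using smooth_map_mor[OF eD(1,2,8)] by (simp add: mor_edge_def)
  ultimately show ?thesis
    unfolding affine_edge_def mor_edge_sel
    using tset_mor[OF eD(1)] tset_mor[OF eD(2)] lin_on_mor[OF eD(1,3)] lin_on_mor[OF eD(2,4)] mul
    by blast
qed

end


section \<open>Morphisms of edges\<close>

context tdc
begin

lemma affine_edge_smooth:
  assumes e: "affine_edge e l u"
  shows "smooth_map n (mors e) (objs e) (esrc e)" and "smooth_map n (objs e) (mors e) (eunit e)"
proof -
  note eD = affine_edgeD[OF e]
  show "smooth_map n (mors e) (objs e) (esrc e)"
    by (rule smooth_map_cong[OF eD(1) _ smooth_map_lin_on[OF eD(1,3)]]) (simp add: eD(6))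
  show "smooth_map n (objs e) (mors e) (eunit e)"
    by (rule smooth_map_cong[OF eD(2) _ smooth_map_lin_on[OF eD(2,4)]]) (simp add: eD(7))
qed

text \<open>This becomes the preservation of units. In direction zero the slope equation reads
  \<open>f x = f x + r G\<close>, which forces \<open>G\<close> to vanish for invertible
  \<open>r\<close>, and density extends this to \<open>t\<close>.\<close>

lemma slope_zero_direction:
  assumes S: "tset S" and E: "tmod E T" and f: "continuous_map (subspace S) T f"
    and G: "has_slope S E T f G" and x: "x \<in> pts S" and t: "t \<in> carrier R"
  shows "G (Mor (x, \<zero>\<^bsub>amb S\<^esub>, t)) = \<zero>\<^bsub>E\<^esub>"
proof -
  interpret A: module R "amb S" by (rule tsetD(2)[OF S])
  interpret E: module R E by (rule tmodD(1)[OF E])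
  have xc: "x \<in> carrier (amb S)" using tsetD(5)[OF S x] .
  have m: "Mor (x, \<zero>\<^bsub>amb S\<^esub>, t) \<in> pts (mor_top R TK S)"
    using x t xc by (intro mor_ptsI) auto
  obtain W where W: "openin TK W" "t \<in> W"
    "\<And>r. r \<in> W \<Longrightarrow> Mor (x, \<zero>\<^bsub>amb S\<^esub>, r) \<in> pts (mor_top R TK S)"
    "continuous_map (subtopology TK W) (subspace (mor_top R TK S)) (\<lambda>r. Mor (x, \<zero>\<^bsub>amb S\<^esub>, r))"
    using line_curve[OF S m] by metis
  have fx: "f x \<in> carrier E" by (rule continuous_on_pts_carrier[OF S E f x])
  show ?thesis
  proof (rule eq_of_eq_on_Units[OF W(1,2) tmodD(3)[OF E], where h = "\<lambda>_. \<zero>\<^bsub>E\<^esub>"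
        and g = "\<lambda>r. G (Mor (x, \<zero>\<^bsub>amb S\<^esub>, r))"])
    show "continuous_map (subtopology TK W) T (\<lambda>r. G (Mor (x, \<zero>\<^bsub>amb S\<^esub>, r)))"
      using continuous_map_compose[OF W(4) has_slope_continuous[OF G]] by (simp add: o_def)
    show "continuous_map (subtopology TK W) T (\<lambda>_. \<zero>\<^bsub>E\<^esub>)"
      using tmodD(2)[OF E] by simp
    fix r assume r: "r \<in> W" "r \<in> Units R"
    note Gc = has_slope_carrier[OF S E G W(3)[OF r(1)]]
    show "G (Mor (x, \<zero>\<^bsub>amb S\<^esub>, r)) = \<zero>\<^bsub>E\<^esub>"
    proof (rule Units_smult_cancel[OF E.module_axioms r(2) Gc E.M.zero_closed])
      have "f x = f x \<oplus>\<^bsub>E\<^esub> (r \<odot>\<^bsub>E\<^esub> G (Mor (x, \<zero>\<^bsub>amb S\<^esub>, r)))"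
        using has_slopeD[OF G W(3)[OF r(1)]] xc r(2) by (simp add: R.Units_closed)
      then show "r \<odot>\<^bsub>E\<^esub> G (Mor (x, \<zero>\<^bsub>amb S\<^esub>, r)) = r \<odot>\<^bsub>E\<^esub> \<zero>\<^bsub>E\<^esub>"
        using fx Gc r(2) by (simp add: R.Units_closed)
    qed
  qed
qed

text \<open>This becomes the preservation of products. The increment from \<open>x\<close> to
  \<open>x + r (v + v')\<close> is computed in one step and in two steps via \<open>x + r v\<close>;
  for invertible \<open>r\<close> the factor \<open>r\<close> cancels.\<close>

lemma slope_add_directions:
  assumes S: "tset S" and E: "tmod E T" and f: "continuous_map (subspace S) T f"
    and G: "has_slope S E T f G" and m: "Mor (x, v, t) \<in> pts (mor_top R TK S)"
    and m': "Mor (x \<oplus>\<^bsub>amb S\<^esub> (t \<odot>\<^bsub>amb S\<^esub> v), v', t) \<in> pts (mor_top R TK S)"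
  shows "G (Mor (x, v \<oplus>\<^bsub>amb S\<^esub> v', t))
    = G (Mor (x, v, t)) \<oplus>\<^bsub>E\<^esub> G (Mor (x \<oplus>\<^bsub>amb S\<^esub> (t \<odot>\<^bsub>amb S\<^esub> v), v', t))"
proof -
  interpret A: module R "amb S" by (rule tsetD(2)[OF S])
  interpret E: module R E by (rule tmodD(1)[OF E])
  note d = Mor_ptsD[OF m] and d' = Mor_ptsD[OF m']
  have xc: "x \<in> carrier (amb S)" using tsetD(5)[OF S d(1)] .
  have sum: "x \<oplus>\<^bsub>amb S\<^esub> (r \<odot>\<^bsub>amb S\<^esub> v) \<oplus>\<^bsub>amb S\<^esub> (r \<odot>\<^bsub>amb S\<^esub> v')
      = x \<oplus>\<^bsub>amb S\<^esub> (r \<odot>\<^bsub>amb S\<^esub> (v \<oplus>\<^bsub>amb S\<^esub> v'))" if "r \<in> carrier R" for r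
    using that xc d d' by (simp add: A.smult_r_distr A.M.a_assoc)
  have mm: "Mor (x, v \<oplus>\<^bsub>amb S\<^esub> v', t) \<in> pts (mor_top R TK S)"
    using d d' sum[OF d(3)] by (intro mor_ptsI) auto
  obtain W\<^sub>1 where W1: "openin TK W\<^sub>1" "t \<in> W\<^sub>1"
    "\<And>r. r \<in> W\<^sub>1 \<Longrightarrow> Mor (x, v, r) \<in> pts (mor_top R TK S)"
    "continuous_map (subtopology TK W\<^sub>1) (subspace (mor_top R TK S)) (\<lambda>r. Mor (x, v, r))"
    using line_curve[OF S m] by metis
  obtain W\<^sub>2 where W2: "openin TK W\<^sub>2" "t \<in> W\<^sub>2"
    "\<And>r. r \<in> W\<^sub>2 \<Longrightarrow> Mor (x, v \<oplus>\<^bsub>amb S\<^esub> v', r) \<in> pts (mor_top R TK S)"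
    "continuous_map (subtopology TK W\<^sub>2) (subspace (mor_top R TK S)) (\<lambda>r. Mor (x, v \<oplus>\<^bsub>amb S\<^esub> v', r))"
    using line_curve[OF S mm] by metis
  \<comment> \<open>The starting point of the second step moves with \<open>r\<close>. The set
    \<open>W\<^sub>1\<close> keeps this intermediate point among the points, and
    \<open>W\<^sub>2\<close> does so for the final one.\<close>
  let ?W = "W\<^sub>1 \<inter> W\<^sub>2"
  let ?m' = "\<lambda>r. Mor (x \<oplus>\<^bsub>amb S\<^esub> (r \<odot>\<^bsub>amb S\<^esub> v), v', r)"
  have W: "openin TK ?W" "t \<in> ?W" using W1 W2 by auto
  have m'W: "?m' r \<in> pts (mor_top R TK S)" if "r \<in> ?W" for r
  proof -
    have r: "r \<in> W\<^sub>1" "r \<in> W\<^sub>2" using that by auto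
    note d1 = Mor_ptsD[OF W1(3)[OF r(1)]] and d2 = Mor_ptsD[OF W2(3)[OF r(2)]]
    show ?thesis
      by (rule mor_ptsI[OF d1(4) d'(2) d1(3)]) (use sum[OF d1(3)] d2(4) in simp)
  qed
  have id: "continuous_map (subtopology TK ?W) TK (\<lambda>r. r)"
    using continuous_map_from_subtopology[OF continuous_map_id] by (simp add: id_def)
  have cons: "continuous_map (subtopology TK ?W) (tau S) (\<lambda>_. y)" if "y \<in> carrier (amb S)" for y
    using that tsetD(3)[OF S] by simp
  have "continuous_map (subtopology TK ?W) (tau (mor_top R TK S)) ?m'"
    unfolding mor_top_sel(3)
    by (intro continuous_map_Mor continuous_add[OF tsetD(1)[OF S]] continuous_smult[OF tsetD(1)[OF S]]
        cons xc d(2) d'(2) id)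
  then have c3: "continuous_map (subtopology TK ?W) (subspace (mor_top R TK S)) ?m'"
    using m'W by (intro continuous_map_into_subtopology) (simp_all del: mor_top_sel)
  have c1: "continuous_map (subtopology TK ?W) (subspace (mor_top R TK S)) (\<lambda>r. Mor (x, v, r))"
    by (rule continuous_map_from_subtopology_mono[OF W1(4)]) simp
  have c2: "continuous_map (subtopology TK ?W) (subspace (mor_top R TK S)) (\<lambda>r. Mor (x, v \<oplus>\<^bsub>amb S\<^esub> v', r))"
    by (rule continuous_map_from_subtopology_mono[OF W2(4)]) simp
  note cG = continuous_map_compose[OF _ has_slope_continuous[OF G], unfolded o_def]
  show ?thesis
  proof (rule eq_of_eq_on_Units[OF W tmodD(3)[OF E] cG[OF c2] continuous_add[OF E cG[OF c1] cG[OF c3]]])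
    fix r assume r: "r \<in> ?W" "r \<in> Units R"
    have m1: "Mor (x, v, r) \<in> pts (mor_top R TK S)" and m2: "Mor (x, v \<oplus>\<^bsub>amb S\<^esub> v', r) \<in> pts (mor_top R TK S)"
      and m3: "?m' r \<in> pts (mor_top R TK S)"
      using W1(3) W2(3) m'W r by (simp_all del: mor_top_sel)
    note g = has_slope_carrier[OF S E G m1] has_slope_carrier[OF S E G m2] has_slope_carrier[OF S E G m3]
    have fx: "f x \<in> carrier E" by (rule continuous_on_pts_carrier[OF S E f d(1)])
    have rc: "r \<in> carrier R" using r by (simp add: R.Units_closed)
    have "f x \<oplus>\<^bsub>E\<^esub> (r \<odot>\<^bsub>E\<^esub> G (Mor (x, v \<oplus>\<^bsub>amb S\<^esub> v', r)))
        = f x \<oplus>\<^bsub>E\<^esub> (r \<odot>\<^bsub>E\<^esub> (G (Mor (x, v, r)) \<oplus>\<^bsub>E\<^esub> G (?m' r)))"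
      unfolding has_slopeD[OF G m2, symmetric] sum[OF rc, symmetric] has_slopeD[OF G m3] has_slopeD[OF G m1]
      using fx g rc by (simp add: E.smult_r_distr E.M.a_assoc)
    then have eq: "r \<odot>\<^bsub>E\<^esub> G (Mor (x, v \<oplus>\<^bsub>amb S\<^esub> v', r)) = r \<odot>\<^bsub>E\<^esub> (G (Mor (x, v, r)) \<oplus>\<^bsub>E\<^esub> G (?m' r))"
      using fx g rc by simp
    show "G (Mor (x, v \<oplus>\<^bsub>amb S\<^esub> v', r)) = G (Mor (x, v, r)) \<oplus>\<^bsub>E\<^esub> G (?m' r)"
      by (rule Units_smult_cancel[OF E.module_axioms r(2) g(2) E.M.a_closed[OF g(1,3)] eq])
  qed
qed

text \<open>Compatibility with targets is the slope equation itself, with units the vanishing of the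
  slope in direction zero, and with products the addition formula for consecutive
  directions.\<close>

lemma edge_morph_base:
  assumes S: "tset S" and S': "tset S'" and f: "smooth_map 1 S S' f"
  shows "edge_morph (base_edge S) (base_edge S') (obj_map f) (mor_map R TK S S' f)"
proof -
  obtain G where G: "has_slope S (amb S') (tau S') f G"
    by (rule smooth_map_slope[OF f[unfolded One_nat_def]])
  note mor = mor_map_eq[OF S S' f G] and c = smooth_mapD(3)[OF f]
  have "esrc (base_edge S') (mor_map R TK S S' f m) = obj_map f (esrc (base_edge S) m)
      \<and> etgt (base_edge S') (mor_map R TK S S' f m) = obj_map f (etgt (base_edge S) m)"
    if m: "m \<in> pts (mor_top R TK S)" for m
  proof -
    obtain x v t where mm: "m = Mor (x, v, t)" using m by auto
    show ?thesis
      using has_slopeD[OF G m[unfolded mm]] mor[OF m] by (simp add: mm base_edge_def)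
  qed
  moreover have "eunit (base_edge S') (obj_map f p) = mor_map R TK S S' f (eunit (base_edge S) p)"
    if p: "p \<in> pts (obj_top R TK S)" for p
  proof -
    obtain x t where pp: "p = Obj (x, t)" "x \<in> pts S" "t \<in> carrier R" using p by auto
    interpret A: module R "amb S" by (rule tsetD(2)[OF S])
    have m: "Mor (x, \<zero>\<^bsub>amb S\<^esub>, t) \<in> pts (mor_top R TK S)"
      using pp tsetD(5)[OF S pp(2)] by (intro mor_ptsI) auto
    show ?thesis
      using mor[OF m] slope_zero_direction[OF S tsetD(1)[OF S'] c G pp(2,3)] by (simp add: pp(1) base_edge_def)
  qed
  moreover have "emul (base_edge S') (mor_map R TK S S' f m', mor_map R TK S S' f m)
      = mor_map R TK S S' f (emul (base_edge S) (m', m))"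
    if c: "(m', m) \<in> ecomp (base_edge S)" for m' m
  proof -
    obtain x v t x' v' t' where mm: "m = Mor (x, v, t)" "m' = Mor (x', v', t')"
      using c by (auto simp: mem_ecomp)
    have m: "Mor (x, v, t) \<in> pts (mor_top R TK S)"
      and m': "Mor (x \<oplus>\<^bsub>amb S\<^esub> (t \<odot>\<^bsub>amb S\<^esub> v), v', t) \<in> pts (mor_top R TK S)"
      and eq: "x' = x \<oplus>\<^bsub>amb S\<^esub> (t \<odot>\<^bsub>amb S\<^esub> v)" "t' = t"
      using c unfolding mm mem_ecomp by (auto simp: base_edge_def simp del: mor_top_sel)
    have "Mor (x, v \<oplus>\<^bsub>amb S\<^esub> v', t) \<in> pts (mor_top R TK S)"
      using affine_edgeD(10)[OF affine_edge_base[OF S] c] by (simp add: mm base_edge_def del: mor_top_sel)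
    then show ?thesis
      using mor[OF m] mor[OF m'] mor slope_add_directions[OF S tsetD(1)[OF S'] smooth_mapD(3)[OF f] G m m']
      by (simp add: mm eq base_edge_def del: mor_top_sel)
  qed
  ultimately show ?thesis
    unfolding edge_morph_def base_edge_sel by blast
qed

lemma edge_morph_obj:
  assumes F: "edge_morph e e' F\<^sub>0 F\<^sub>1"
  shows "edge_morph (obj_edge e) (obj_edge e') (obj_map F\<^sub>0) (obj_map F\<^sub>1)"
proof -
  have "emul (obj_edge e') (obj_map F\<^sub>1 m', obj_map F\<^sub>1 m) = obj_map F\<^sub>1 (emul (obj_edge e) (m', m))"
    if c: "(m', m) \<in> ecomp (obj_edge e)" for m' m
  proof -
    obtain x t x' where m: "m = Obj (x, t)" "m' = Obj (x', t)" and x: "(x', x) \<in> ecomp e"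
      using c by (auto simp: mem_ecomp obj_edge_def)
    show ?thesis
      using edge_morphD(4)[OF F x] by (simp add: m obj_edge_def)
  qed
  then show ?thesis
    unfolding edge_morph_def obj_edge_sel using edge_morphD(1-3)[OF F] by (auto simp: obj_edge_def)
qed

text \<open>Sources, targets and units are instances of \<open>mor_map_square\<close>. For products
  only the slope components need an argument: both sides are continuous on the fibre product, and at
  invertible parameters they are compared by means of the products at the two ends of a composable
  line.\<close>

lemma edge_morph_mor:
  assumes e: "affine_edge e l u" and e': "affine_edge e' l' u'"
    and F0: "smooth_map 1 (objs e) (objs e') F\<^sub>0" and F1: "smooth_map 1 (mors e) (mors e') F\<^sub>1"
    and F: "edge_morph e e' F\<^sub>0 F\<^sub>1"
  shows "edge_morph (mor_edge e) (mor_edge e')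
    (mor_map R TK (objs e) (objs e') F\<^sub>0) (mor_map R TK (mors e) (mors e') F\<^sub>1)"
proof -
  note eD = affine_edgeD[OF e] and eD' = affine_edgeD[OF e'] and FD = edge_morphD[OF F]
  note es = affine_edge_smooth[OF e] and es' = affine_edge_smooth[OF e']
  let ?F0 = "mor_map R TK (objs e) (objs e') F\<^sub>0" and ?F1 = "mor_map R TK (mors e) (mors e') F\<^sub>1"
  let ?E = "amb (mors e')"
  have src: "esrc (mor_edge e') (?F1 m) = ?F0 (esrc (mor_edge e) m)"
    and tgt: "etgt (mor_edge e') (?F1 m) = ?F0 (etgt (mor_edge e) m)"
    if m: "m \<in> pts (mor_top R TK (mors e))" for m
    using mor_map_square[OF eD(1) eD'(1) eD(2) eD'(2) F1 es'(1) es(1) F0 FD(1) m]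
      mor_map_square[OF eD(1) eD'(1) eD(2) eD'(2) F1 eD'(8) eD(8) F0 FD(2) m]
    by (simp_all add: mor_edge_def)
  have unit: "eunit (mor_edge e') (?F0 p) = ?F1 (eunit (mor_edge e) p)" if p: "p \<in> pts (mor_top R TK (objs e))" for p
    using mor_map_square[OF eD(2) eD'(2) eD(1) eD'(1) F0 es'(2) es(2) F1 FD(3) p]
    by (simp add: mor_edge_def)
  obtain G where G: "has_slope (mors e) (amb (mors e')) (tau (mors e')) F\<^sub>1 G"
    by (rule smooth_map_slope[OF F1[unfolded One_nat_def]])
  note mor = mor_map_eq[OF eD(1) eD'(1) F1 G]
  have E: "tmod ?E (tau (mors e'))" by (rule tsetD(1)[OF eD'(1)])
  interpret E: module R ?E by (rule tmodD(1)[OF E])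
  have pts: "m' \<in> pts (mor_top R TK (mors e)) \<and> m \<in> pts (mor_top R TK (mors e))" if "(m', m) \<in> mor_comp e" for m' m
    using that by (simp add: mor_comp_def del: mor_top_sel)
  have F1c: "(?F1 m', ?F1 m) \<in> mor_comp e'" if c: "(m', m) \<in> mor_comp e" for m' m
  proof -
    have m: "m' \<in> pts (mor_top R TK (mors e))" "m \<in> pts (mor_top R TK (mors e))"
      using pts[OF c] by auto
    have "esrc (mor_edge e) m' = etgt (mor_edge e) m"
      using c by (simp add: mem_ecomp flip: ecomp_mor_edge)
    then show ?thesis
      using smooth_mapD(2)[OF smooth_map_mor[OF eD(1) eD'(1) F1[unfolded One_nat_def]]] src[OF m(1)] tgt[OF m(2)] m
      by (simp add: mem_ecomp flip: ecomp_mor_edge del: mor_top_sel)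
  qed
  have slope: "G (emul (mor_edge e) q) = aff ?E l' u' (G (fst q)) (G (snd q))" if q: "q \<in> mor_comp e" for q
  proof (rule mor_comp_eq_of_eq_on_Units[OF e tmodD(3)[OF E] _ _ _ q])
    note s = continuous_mor_comp_sel[of e]
    show "continuous_map (mor_comp_top e) (tau (mors e')) (\<lambda>q. aff ?E l' u' (G (fst q)) (G (snd q)))"
      using continuous_map_compose[OF s(1) has_slope_continuous[OF G]]
        continuous_map_compose[OF s(2) has_slope_continuous[OF G]]
      by (intro continuous_aff[OF e']) (simp_all add: o_def)
    note me = affine_edge_mor[OF e]
    have "continuous_map (mor_comp_top e) (tau (mor_top R TK (mors e)))
        (\<lambda>q. aff (amb (mors (mor_edge e))) (lin_mor l) (lin_mor u) (fst q) (snd q))"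
      using continuous_aff[OF me, of "mor_comp_top e" fst snd] s by (simp add: continuous_map_in_subtopology)
    then have "continuous_map (mor_comp_top e) (tau (mor_top R TK (mors e))) (emul (mor_edge e))"
      by (rule continuous_map_eq) (use affine_edgeD(9)[OF me] in \<open>auto simp: ecomp_mor_edge\<close>)
    then have "continuous_map (mor_comp_top e) (subspace (mor_top R TK (mors e))) (emul (mor_edge e))"
      by (rule continuous_map_into_subtopology)
        (use affine_edgeD(10)[OF me] in \<open>auto simp: ecomp_mor_edge simp del: mor_top_sel\<close>)
    from continuous_map_compose[OF this has_slope_continuous[OF G]]
    show "continuous_map (mor_comp_top e) (tau (mors e')) (\<lambda>q. G (emul (mor_edge e) q))"
      by (simp add: o_def)
    fix p' w' p w t
    assume c: "(Mor (p', w', t), Mor (p, w, t)) \<in> mor_comp e" and t: "t \<in> Units R"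
    have m': "Mor (p', w', t) \<in> pts (mor_top R TK (mors e))" and m: "Mor (p, w, t) \<in> pts (mor_top R TK (mors e))"
      using pts[OF c] by auto
    have ec: "(p', p) \<in> ecomp e"
      and ec': "(p' \<oplus>\<^bsub>amb (mors e)\<^esub> (t \<odot>\<^bsub>amb (mors e)\<^esub> w'), p \<oplus>\<^bsub>amb (mors e)\<^esub> (t \<odot>\<^bsub>amb (mors e)\<^esub> w)) \<in> ecomp e"
      using mor_compE[OF e c] by (metis pt.inject(3) prod.inject)+
    have c': "(Mor (F\<^sub>1 p', G (Mor (p', w', t)), t), Mor (F\<^sub>1 p, G (Mor (p, w, t)), t)) \<in> mor_comp e'"
      using F1c[OF c] by (simp add: mor[OF m] mor[OF m'])
    note line = emul_line[OF e c] and line' = emul_line[OF e' c']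
    note mul = emul_mor_edge[OF e c]
    have tc: "t \<in> carrier R" using t by (simp add: R.Units_closed)
    have mm: "emul (mor_edge e) (Mor (p', w', t), Mor (p, w, t)) \<in> pts (mor_top R TK (mors e))"
      unfolding mul by (rule line(3))
    have g: "G (emul (mor_edge e) (Mor (p', w', t), Mor (p, w, t))) \<in> carrier ?E"
      by (rule has_slope_carrier[OF eD(1) E G mm])
    have car: "emul e' (F\<^sub>1 p', F\<^sub>1 p) \<in> carrier ?E"
      "aff ?E l' u' (G (Mor (p', w', t))) (G (Mor (p, w, t))) \<in> carrier ?E"
      using tsetD(5)[OF eD'(1) line'(2)] Mor_ptsD(2)[OF line'(3)] by auto
    \<comment> \<open>The image under \<open>F\<^sub>1\<close> of the product at the far ends is
      expanded in two ways: by the slope equation along the line of products in \<open>e\<close>,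
      and by preservation of that product followed by linearity of the product along the image line
      in \<open>e'\<close>.\<close>
    have "emul e' (F\<^sub>1 p', F\<^sub>1 p) \<oplus>\<^bsub>?E\<^esub> (t \<odot>\<^bsub>?E\<^esub> G (emul (mor_edge e) (Mor (p', w', t), Mor (p, w, t))))
        = F\<^sub>1 (emul e (p', p) \<oplus>\<^bsub>amb (mors e)\<^esub> (t \<odot>\<^bsub>amb (mors e)\<^esub> aff (amb (mors e)) l u w' w))"
      unfolding has_slopeD[OF G line(3)] mul FD(4)[OF ec] ..
    also have "\<dots> = emul e' (F\<^sub>1 p' \<oplus>\<^bsub>?E\<^esub> (t \<odot>\<^bsub>?E\<^esub> G (Mor (p', w', t))), F\<^sub>1 p \<oplus>\<^bsub>?E\<^esub> (t \<odot>\<^bsub>?E\<^esub> G (Mor (p, w, t))))"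
      using FD(4)[OF ec'] by (simp add: line(1) has_slopeD[OF G m] has_slopeD[OF G m'])
    also have "\<dots> = emul e' (F\<^sub>1 p', F\<^sub>1 p)
        \<oplus>\<^bsub>?E\<^esub> (t \<odot>\<^bsub>?E\<^esub> aff ?E l' u' (G (Mor (p', w', t))) (G (Mor (p, w, t))))"
      by (rule line'(1))
    finally have "t \<odot>\<^bsub>?E\<^esub> G (emul (mor_edge e) (Mor (p', w', t), Mor (p, w, t)))
        = t \<odot>\<^bsub>?E\<^esub> aff ?E l' u' (G (Mor (p', w', t))) (G (Mor (p, w, t)))"
      using car g tc by simp
    then show "G (emul (mor_edge e) (Mor (p', w', t), Mor (p, w, t)))
        = aff ?E l' u' (G (fst (Mor (p', w', t), Mor (p, w, t)))) (G (snd (Mor (p', w', t), Mor (p, w, t))))"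
      using car g by (simp add: Units_smult_cancel[OF E.module_axioms t])
  qed
  have "emul (mor_edge e') (?F1 m', ?F1 m) = ?F1 (emul (mor_edge e) (m', m))"
    if c: "(m', m) \<in> ecomp (mor_edge e)" for m' m
  proof -
    have c: "(m', m) \<in> mor_comp e" using c by (simp add: ecomp_mor_edge)
    obtain p' w' p w s where mm: "m' = Mor (p', w', s)" "m = Mor (p, w, s)"
      and m: "Mor (p', w', s) \<in> pts (mor_top R TK (mors e))" "Mor (p, w, s) \<in> pts (mor_top R TK (mors e))"
      and ec: "(p', p) \<in> ecomp e"
      using mor_compE[OF e c] by metis
    note c = c[unfolded mm]
    have c': "(Mor (F\<^sub>1 p', G (Mor (p', w', s)), s), Mor (F\<^sub>1 p, G (Mor (p, w, s)), s)) \<in> mor_comp e'"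
      using F1c[OF c] by (simp add: mor[OF m(1)] mor[OF m(2)])
    have pos: "emul (mor_edge e) (Mor (p', w', s), Mor (p, w, s)) \<in> pts (mor_top R TK (mors e))"
      unfolding emul_mor_edge[OF e c] by (rule emul_line(3)[OF e c])
    have "?F1 (emul (mor_edge e) (m', m))
        = Mor (F\<^sub>1 (emul e (p', p)), G (emul (mor_edge e) (Mor (p', w', s), Mor (p, w, s))), s)"
      using mor[OF pos] by (simp add: mm emul_mor_edge[OF e c])
    also have "\<dots> = Mor (emul e' (F\<^sub>1 p', F\<^sub>1 p), aff ?E l' u' (G (Mor (p', w', s))) (G (Mor (p, w, s))), s)"
      using slope[OF c] FD(4)[OF ec] by simp
    also have "\<dots> = emul (mor_edge e') (?F1 m', ?F1 m)"
      unfolding mm mor[OF m(1)] mor[OF m(2)] using emul_mor_edge[OF e' c'] by simp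
    finally show ?thesis ..
  qed
  then show ?thesis
    unfolding edge_morph_def mor_edge_sel using src tgt unit by blast
qed

end


section \<open>The vertex maps\<close>

context tdc
begin

lemma top_G_simps [simp]:
  "top_G R TK {k} k S = mor_top R TK S" "top_G R TK {} k S = obj_top R TK S"
  by (simp_all add: top_G_def)

lemma top_map_G_simps [simp]:
  "top_map_G R TK {k} k F = mor_tmap R TK F" "top_map_G R TK {} k F = obj_tmap R TK F"
  by (simp_all add: top_map_G_def)

primrec nedge :: "('k, ('v, 'k) pt) tlinset \<Rightarrow> nat list \<Rightarrow> nat set \<Rightarrow> nat \<Rightarrow> ('v, 'k) edge" where
  "nedge S [] \<beta> i = undefined"
| "nedge S (a # L) \<beta> i =
    (if i = a then base_edge (tvertex R TK L S \<beta>)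
     else if a \<in> \<beta> then mor_edge (nedge S L (\<beta> - {a}) i)
     else obj_edge (nedge S L \<beta> i))"

text \<open>All components are identified at once, because through \<open>ncomp\<close> the product
  refers to the vertices and to the source and target maps of the same stage.\<close>

lemma nedge_sel_conj:
  "distinct L \<Longrightarrow> i \<in> set L \<Longrightarrow> i \<notin> \<beta> \<Longrightarrow>
    mors (nedge S L \<beta> i) = tvertex R TK L S (insert i \<beta>)
    \<and> objs (nedge S L \<beta> i) = tvertex R TK L S \<beta>
    \<and> esrc (nedge S L \<beta> i) = nsrc R TK S L \<beta> i
    \<and> etgt (nedge S L \<beta> i) = ntgt R TK S L \<beta> i
    \<and> eunit (nedge S L \<beta> i) = nunit R TK S L \<beta> i
    \<and> emul (nedge S L \<beta> i) = nmul R TK S L \<beta> i"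
proof (induction L arbitrary: \<beta>)
  case (Cons a L)
  show ?case
  proof (cases "i = a")
    case True
    then show ?thesis
      using Cons.prems by (auto simp: base_edge_def  Let_def)
  next
    case i: False
    then have iL: "distinct L" "i \<in> set L" using Cons.prems by auto
    show ?thesis
    proof (cases "a \<in> \<beta>")
      case a: True
      define e where "e = nedge S L (\<beta> - {a}) i"
      have "i \<notin> \<beta> - {a}" using Cons.prems by simp
      from Cons.IH[OF iL this, folded e_def]
      have IH: "mors e = tvertex R TK L S (insert i (\<beta> - {a}))" "objs e = tvertex R TK L S (\<beta> - {a})"
        "esrc e = nsrc R TK S L (\<beta> - {a}) i" "etgt e = ntgt R TK S L (\<beta> - {a}) i"
        "eunit e = nunit R TK S L (\<beta> - {a}) i" "emul e = nmul R TK S L (\<beta> - {a}) i"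
        by auto
      have v: "tvertex R TK (a # L) S (insert i \<beta>) = mor_top R TK (mors e)"
        "tvertex R TK (a # L) S \<beta> = mor_top R TK (objs e)"
        using a i by (simp_all add: IH insert_Diff_if)
      have s: "nsrc R TK S (a # L) \<beta> i = mor_map R TK (mors e) (objs e) (esrc e)"
        "ntgt R TK S (a # L) \<beta> i = mor_map R TK (mors e) (objs e) (etgt e)"
        "nunit R TK S (a # L) \<beta> i = mor_map R TK (objs e) (mors e) (eunit e)"
        using a i by (simp_all add: IH angle_def Let_def)
      have c: "ncomp R TK S (a # L) \<beta> i = mor_comp e"
        unfolding ncomp_def mor_comp_def v s ..
      have "nmul R TK S (a # L) \<beta> i = emul (mor_edge e)"
        using a i by (simp add: c Let_def mor_edge_def mor_comp_triples_def IH)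
      then show ?thesis
        using a i unfolding v s by (simp add: mor_edge_def flip: e_def)
    next
      case a: False
      define e where "e = nedge S L \<beta> i"
      note IH = Cons.IH[OF iL Cons.prems(3), folded e_def]
      show ?thesis
        using a i
        by (simp add: obj_edge_def IH angle_def Let_def insert_Diff_if flip: e_def)
    qed
  qed
qed simp

lemma nedge_sel:
  assumes "distinct L" and "i \<in> set L" and "i \<notin> \<beta>"
  shows "mors (nedge S L \<beta> i) = tvertex R TK L S (insert i \<beta>)"
    and "objs (nedge S L \<beta> i) = tvertex R TK L S \<beta>"
    and "esrc (nedge S L \<beta> i) = nsrc R TK S L \<beta> i"
    and "etgt (nedge S L \<beta> i) = ntgt R TK S L \<beta> i"
    and "eunit (nedge S L \<beta> i) = nunit R TK S L \<beta> i"
    and "emul (nedge S L \<beta> i) = nmul R TK S L \<beta> i"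
  using nedge_sel_conj[OF assms] by auto

lemma ncomp_eq_ecomp:
  assumes "distinct L" and "i \<in> set L" and "i \<notin> \<beta>"
  shows "ncomp R TK S L \<beta> i = ecomp (nedge S L \<beta> i)"
  unfolding ncomp_def ecomp_def nedge_sel[OF assms] ..

lemma nfold_morphism_iff:
  assumes "distinct L"
  shows "nfold_morphism R TK L S S' \<Phi> \<longleftrightarrow>
    (\<forall>\<beta> i. \<beta> \<subseteq> set L \<and> i \<in> set L \<and> i \<notin> \<beta> \<longrightarrow>
      edge_morph (nedge S L \<beta> i) (nedge S' L \<beta> i) (\<Phi> \<beta>) (\<Phi> (insert i \<beta>)))"
proof -
  have eq: "edge_morph (nedge S L \<beta> i) (nedge S' L \<beta> i) (\<Phi> \<beta>) (\<Phi> (insert i \<beta>)) \<longleftrightarrow>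
      (\<forall>m \<in> pts (tvertex R TK L S (insert i \<beta>)).
         nsrc R TK S' L \<beta> i (\<Phi> (insert i \<beta>) m) = \<Phi> \<beta> (nsrc R TK S L \<beta> i m)
         \<and> ntgt R TK S' L \<beta> i (\<Phi> (insert i \<beta>) m) = \<Phi> \<beta> (ntgt R TK S L \<beta> i m))
      \<and> (\<forall>p \<in> pts (tvertex R TK L S \<beta>).
         nunit R TK S' L \<beta> i (\<Phi> \<beta> p) = \<Phi> (insert i \<beta>) (nunit R TK S L \<beta> i p))
      \<and> (\<forall>(m', m) \<in> ncomp R TK S L \<beta> i.
         nmul R TK S' L \<beta> i (\<Phi> (insert i \<beta>) m', \<Phi> (insert i \<beta>) m)
           = \<Phi> (insert i \<beta>) (nmul R TK S L \<beta> i (m', m)))"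
    if "i \<in> set L" "i \<notin> \<beta>" for \<beta> i
    unfolding edge_morph_def nedge_sel[OF assms that] ncomp_eq_ecomp[OF assms that] ..
  show ?thesis
    unfolding nfold_morphism_def by (intro iff_allI imp_cong refl eq[symmetric]) auto
qed

lemma tset_tvertex: "tset S \<Longrightarrow> tset (tvertex R TK L S \<beta>)"
  by (induction L arbitrary: \<beta>) (auto intro: tset_mor tset_obj)

lemma affine_nedge:
  assumes S: "tset S" and "distinct L" and "i \<in> set L" and "i \<notin> \<beta>"
  shows "\<exists>l u. affine_edge (nedge S L \<beta> i) l u"
  using assms(2-)
proof (induction L arbitrary: \<beta>)
  case (Cons a L)
  show ?case
  proof (cases "i = a")
    case True
    then show ?thesis using affine_edge_base[OF tset_tvertex[OF S]] by auto
  next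
    case i: False
    then show ?thesis
      using Cons.IH[of "\<beta> - {a}"] Cons.IH[of \<beta>] Cons.prems affine_edge_mor affine_edge_obj
      by (cases "a \<in> \<beta>") (simp_all, blast+)
  qed
qed simp

section \<open>The vertex maps, and their characterisation\<close>

primrec vertex_map ::
    "('k, ('v, 'k) pt) tlinset \<Rightarrow> ('k, ('w, 'k) pt) tlinset \<Rightarrow> (('v, 'k) pt \<Rightarrow> ('w, 'k) pt) \<Rightarrow>
     nat list \<Rightarrow> nat set \<Rightarrow> ('v, 'k) pt \<Rightarrow> ('w, 'k) pt" where
  "vertex_map S S' f [] \<alpha> = f"
| "vertex_map S S' f (a # L) \<alpha> =
    (if a \<in> \<alpha> then mor_map R TK (tvertex R TK L S (\<alpha> - {a})) (tvertex R TK L S' (\<alpha> - {a}))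
       (vertex_map S S' f L (\<alpha> - {a}))
     else obj_map (vertex_map S S' f L \<alpha>))"

lemma vertex_top_map_G:
  "vertex (top_map_G R TK) L (S, S', f) \<alpha> = (tvertex R TK L S \<alpha>, tvertex R TK L S' \<alpha>, vertex_map S S' f L \<alpha>)"
  by (induction L arbitrary: \<alpha>) (simp_all)

text \<open>One order is charged per label, whether or not it lies in \<alpha>. The order
  \<open>n\<close> is left arbitrary because the induction step needs one order more for the shorter
  list.\<close>

lemma smooth_vertex_map:
  assumes S: "tset S" and S': "tset S'" and "smooth_map (length L + n) S S' f"
  shows "smooth_map n (tvertex R TK L S \<alpha>) (tvertex R TK L S' \<alpha>) (vertex_map S S' f L \<alpha>)"
  using assms(3)
proof (induction L arbitrary: n \<alpha>)
  case (Cons a L)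
  have "smooth_map (Suc n) (tvertex R TK L S \<gamma>) (tvertex R TK L S' \<gamma>) (vertex_map S S' f L \<gamma>)" for \<gamma>
    using Cons.prems by (intro Cons.IH) simp
  from smooth_map_mor[OF tset_tvertex[OF S] tset_tvertex[OF S'] this]
    smooth_map_obj[OF tset_tvertex[OF S] tset_tvertex[OF S'] smooth_map_mono[OF this, of n]]
  show ?case by (simp)
qed simp

text \<open>Order \<open>length (a # L)\<close> leaves order one for the vertex maps of
  \<open>L\<close>, which is what both \<open>edge_morph_base\<close>, in the direction
  \<open>a\<close>, and \<open>edge_morph_mor\<close>, in the other directions, require.\<close>

lemma edge_morph_vertex_map:
  assumes S: "tset S" and S': "tset S'" and "smooth_map (length L) S S' f"
    and "distinct L" and "i \<in> set L" and "i \<notin> \<beta>"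
  shows "edge_morph (nedge S L \<beta> i) (nedge S' L \<beta> i) (vertex_map S S' f L \<beta>) (vertex_map S S' f L (insert i \<beta>))"
  using assms(3-)
proof (induction L arbitrary: \<beta>)
  case (Cons a L)
  have f: "smooth_map (length L) S S' f" by (rule smooth_map_mono[OF Cons.prems(1)]) simp
  have sm: "smooth_map 1 (tvertex R TK L S \<gamma>) (tvertex R TK L S' \<gamma>) (vertex_map S S' f L \<gamma>)" for \<gamma>
    using Cons.prems(1) by (intro smooth_vertex_map[OF S S']) simp
  show ?case
  proof (cases "i = a")
    case True
    then show ?thesis
      using Cons.prems edge_morph_base[OF tset_tvertex[OF S] tset_tvertex[OF S'] sm] by simp
  next
    case i: False
    then have iL: "distinct L" "i \<in> set L" using Cons.prems by auto
    show ?thesis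
    proof (cases "a \<in> \<beta>")
      case a: True
      have i': "i \<notin> \<beta> - {a}" using Cons.prems by simp
      obtain l u l' u' where "affine_edge (nedge S L (\<beta> - {a}) i) l u" "affine_edge (nedge S' L (\<beta> - {a}) i) l' u'"
        using affine_nedge[OF S iL i'] affine_nedge[OF S' iL i'] by blast
      from edge_morph_mor[OF this _ _ Cons.IH[OF f iL i']] sm
      show ?thesis
        using a i by (simp add: nedge_sel[OF iL i'] insert_Diff_if)
    next
      case a: False
      then show ?thesis
        using i edge_morph_obj[OF Cons.IH[OF f iL Cons.prems(4)]] by simp
    qed
  qed
qed simp

text \<open>Allows the vertex maps to be replaced by their restrictions to the points: the structure
  maps of an affine edge send points to points and composable pairs to points, so all values
  involved are taken there.\<close>

lemma edge_morph_cong: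
  assumes e: "affine_edge e l u" and F: "edge_morph e e' F\<^sub>0 F\<^sub>1"
    and G0: "\<And>p. p \<in> pts (objs e) \<Longrightarrow> G\<^sub>0 p = F\<^sub>0 p" and G1: "\<And>m. m \<in> pts (mors e) \<Longrightarrow> G\<^sub>1 m = F\<^sub>1 m"
  shows "edge_morph e e' G\<^sub>0 G\<^sub>1"
proof -
  note eD = affine_edgeD[OF e]
  have "esrc e m \<in> pts (objs e)" "etgt e m \<in> pts (objs e)" if "m \<in> pts (mors e)" for m
    using smooth_mapD(2)[OF affine_edge_smooth(1)[OF e] that] smooth_mapD(2)[OF eD(8) that] by auto
  moreover have "eunit e p \<in> pts (mors e)" if "p \<in> pts (objs e)" for p
    using smooth_mapD(2)[OF affine_edge_smooth(2)[OF e] that] .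
  ultimately show ?thesis
    using edge_morphD[OF F] eD(10) by (auto simp: edge_morph_def G0 G1 mem_ecomp)
qed

lemma base_edge_morph_unique:
  assumes S: "tset S" and S': "tset S'"
    and g: "continuous_map (subspace (mor_top R TK S)) (subspace (mor_top R TK S')) g"
    and h: "continuous_map (subspace (mor_top R TK S)) (subspace (mor_top R TK S')) h"
    and F: "\<And>x t. x \<in> pts S \<Longrightarrow> t \<in> carrier R \<Longrightarrow> F (Obj (x, t)) = Obj (f x, t)"
    and gF: "\<And>m. m \<in> pts (mor_top R TK S) \<Longrightarrow>
      esrc (base_edge S') (g m) = F (esrc (base_edge S) m) \<and> etgt (base_edge S') (g m) = F (etgt (base_edge S) m)"
    and hF: "\<And>m. m \<in> pts (mor_top R TK S) \<Longrightarrow>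
      esrc (base_edge S') (h m) = F (esrc (base_edge S) m) \<and> etgt (base_edge S') (h m) = F (etgt (base_edge S) m)"
    and m: "m \<in> pts (mor_top R TK S)"
  shows "g m = h m"
proof (rule mor_eq_of_eq_on_Units[OF S tmodD(3)[OF tsetD(1)[OF tset_mor[OF S']]] _ _ _ m])
  show "continuous_map (subspace (mor_top R TK S)) (tau (mor_top R TK S')) g"
    "continuous_map (subspace (mor_top R TK S)) (tau (mor_top R TK S')) h"
    using g h by (simp_all add: continuous_map_in_subtopology)
  fix x v t assume m: "Mor (x, v, t) \<in> pts (mor_top R TK S)" and t: "t \<in> Units R"
  note d = Mor_ptsD[OF m]
  interpret E: module R "amb S'" by (rule tsetD(2)[OF S'])
  have "g (Mor (x, v, t)) \<in> pts (mor_top R TK S')" "h (Mor (x, v, t)) \<in> pts (mor_top R TK S')"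
    using g h m topspace_subspace[OF tset_mor[OF S]] topspace_subspace[OF tset_mor[OF S']]
    by (auto simp: continuous_map_def Pi_iff simp del: mor_top_sel)
  then obtain y w r y' w' r' where gh: "g (Mor (x, v, t)) = Mor (y, w, r)" "h (Mor (x, v, t)) = Mor (y', w', r')"
    and w: "y \<in> pts S'" "w \<in> carrier (amb S')" "w' \<in> carrier (amb S')"
    by (metis mor_ptsE)
  have yc: "y \<in> carrier (amb S')" using tsetD(5)[OF S' w(1)] .
  have eq: "y = f x" "r = t" "y' = f x" "r' = t"
    "y \<oplus>\<^bsub>amb S'\<^esub> (t \<odot>\<^bsub>amb S'\<^esub> w) = y \<oplus>\<^bsub>amb S'\<^esub> (t \<odot>\<^bsub>amb S'\<^esub> w')"
    using gF[OF m] hF[OF m] F d by (auto simp: gh base_edge_def)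
  have "t \<odot>\<^bsub>amb S'\<^esub> w = t \<odot>\<^bsub>amb S'\<^esub> w'"
    using eq(5) yc w d(3) by simp
  then have "w = w'"
    by (rule Units_smult_cancel[OF E.module_axioms t w(2,3)])
  then show "g (Mor (x, v, t)) = h (Mor (x, v, t))"
    by (simp add: gh eq)
qed

text \<open>Extensional in the vertex and in the point, as is demanded of the families among which
  \<open>nfold_map\<close> is the definite description.\<close>

definition restricted_vertex_map ::
    "('k, ('v, 'k) pt) tlinset \<Rightarrow> ('k, ('w, 'k) pt) tlinset \<Rightarrow> (('v, 'k) pt \<Rightarrow> ('w, 'k) pt) \<Rightarrow>
     nat list \<Rightarrow> nat set \<Rightarrow> ('v, 'k) pt \<Rightarrow> ('w, 'k) pt" where
  "restricted_vertex_map S S' f L =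
    (\<lambda>\<alpha> \<in> Pow (set L). restrict (vertex_map S S' f L \<alpha>) (pts (tvertex R TK L S \<alpha>)))"

lemma restricted_vertex_map_apply:
  "\<alpha> \<subseteq> set L \<Longrightarrow> p \<in> pts (tvertex R TK L S \<alpha>) \<Longrightarrow>
    restricted_vertex_map S S' f L \<alpha> p = vertex_map S S' f L \<alpha> p"
  by (simp add: restricted_vertex_map_def)

text \<open>That the composites qualify is \<open>edge_morph_vertex_map\<close>. For uniqueness, a
  vertex without \<open>a\<close> is prescribed by the shorter list, and a vertex with
  \<open>a\<close> is the morphism end of the edge from \<alpha>\<open>- {a}\<close>, to which
  \<open>base_edge_morph_unique\<close> applies.\<close>

lemma nfold_map_eq:
  assumes S: "tset S" and S': "tset S'" and "smooth_map (length L) S S' f" and "distinct L"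
  shows "nfold_map R TK L S S' f = restricted_vertex_map S S' f L"
  using assms(3-)
proof (induction L)
  case Nil
  then show ?case by (simp add: restricted_vertex_map_def)
next
  case (Cons a L)
  let ?K = "a # L" and ?\<Psi> = "restricted_vertex_map S S' f (a # L)"
  note f = Cons.prems(1) and L = Cons.prems(2)
  have IH: "nfold_map R TK L S S' f = restricted_vertex_map S S' f L"
    using L by (intro Cons.IH smooth_map_mono[OF f]) auto
  note v = tset_tvertex[OF S] and v' = tset_tvertex[OF S']
  have sm: "smooth_map 0 (tvertex R TK ?K S \<alpha>) (tvertex R TK ?K S' \<alpha>) (vertex_map S S' f ?K \<alpha>)" for \<alpha>
    using f by (intro smooth_vertex_map[OF S S']) simp
  have pi: "?\<Psi> \<in> (\<Pi>\<^sub>E \<alpha> \<in> Pow (set ?K). pts (tvertex R TK ?K S \<alpha>) \<rightarrow>\<^sub>E pts (tvertex R TK ?K S' \<alpha>))"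
    unfolding restricted_vertex_map_def by (intro restrict_PiE_iff[THEN iffD2] ballI smooth_mapD(2)[OF sm])
  have cont: "continuous_map (subspace (tvertex R TK ?K S \<alpha>)) (subspace (tvertex R TK ?K S' \<alpha>)) (?\<Psi> \<alpha>)"
    if "\<alpha> \<subseteq> set ?K" for \<alpha>
    by (rule continuous_map_eq[OF smooth_map_continuous[OF v sm]])
      (simp only: topspace_subspace[OF v] restricted_vertex_map_apply[OF that])
  have morph: "edge_morph (nedge S ?K \<beta> i) (nedge S' ?K \<beta> i) (?\<Psi> \<beta>) (?\<Psi> (insert i \<beta>))"
    if b: "\<beta> \<subseteq> set ?K" "i \<in> set ?K" "i \<notin> \<beta>" for \<beta> i
  proof -
    obtain l u where "affine_edge (nedge S ?K \<beta> i) l u"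
      using affine_nedge[OF S L b(2,3)] by blast
    then show ?thesis
      by (rule edge_morph_cong[OF _ edge_morph_vertex_map[OF S S' f L b(2,3)]])
        (use b in \<open>simp_all add: nedge_sel[OF L b(2,3)] restricted_vertex_map_apply del: vertex_map.simps vertex.simps nedge.simps\<close>)
  qed
  have base: "?\<Psi> \<alpha> (Obj (p, t)) = Obj (nfold_map R TK L S S' f \<alpha> p, t)"
    if "\<alpha> \<subseteq> set L" "p \<in> pts (tvertex R TK L S \<alpha>)" "t \<in> carrier R" for \<alpha> p t
  proof -
    have "a \<notin> \<alpha>" using that L by auto
    then have "Obj (p, t) \<in> pts (tvertex R TK ?K S \<alpha>)" using that by (simp)
    then have "?\<Psi> \<alpha> (Obj (p, t)) = vertex_map S S' f ?K \<alpha> (Obj (p, t))"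
      using that by (intro restricted_vertex_map_apply) auto
    then show ?thesis
      using that \<open>a \<notin> \<alpha>\<close> by (simp add: IH restricted_vertex_map_apply)
  qed
  show ?case
    unfolding nfold_map.simps(2)
  proof (rule the_equality)
    show "?\<Psi> \<in> (\<Pi>\<^sub>E \<alpha> \<in> Pow (set ?K). pts (tvertex R TK ?K S \<alpha>) \<rightarrow>\<^sub>E pts (tvertex R TK ?K S' \<alpha>))
      \<and> (\<forall>\<alpha> \<subseteq> set ?K.
           continuous_map (subspace (tvertex R TK ?K S \<alpha>)) (subspace (tvertex R TK ?K S' \<alpha>)) (?\<Psi> \<alpha>))
      \<and> nfold_morphism R TK ?K S S' ?\<Psi>
      \<and> (\<forall>\<alpha> \<subseteq> set L. \<forall>p \<in> pts (tvertex R TK L S \<alpha>). \<forall>t \<in> carrier R.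
           ?\<Psi> \<alpha> (Obj (p, t)) = Obj (nfold_map R TK L S S' f \<alpha> p, t))"
      unfolding nfold_morphism_iff[OF L]
      by (intro conjI allI impI ballI; (elim conjE)?)
        (rule pi | rule cont, assumption | rule morph, assumption+ | rule base, assumption+)+
  next
    fix \<Phi>
    assume \<Phi>: "\<Phi> \<in> (\<Pi>\<^sub>E \<alpha> \<in> Pow (set ?K). pts (tvertex R TK ?K S \<alpha>) \<rightarrow>\<^sub>E pts (tvertex R TK ?K S' \<alpha>))
      \<and> (\<forall>\<alpha> \<subseteq> set ?K.
           continuous_map (subspace (tvertex R TK ?K S \<alpha>)) (subspace (tvertex R TK ?K S' \<alpha>)) (\<Phi> \<alpha>))
      \<and> nfold_morphism R TK ?K S S' \<Phi>
      \<and> (\<forall>\<alpha> \<subseteq> set L. \<forall>p \<in> pts (tvertex R TK L S \<alpha>). \<forall>t \<in> carrier R.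
           \<Phi> \<alpha> (Obj (p, t)) = Obj (nfold_map R TK L S S' f \<alpha> p, t))"
    note \<Phi>' = conjunct2[OF \<Phi>] and \<Phi>pi = conjunct1[OF \<Phi>]
    have \<Phi>cont: "continuous_map (subspace (tvertex R TK ?K S \<alpha>)) (subspace (tvertex R TK ?K S' \<alpha>)) (\<Phi> \<alpha>)"
      if "\<alpha> \<subseteq> set ?K" for \<alpha>
      using conjunct1[OF \<Phi>'] that by blast
    have \<Phi>morph: "edge_morph (nedge S ?K \<beta> i) (nedge S' ?K \<beta> i) (\<Phi> \<beta>) (\<Phi> (insert i \<beta>))"
      if "\<beta> \<subseteq> set ?K" "i \<in> set ?K" "i \<notin> \<beta>" for \<beta> i
      using conjunct1[OF conjunct2[OF \<Phi>']] that unfolding nfold_morphism_iff[OF L] by blast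
    have \<Phi>base: "\<Phi> \<alpha> (Obj (p, t)) = Obj (nfold_map R TK L S S' f \<alpha> p, t)"
      if "\<alpha> \<subseteq> set L" "p \<in> pts (tvertex R TK L S \<alpha>)" "t \<in> carrier R" for \<alpha> p t
      using conjunct2[OF conjunct2[OF \<Phi>']] that by blast
    have eq: "\<Phi> \<alpha> p = ?\<Psi> \<alpha> p" if \<alpha>: "\<alpha> \<subseteq> set ?K" and p: "p \<in> pts (tvertex R TK ?K S \<alpha>)" for \<alpha> p
    proof (cases "a \<in> \<alpha>")
      case False
      then have "\<alpha> \<subseteq> set L" using \<alpha> by auto
      moreover obtain x t where "p = Obj (x, t)" "x \<in> pts (tvertex R TK L S \<alpha>)" "t \<in> carrier R"
        using p False by auto
      ultimately show ?thesis
        using base \<Phi>base by simp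
    next
      case True
      define \<gamma> where "\<gamma> = \<alpha> - {a}"
      have \<gamma>: "\<gamma> \<subseteq> set L" "\<gamma> \<subseteq> set ?K" "a \<in> set ?K" "a \<notin> \<gamma>" and \<alpha>\<gamma>: "\<alpha> = insert a \<gamma>"
        using True \<alpha> by (auto simp: \<gamma>_def)
      \<comment> \<open>The type of \<open>T\<close> is left open so that the fact serves for the
        domain and for the codomain, whose points have different types.\<close>
      have va: "tvertex R TK ?K T \<alpha> = mor_top R TK (tvertex R TK L T \<gamma>)"
        for T :: "('k, ('x, 'k) pt) tlinset"
        using True by (simp add:  \<gamma>_def)
      have ne: "nedge T ?K \<gamma> a = base_edge (tvertex R TK L T \<gamma>)" for T :: "('k, ('x, 'k) pt) tlinset"
        by simp
      note m\<Phi> = \<Phi>morph[OF \<gamma>(2-4), unfolded ne, folded \<alpha>\<gamma>]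
        and m\<Psi> = morph[OF \<gamma>(2-4), unfolded ne, folded \<alpha>\<gamma>]
      let ?S = "tvertex R TK L S \<gamma>" and ?S' = "tvertex R TK L S' \<gamma>"
      have agree: "\<Phi> \<gamma> (Obj (x, t)) = ?\<Psi> \<gamma> (Obj (x, t))" if "x \<in> pts ?S" "t \<in> carrier R" for x t
        using base[OF \<gamma>(1) that] \<Phi>base[OF \<gamma>(1) that] by simp
      have objs: "esrc (base_edge ?S) m \<in> pts (obj_top R TK ?S) \<and> etgt (base_edge ?S) m \<in> pts (obj_top R TK ?S)"
        if "m \<in> pts (mor_top R TK ?S)" for m
        using that by (auto simp: base_edge_def dom1_def)
      have st: "\<Phi> \<gamma> (esrc (base_edge ?S) m) = ?\<Psi> \<gamma> (esrc (base_edge ?S) m)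
          \<and> \<Phi> \<gamma> (etgt (base_edge ?S) m) = ?\<Psi> \<gamma> (etgt (base_edge ?S) m)"
        if "m \<in> pts (mor_top R TK ?S)" for m
        using objs[OF that] agree by auto
      show ?thesis
      proof (rule base_edge_morph_unique[OF v v', where F = "?\<Psi> \<gamma>" and f = "nfold_map R TK L S S' f \<gamma>"])
        show "continuous_map (subspace (mor_top R TK ?S)) (subspace (mor_top R TK ?S')) (\<Phi> \<alpha>)"
          using \<Phi>cont[OF \<alpha>] by (simp only: va)
        show "continuous_map (subspace (mor_top R TK ?S)) (subspace (mor_top R TK ?S')) (?\<Psi> \<alpha>)"
          using cont[OF \<alpha>] by (simp only: va)
        show "p \<in> pts (mor_top R TK ?S)"
          using p by (simp only: va)
        show "?\<Psi> \<gamma> (Obj (x, t)) = Obj (nfold_map R TK L S S' f \<gamma> x, t)" if "x \<in> pts ?S" "t \<in> carrier R" for x t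
          by (rule base[OF \<gamma>(1) that])
        fix m assume m: "m \<in> pts (mor_top R TK ?S)"
        then have m': "m \<in> pts (mors (base_edge ?S))" by simp
        show "esrc (base_edge ?S') (?\<Psi> \<alpha> m) = ?\<Psi> \<gamma> (esrc (base_edge ?S) m)
            \<and> etgt (base_edge ?S') (?\<Psi> \<alpha> m) = ?\<Psi> \<gamma> (etgt (base_edge ?S) m)"
          using edge_morphD(1,2)[OF m\<Psi> m'] by simp
        show "esrc (base_edge ?S') (\<Phi> \<alpha> m) = ?\<Psi> \<gamma> (esrc (base_edge ?S) m)
            \<and> etgt (base_edge ?S') (\<Phi> \<alpha> m) = ?\<Psi> \<gamma> (etgt (base_edge ?S) m)"
          using edge_morphD(1,2)[OF m\<Phi> m'] st[OF m] by simp
      qed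
    qed
    show "\<Phi> = ?\<Psi>"
    proof (rule PiE_ext[OF \<Phi>pi pi])
      fix \<alpha> assume \<alpha>: "\<alpha> \<in> Pow (set ?K)"
      show "\<Phi> \<alpha> = ?\<Psi> \<alpha>"
        by (rule PiE_ext[OF PiE_mem[OF \<Phi>pi \<alpha>] PiE_mem[OF pi \<alpha>] eq[OF PowD[OF \<alpha>]]])
    qed
  qed
qed

section \<open>The bottom vertex map in coordinates\<close>

lemma bottom_pt_snoc: "bottom_pt x (ts @ [t]) = Obj (bottom_pt x ts, t)"
  by (simp add: bottom_pt_def)

text \<open>The labels in \<open>L\<close> come with the last one first, while \<open>ts\<close>
  begins with the scalar of the first label. A label in front of \<open>L\<close> thus corresponds
  to a scalar at the end of \<open>ts\<close>, which is why \<open>ts\<close> is split from the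
  right.\<close>

lemma bottom_pt_mem:
  assumes "x \<in> pts S" and "set ts \<subseteq> carrier R" and "length ts = length L"
  shows "bottom_pt x ts \<in> pts (tvertex R TK L (base_top S) {})"
    and "vertex_map (base_top S) S' (base_map f) L {} (bottom_pt x ts) = bottom_pt (f x) ts"
  using assms(2,3)
proof (induction L arbitrary: ts)
  case Nil
  {
    case 1
    then show ?case using assms(1) by (simp add: bottom_pt_def base_top_def)
  next
    case 2
    then show ?case by (simp add: bottom_pt_def base_map_def)
  }
next
  case (Cons a L)
  {
    case 1
    then obtain us t where "ts = us @ [t]" by (cases ts rule: rev_cases) auto
    then show ?case using 1 Cons.IH(1)[of us] by (simp add: bottom_pt_snoc )
  next
    case 2
    then obtain us t where "ts = us @ [t]" by (cases ts rule: rev_cases) auto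
    then show ?case using 2 Cons.IH(2)[of us] by (simp add: bottom_pt_snoc)
  }
qed

lemma nfold_map_labels:
  fixes N :: "nat set"
  assumes N: "finite N" and S: "tset S" and S': "tset S'" and f: "smooth_map (card N) S S' f"
    and \<alpha>: "\<alpha> \<subseteq> N" and p: "p \<in> pts (tvertex R TK (labels N) S \<alpha>)"
  shows "nfold_map R TK (labels N) S S' f \<alpha> p = the_map (vertex (top_map_G R TK) (labels N) (S, S', f) \<alpha>) p"
  using nfold_map_eq[OF S S' _ distinct_labels, of N f] f \<alpha> p N
  by (simp add: restricted_vertex_map_apply vertex_top_map_G)

end

theorem theorem5p2:
  fixes R :: "'k ring" and N \<alpha> :: "nat set"
  assumes "cring R" and "finite N" and "\<alpha> \<subseteq> N"
  shows
    "(\<forall>S :: ('k, 'v) linset. linear_set R S \<longrightarrow>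
        vertex (lin_G R) (labels N) (base_lin S) \<alpha> = composite (lin_G R) \<alpha> N (base_lin S))
   \<and> (\<forall>TK (S :: ('k, 'v) tlinset) (S' :: ('k, 'w) tlinset) f.
        top_ring R TK \<and> Hausdorff_space TK \<and> TK closure_of Units R = carrier R
        \<and> open_set R TK S \<and> open_set R TK S'
        \<and> Cn R TK (card N) (base_top S) (base_top S') (base_map f) \<longrightarrow>
        (\<forall>p \<in> pts (tvertex R TK (labels N) (base_top S) \<alpha>).
           nfold_map R TK (labels N) (base_top S) (base_top S') (base_map f) \<alpha> p
           = the_map (composite (top_map_G R TK) \<alpha> N (base_top S, base_top S', base_map f)) p)
        \<and> (\<forall>p \<in> pts (tvertex R TK (labels N) (base_top S) N).
           nfold_map R TK (labels N) (base_top S) (base_top S') (base_map f) N p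
           = the_map ((mor_tmap R TK ^^ card N) (base_top S, base_top S', base_map f)) p)
        \<and> (\<forall>x \<in> pts S. \<forall>ts. set ts \<subseteq> carrier R \<and> length ts = card N \<longrightarrow>
           nfold_map R TK (labels N) (base_top S) (base_top S') (base_map f) {} (bottom_pt x ts)
           = bottom_pt (f x) ts))
   \<and> (\<forall>(V :: ('k, 'v) module) (W :: ('k, 'w) module) (f :: ('v, 'w, 'k, 'u) law).
        module R V \<and> module R W \<and> polynomial_law R V W f \<longrightarrow>
        law_eq R (fst (vertex (law_G R) (labels N) (base_lmap R V W f) \<alpha>))
          (the_map (vertex (law_G R) (labels N) (base_lmap R V W f) \<alpha>))
          (the_map (composite (law_G R) \<alpha> N (base_lmap R V W f)))
        \<and> law_eq R (fst (vertex (law_G R) (labels N) (base_lmap R V W f) N))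
          (the_map (vertex (law_G R) (labels N) (base_lmap R V W f) N))
          (the_map ((mor_lmap R ^^ card N) (base_lmap R V W f)))
        \<and> law_eq R (fst (vertex (law_G R) (labels N) (base_lmap R V W f) {}))
          (the_map (vertex (law_G R) (labels N) (base_lmap R V W f) {}))
          (law_times_id R (card N) (wrap_mod Base V) (wrap_mod Base W) (base_law R V W f)))"
proof (intro conjI allI impI)
  show "vertex (lin_G R) (labels N) (base_lin S) \<alpha> = composite (lin_G R) \<alpha> N (base_lin S)"
    for S :: "('k, 'v) linset"
    by (rule vertex_eq_composite)
next
  fix TK :: "'k topology" and S :: "('k, 'v) tlinset" and S' :: "('k, 'w) tlinset" and f
  assume *: "top_ring R TK \<and> Hausdorff_space TK \<and> TK closure_of Units R = carrier R
    \<and> open_set R TK S \<and> open_set R TK S'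
    \<and> Cn R TK (card N) (base_top S) (base_top S') (base_map f)"
  then interpret tdc R TK by unfold_locales auto
  have S: "tset (base_top S)" and S': "tset (base_top S')"
    using * by (auto intro: tset_base open_set_imp_tset)
  have f: "smooth_map (card N) (base_top S) (base_top S') (base_map f)"
    using * by (intro Cn_imp_smooth_map[OF S S']) auto
  note eq = nfold_map_labels[OF assms(2) S S' f]
  show "\<forall>p \<in> pts (tvertex R TK (labels N) (base_top S) \<alpha>).
      nfold_map R TK (labels N) (base_top S) (base_top S') (base_map f) \<alpha> p
      = the_map (composite (top_map_G R TK) \<alpha> N (base_top S, base_top S', base_map f)) p"
    using eq[OF assms(3)] by (simp only: vertex_eq_composite) blast
  have "top_map_G R TK {k} k = (mor_tmap R TK :: ('v, 'w, 'k) tmap \<Rightarrow> _)" for k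
    by (rule ext, rule top_map_G_simps)
  from vertex_top_eq_funpow[of "top_map_G R TK", OF this assms(2)]
  show "\<forall>p \<in> pts (tvertex R TK (labels N) (base_top S) N).
      nfold_map R TK (labels N) (base_top S) (base_top S') (base_map f) N p
      = the_map ((mor_tmap R TK ^^ card N) (base_top S, base_top S', base_map f)) p"
    using eq[of N] by simp
  show "\<forall>x \<in> pts S. \<forall>ts. set ts \<subseteq> carrier R \<and> length ts = card N \<longrightarrow>
      nfold_map R TK (labels N) (base_top S) (base_top S') (base_map f) {} (bottom_pt x ts) = bottom_pt (f x) ts"
  proof (intro ballI allI impI)
    fix x ts assume "x \<in> pts S" and ts: "set ts \<subseteq> carrier R \<and> length ts = card N"
    with bottom_pt_mem[of x S ts "labels N"] eq[of "{}" "bottom_pt x ts"]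
    show "nfold_map R TK (labels N) (base_top S) (base_top S') (base_map f) {} (bottom_pt x ts) = bottom_pt (f x) ts"
      by (simp add: vertex_top_map_G)
  qed
next
  fix V :: "('k, 'v) module" and W :: "('k, 'w) module" and f :: "('v, 'w, 'k, 'u) law"
  assume "module R V \<and> module R W \<and> polynomial_law R V W f"
  then have *: "module R V" "module R W" "polynomial_law R V W f" by auto
  show "law_eq R (fst (vertex (law_G R) (labels N) (base_lmap R V W f) \<alpha>))
      (the_map (vertex (law_G R) (labels N) (base_lmap R V W f) \<alpha>))
      (the_map (composite (law_G R) \<alpha> N (base_lmap R V W f)))"
    "law_eq R (fst (vertex (law_G R) (labels N) (base_lmap R V W f) N))
      (the_map (vertex (law_G R) (labels N) (base_lmap R V W f) N))
      (the_map ((mor_lmap R ^^ card N) (base_lmap R V W f)))"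
    "law_eq R (fst (vertex (law_G R) (labels N) (base_lmap R V W f) {}))
      (the_map (vertex (law_G R) (labels N) (base_lmap R V W f) {}))
      (law_times_id R (card N) (wrap_mod Base V) (wrap_mod Base W) (base_law R V W f))"
    by (rule law_eq_vertex[OF assms(2) *])+
qed

end
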